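(* Let $f:\overline{\mathbb C}_x\to\overline{\mathbb C}_z$ be a Belyi function (non-constant rational function) unramified outside of the set $\{0,1,\infty\}$ and such that $f(\infty)\in\{0,1,\infty\}$. Let $m_{\boldsymbol\beta}=e^{2\phi}|dz|^2$ be the unit area constant curvature metric on $\overline{\mathbb C}_z$ with conical singularities of orders $\beta_0,\beta_1,\beta_\infty$ at $0,1,\infty$, and let $f^*\phi=\phi\circ f+\log|f'|$, so that $f^*m_{\boldsymbol\beta}=e^{2f^*\phi}|dx|^2$. Let $x_1,\dots,x_n$, $n=\deg f+2$, be the preimages of $\{0,1,\infty\}$ under $f$. Then the stress-energy tensor $T_{f^*\phi}=2\bigl(\partial_x^2(f^*\phi)-(\partial_x(f^*\phi))^2\bigr)$ satisfies $$T_{f^*\phi}(x)=\sum_{k:\,x_k\ne\infty}\left(\frac{s_k}{2(x-x_k)^2}+\frac{h_k}{x-x_k}\right),\qquad T_{f^*\phi}(x)=\frac{s_k}{2x^2}+\frac{h_k}{x^3}+O(x^{-4})\ \text{ as }x\to x_k=\infty,$$ where $s_k=-(f^*\boldsymbol\beta)_k\bigl((f^*\boldsymbol\beta)_k+2\bigr)$ with $(f^*\boldsymbol\beta)_k=(\operatorname{ord}_kf+1)(\beta_{f(x_k)}+1)-1$, and the accessory parameters $h_k$ are as follows. 1. If $x_k$ is not a pole of $f$, then $$h_k=\begin{cases}\dfrac{d_k}{c_k}\,\mathfrak s_{f(x_k)}+c_k\,\mathfrak h_{f(x_k)}&\text{for }\operatorname{ord}_kf=0,\\[2mm]-\dfrac{d_k}{c_k}\,\dfrac{(f^*\boldsymbol\beta)_k((f^*\boldsymbol\beta)_k+2)}{\operatorname{ord}_kf+1}&\text{for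 }\operatorname{ord}_kf>0,\end{cases}$$ where $c_k$ and $d_k$ are the coefficients from the expansion $$f(x)-f(x_k)=c_kx^{-\operatorname{ord}_kf-1}\left(1+\frac{d_k}{c_k}\frac1x+O(x^{-2})\right),\quad x\to x_k=\infty,$$ if $x_k=\infty$, or $$f(x)-f(x_k)=c_k(x-x_k)^{\operatorname{ord}_kf+1}\left(1+\frac{d_k}{c_k}(x-x_k)+O((x-x_k)^2)\right),\quad x\to x_k\ne\infty,$$ if $x_k\ne\infty$. 2. If $x_k$ is a pole of $f$, then $$h_k=\begin{cases}-\dfrac{d_k}{c_k}\,\mathfrak s_\infty+\dfrac1{c_k}\,\mathfrak h_\infty&\text{for }\operatorname{ord}_kf=0,\\[2mm]\dfrac{d_k}{c_k}\,\dfrac{(f^*\boldsymbol\beta)_k((f^*\boldsymbol\beta)_k+2)}{\operatorname{ord}_kf+1}&\text{for }\operatorname{ord}_kf>0,\end{cases}$$ where $c_k$ and $d_k$ are the coefficients from the expansion $$f(x)=c_kx^{\operatorname{ord}_kf+1}\left(1+\frac{d_k}{c_k}\frac1x+O(x^{-2})\right),\quad x\to x_k=\infty,$$ if $x_k=\infty$, or $$f(x)=c_k(x-x_k)^{-\operatorname{ord}_kf-1}\left(1+\frac{d_k}{c_k}(x-x_k)+O((x-x_k)^2)\right),\quad x\to x_k\ne\infty,$$ if $x_k\ne\infty$. Here $\mathfrak s_j=-\beta_j(2+\beta_j)$ for $j\in\{0,1,\infty\}$ and $$\mathfrak h_0=-\mathfrak h_1=\frac{\mathfrak s_0+\mathfrak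 s_1-\mathfrak s_\infty}2,\qquad\mathfrak h_\infty=\frac{\mathfrak s_1+\mathfrak s_\infty-\mathfrak s_0}2.$$
   Context: For $\beta_0,\beta_1,\beta_\infty\in(-1,0]$ put $|\boldsymbol\beta|=\beta_0+\beta_1+\beta_\infty$ and assume $\beta_j-|\boldsymbol\beta|/2>0$ for $j\in\{0,1,\infty\}$ (condition for existence of the metric). $m_{\boldsymbol\beta}=e^{2\phi}|dz|^2$ denotes the unique conformal metric of total area one on $\overline{\mathbb C}_z=\mathbb C\cup\{\infty\}$ such that $e^{-2\phi}(-4\partial_z\partial_{\bar z}\phi)=2\pi(|\boldsymbol\beta|+2)$ on $\mathbb C\setminus\{0,1\}$ and $\phi(z)=\beta_0\log|z|+O(1)$ as $z\to0$, $\phi(z)=\beta_1\log|z-1|+O(1)$ as $z\to1$, $\phi(z)=-(\beta_\infty+2)\log|z|+O(1)$ as $z\to\infty$. "Unramified outside of $\{0,1,\infty\}$" means that all critical values of $f$ lie in $\{0,1,\infty\}$. $\operatorname{ord}_kf$ is the ramification order of $f$ at $x_k$: $\operatorname{ord}_kf+1$ is the multiplicity of the pole if $f(x_k)=\infty$, and the order of vanishing of $f-f(x_k)$ at $x_k$ otherwise. $\partial_x$ is the Wirtinger derivative. *)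

theory Defs
  imports
    "HOL-Complex_Analysis.Complex_Analysis"
    "HOL-Library.Landau_Symbols"
    "HOL-Computational_Algebra.Polynomial"
begin

section \<open>The Riemann sphere and rational functions\<close>

datatype csphere = Fin complex | Infty

definition marked :: "csphere set"
  where "marked = {Fin 0, Fin 1, Infty}"

text \<open>A rational function is given as a quotient of coprime polynomials. On the affine part it is
  \<open>aff p q\<close>; its values at poles (0 by convention) are never used.\<close>

definition aff :: "complex poly \<Rightarrow> complex poly \<Rightarrow> complex \<Rightarrow> complex"
  where "aff p q x = poly p x / poly q x"

fun ratmap :: "complex poly \<Rightarrow> complex poly \<Rightarrow> csphere \<Rightarrow> csphere" where
  "ratmap p q (Fin x) = (if poly q x = 0 then Infty else Fin (aff p q x))"
| "ratmap p q Infty = (if degree q < degree p then Infty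
                       else Fin (coeff p (degree q) / lead_coeff q))"

definition rat_degree :: "complex poly \<Rightarrow> complex poly \<Rightarrow> nat"
  where "rat_degree p q = max (degree p) (degree q)"

text \<open>Centred charts of the sphere: \<open>chart k\<close> maps a punctured neighbourhood of 0 to a punctured
  neighbourhood of \<open>k\<close> (with values in the affine part), \<open>lparam k\<close> is its inverse, and
  \<open>pnhd k\<close> is the filter of punctured neighbourhoods of \<open>k\<close>.\<close>

fun chart :: "csphere \<Rightarrow> complex \<Rightarrow> complex" where
  "chart (Fin a) w = a + w"
| "chart Infty w = 1 / w"

fun lparam :: "csphere \<Rightarrow> complex \<Rightarrow> complex" where
  "lparam (Fin a) x = x - a"
| "lparam Infty x = 1 / x"

fun pnhd :: "csphere \<Rightarrow> complex filter" where
  "pnhd (Fin a) = at a"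
| "pnhd Infty = at_infinity"

text \<open>The ramification order: one less than the multiplicity of the pole, respectively than the order
  of vanishing of \<open>f - f k\<close> at \<open>k\<close>.\<close>

definition ram_ord :: "complex poly \<Rightarrow> complex poly \<Rightarrow> csphere \<Rightarrow> nat" where
  "ram_ord p q k =
     (case ratmap p q k of
        Fin v \<Rightarrow> nat (zorder (\<lambda>w. aff p q (chart k w) - v) 0) - 1
      | Infty \<Rightarrow> nat (- zorder (\<lambda>w. aff p q (chart k w)) 0) - 1)"

definition belyi :: "complex poly \<Rightarrow> complex poly \<Rightarrow> bool" where
  "belyi p q \<longleftrightarrow>
     q \<noteq> 0 \<and> coprime p q \<and> 0 < rat_degree p q \<and>
     (\<forall>x. 0 < ram_ord p q x \<longrightarrow> ratmap p q x \<in> marked)"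

definition preimages :: "complex poly \<Rightarrow> complex poly \<Rightarrow> csphere set"
  where "preimages p q = ratmap p q -` marked"

text \<open>In terms of the local parameter \<open>u\<close> at \<open>k\<close> (\<open>u = x - a\<close> for \<open>k = Fin a\<close> and \<open>u = 1/x\<close> for
  \<open>k = Infty\<close>), with \<open>m\<close> the multiplicity:
  \<open>f(x) - f(k) = c u^m (1 + (d/c) u + O(u^2))\<close>, respectively
  \<open>f(x) = c u^(-m) (1 + (d/c) u + O(u^2))\<close> at a pole.\<close>

definition leading_expansion ::
    "complex poly \<Rightarrow> complex poly \<Rightarrow> csphere \<Rightarrow> complex \<Rightarrow> complex \<Rightarrow> bool" where
  "leading_expansion p q k c d \<longleftrightarrow>
     c \<noteq> 0 \<and>
     (\<exists>R \<in> O[pnhd k](\<lambda>x. lparam k x ^ 2).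
        case ratmap p q k of
          Fin v \<Rightarrow> (\<forall>\<^sub>F x in pnhd k. aff p q x - v =
                     c * lparam k x ^ (ram_ord p q k + 1) * (1 + d / c * lparam k x + R x))
        | Infty \<Rightarrow> (\<forall>\<^sub>F x in pnhd k. aff p q x =
                     c / lparam k x ^ (ram_ord p q k + 1) * (1 + d / c * lparam k x + R x)))"


section \<open>Wirtinger derivatives and smoothness\<close>

definition wirtinger :: "(complex \<Rightarrow> complex) \<Rightarrow> complex \<Rightarrow> complex" where
  "wirtinger g z =
     (frechet_derivative g (at z) 1 - \<i> * frechet_derivative g (at z) \<i>) / 2"

definition wirtinger_bar :: "(complex \<Rightarrow> complex) \<Rightarrow> complex \<Rightarrow> complex" where
  "wirtinger_bar g z =
     (frechet_derivative g (at z) 1 + \<i> * frechet_derivative g (at z) \<i>) / 2"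

text \<open>Real \<open>C\<^sup>k\<close> regularity on an open set, by iterated directional derivatives.\<close>

primrec Ck_on :: "nat \<Rightarrow> complex set \<Rightarrow> (complex \<Rightarrow> real) \<Rightarrow> bool" where
  "Ck_on 0 U u \<longleftrightarrow> continuous_on U u"
| "Ck_on (Suc k) U u \<longleftrightarrow>
     (\<forall>z\<in>U. u differentiable (at z)) \<and>
     (\<forall>v. Ck_on k U (\<lambda>z. frechet_derivative u (at z) v))"

definition smooth_on :: "complex set \<Rightarrow> (complex \<Rightarrow> real) \<Rightarrow> bool"
  where "smooth_on U u \<longleftrightarrow> (\<forall>k. Ck_on k U u)"


section \<open>The constant curvature metric with conical singularities\<close>

text \<open>The orders are given by a function on the sphere of which only the values at
  0, 1 and infinity matter.\<close>

definition total_order :: "(csphere \<Rightarrow> real) \<Rightarrow> real"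
  where "total_order \<beta> = (\<Sum>j\<in>marked. \<beta> j)"

definition admissible_orders :: "(csphere \<Rightarrow> real) \<Rightarrow> bool" where
  "admissible_orders \<beta> \<longleftrightarrow>
     (\<forall>j\<in>marked. -1 < \<beta> j \<and> \<beta> j \<le> 0 \<and> \<beta> j - total_order \<beta> / 2 > 0)"

text \<open>\<open>\<phi>\<close> is the potential of the metric \<open>m\<^sub>\<beta> = exp (2\<phi>) |dz|\<^sup>2\<close> of unit area.\<close>

definition metric_potential :: "(csphere \<Rightarrow> real) \<Rightarrow> (complex \<Rightarrow> real) \<Rightarrow> bool" where
  "metric_potential \<beta> \<phi> \<longleftrightarrow>
     smooth_on (UNIV - {0, 1}) \<phi> \<and>
     (\<forall>z. z \<notin> {0, 1} \<longrightarrow>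
        complex_of_real (exp (- 2 * \<phi> z)) *
          (- 4 * wirtinger (wirtinger_bar (\<lambda>w. complex_of_real (\<phi> w))) z)
        = complex_of_real (2 * pi * (total_order \<beta> + 2))) \<and>
     (\<lambda>z. \<phi> z - \<beta> (Fin 0) * ln (cmod z)) \<in> O[at 0](\<lambda>_. 1) \<and>
     (\<lambda>z. \<phi> z - \<beta> (Fin 1) * ln (cmod (z - 1))) \<in> O[at 1](\<lambda>_. 1) \<and>
     (\<lambda>z. \<phi> z + (\<beta> Infty + 2) * ln (cmod z)) \<in> O[at_infinity](\<lambda>_. 1) \<and>
     has_bochner_integral lborel (\<lambda>z. exp (2 * \<phi> z)) 1"

definition pullback_potential ::
    "complex poly \<Rightarrow> complex poly \<Rightarrow> (complex \<Rightarrow> real) \<Rightarrow> complex \<Rightarrow> real" where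
  "pullback_potential p q \<phi> x = \<phi> (aff p q x) + ln (cmod (deriv (aff p q) x))"

definition stress_energy :: "(complex \<Rightarrow> real) \<Rightarrow> complex \<Rightarrow> complex" where
  "stress_energy \<psi> x =
     (let g = (\<lambda>y. complex_of_real (\<psi> y))
      in 2 * (wirtinger (wirtinger g) x - (wirtinger g x)\<^sup>2))"

definition pullback_order ::
    "complex poly \<Rightarrow> complex poly \<Rightarrow> (csphere \<Rightarrow> real) \<Rightarrow> csphere \<Rightarrow> real" where
  "pullback_order p q \<beta> k = real (ram_ord p q k + 1) * (\<beta> (ratmap p q k) + 1) - 1"

definition weight :: "real \<Rightarrow> real"
  where "weight b = - b * (b + 2)"

text \<open>The accessory parameters of the metric itself; the value 0 away from \<open>marked\<close> is
  never used.\<close>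

definition base_accessory :: "(csphere \<Rightarrow> real) \<Rightarrow> csphere \<Rightarrow> real" where
  "base_accessory \<beta> j =
     (let s0 = weight (\<beta> (Fin 0)); s1 = weight (\<beta> (Fin 1)); si = weight (\<beta> Infty)
      in if j = Fin 0 then (s0 + s1 - si) / 2
         else if j = Fin 1 then - ((s0 + s1 - si) / 2)
         else if j = Infty then (s1 + si - s0) / 2
         else 0)"

end

theory Submission
  imports Defs "HOL-Computational_Algebra.Fundamental_Theorem_Algebra"
begin

text \<open>The stress-energy tensor behaves like a projective connection. If \<open>\<phi>\<close> solves Liouville's equation, then
\<open>T\<^sub>\<phi> = 2 (\<partial>\<^sup>2\<phi> - (\<partial>\<phi>)\<^sup>2)\<close> is holomorphic, and pulling \<open>\<phi>\<close> back by a holomorphic map \<open>f\<close> gives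
\<open>T\<^sub>\<phi>(f) f'\<^sup>2 + S f\<close> with the Schwarzian derivative \<open>S f\<close> (\<open>liouville_pullback\<close>). The claim thus splits into
the determination of the tensor of the metric itself and a computation with power series.

The metric. Its tensor is holomorphic away from 0, 1 and infinity, and the analytic core is that a cone of
order \<open>\<beta>\<close> forces a double pole with coefficient \<open>- \<beta> (\<beta> + 2) / 2\<close>
(\<open>conical_singularity_stress_limit\<close>), which has to be deduced from the boundedness of \<open>\<phi> - \<beta> log |z|\<close>.
In the coordinate \<open>w\<close> with \<open>z = exp w\<close> the cone is the end of a half cylinder, where the potential is
\<open>b Re w + U\<close> with \<open>b = \<beta> + 1 > 0\<close> and \<open>U\<close> bounded, and the Laplacian of \<open>U\<close> decays exponentially. There
\<open>T + b\<^sup>2/2 = 2 \<partial>\<^sup>2U - 2 b \<partial>U - 2 (\<partial>U)\<^sup>2\<close>.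
An integration by parts over a period bounds the energy of \<open>U\<close> in a window of length \<open>l\<close> far down the
cylinder by a multiple of \<open>1/l\<close> (\<open>energy_bound\<close>). Hence the integral of \<open>T + b\<^sup>2/2\<close> against a test
function over such a window is bounded independently of position and length (\<open>window_bound\<close>). With
Cauchy kernels as test functions this bounds \<open>T + b\<^sup>2/2\<close> pointwise, so that it extends holomorphically over
\<open>z = 0\<close>; with the constant 1 and long windows it shows that the value there is 0.
A holomorphic function with three such double poles is determined by Liouville's theorem
(\<open>three_point_stress\<close>), and its expansions give the accessory parameters of the metric.

The pull-back. In charts centred at \<open>k\<close> and \<open>f k\<close> the map is \<open>u\<^sup>m G(u)\<close> with \<open>G(0) \<noteq> 0\<close>, and
\<open>double_pole_germ_compose\<close> reads off the two leading coefficients. The charts are Moebius maps and have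
Schwarzian 0, so that one computation covers zeros and poles of \<open>f\<close>, at finite points and at infinity.
At points outside the preimages of 0, 1 and infinity \<open>f\<close> is regular with \<open>f' \<noteq> 0\<close>, hence the tensor minus
its principal parts is entire and vanishes at infinity (\<open>pullback_stress_partial_fractions\<close>).

The number of preimages is the Riemann-Hurwitz formula, obtained from the degree of the Wronskian
\<open>p' q - p q'\<close>: all its zeros lie over 0, 1 and infinity, with multiplicity one less than that of \<open>f\<close>
(\<open>card_affine_preimages\<close>).\<close>
section \<open>Wirtinger derivatives\<close>

text \<open>The real derivative written as \<open>h \<mapsto> A h + B cnj h\<close>, so that \<open>A\<close> and \<open>B\<close> are the values of \<open>\<partial>g\<close> and
\<open>\<partial>\<^bsub>bar\<^esub>g\<close>; in this form derivatives compose with holomorphic maps without splitting into real and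
imaginary parts.\<close>
definition has_wirtinger ::
    "(complex \<Rightarrow> complex) \<Rightarrow> complex \<Rightarrow> complex \<Rightarrow> complex \<Rightarrow> bool" where
  "has_wirtinger g A B z \<longleftrightarrow> (g has_derivative (\<lambda>h. A * h + B * cnj h)) (at z)"

lemma has_wirtinger_unique:
  assumes "has_wirtinger g A B z"
  shows "wirtinger g z = A" "wirtinger_bar g z = B"
proof -
  have "frechet_derivative g (at z) = (\<lambda>h. A * h + B * cnj h)"
    using assms unfolding has_wirtinger_def by (metis frechet_derivative_at)
  then show "wirtinger g z = A" "wirtinger_bar g z = B"
    by (simp_all add: wirtinger_def wirtinger_bar_def algebra_simps)
qed

lemma differentiable_imp_has_wirtinger:
  assumes "g differentiable (at z)"
  shows "has_wirtinger g (wirtinger g z) (wirtinger_bar g z) z"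
proof -
  let ?D = "frechet_derivative g (at z)"
  have D: "(g has_derivative ?D) (at z)"
    using assms frechet_derivative_works by blast
  interpret linear ?D using D has_derivative_linear by blast
  have "?D h = wirtinger g z * h + wirtinger_bar g z * cnj h" for h
  proof -
    have "?D h = ?D (Re h *\<^sub>R 1 + Im h *\<^sub>R \<i>)"
      by (rule arg_cong[where f = ?D]) (simp add: complex_eq_iff)
    also have "\<dots> = Re h *\<^sub>R ?D 1 + Im h *\<^sub>R ?D \<i>"
      by (simp only: add scale)
    also have "\<dots> = wirtinger g z * h + wirtinger_bar g z * cnj h"
      by (simp add: wirtinger_def wirtinger_bar_def complex_eq_iff field_simps)
    finally show ?thesis .
  qed
  then have "?D = (\<lambda>h. wirtinger g z * h + wirtinger_bar g z * cnj h)" by blast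
  with D show ?thesis by (simp add: has_wirtinger_def)
qed

lemma has_wirtinger_differentiable: "has_wirtinger g A B z \<Longrightarrow> g differentiable (at z)"
  unfolding has_wirtinger_def differentiable_def by blast

lemma has_wirtinger_isCont: "has_wirtinger g A B z \<Longrightarrow> isCont g z"
  unfolding has_wirtinger_def by (rule has_derivative_continuous)

lemma has_wirtinger_transform:
  assumes "has_wirtinger g A B z" "open U" "z \<in> U" "\<And>w. w \<in> U \<Longrightarrow> g w = g' w"
  shows "has_wirtinger g' A B z"
  using assms unfolding has_wirtinger_def
  by (meson has_derivative_transform_within_open)

lemma has_wirtinger_cong_values:
  "has_wirtinger g A B z \<Longrightarrow> A = A' \<Longrightarrow> B = B' \<Longrightarrow> has_wirtinger g A' B' z"
  by simp

lemma has_wirtinger_iff_field_derivative: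
  "has_wirtinger g A 0 z \<longleftrightarrow> (g has_field_derivative A) (at z)"
  by (simp add: has_wirtinger_def has_field_derivative_def)

lemma has_wirtinger_add:
  assumes "has_wirtinger f A B z" "has_wirtinger g A' B' z"
  shows "has_wirtinger (\<lambda>w. f w + g w) (A + A') (B + B') z"
  using has_derivative_add[OF assms[unfolded has_wirtinger_def]]
  by (simp add: has_wirtinger_def algebra_simps)

lemma has_wirtinger_diff:
  assumes "has_wirtinger f A B z" "has_wirtinger g A' B' z"
  shows "has_wirtinger (\<lambda>w. f w - g w) (A - A') (B - B') z"
  using has_derivative_diff[OF assms[unfolded has_wirtinger_def]]
  by (simp add: has_wirtinger_def algebra_simps)

lemma has_wirtinger_mult:
  assumes "has_wirtinger f A B z" "has_wirtinger g A' B' z"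
  shows "has_wirtinger (\<lambda>w. f w * g w) (A * g z + f z * A') (B * g z + f z * B') z"
  using has_derivative_mult[OF assms[unfolded has_wirtinger_def]]
  by (simp add: has_wirtinger_def algebra_simps)

lemma has_wirtinger_const: "has_wirtinger (\<lambda>w. c) 0 0 z"
  by (simp add: has_wirtinger_def)

lemma has_wirtinger_cnj:
  assumes "has_wirtinger f A B z"
  shows "has_wirtinger (\<lambda>w. cnj (f w)) (cnj B) (cnj A) z"
proof -
  have "((\<lambda>w. cnj (f w)) has_derivative (\<lambda>h. cnj (A * h + B * cnj h))) (at z)"
    using assms unfolding has_wirtinger_def
    by (rule bounded_linear.has_derivative[OF bounded_linear_cnj])
  then show ?thesis
    by (simp add: has_wirtinger_def algebra_simps)
qed

lemma has_wirtinger_compose_holomorphic: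
  assumes "has_wirtinger g A B (f z)" "(f has_field_derivative f') (at z)"
  shows "has_wirtinger (\<lambda>w. g (f w)) (A * f') (B * cnj f') z"
proof -
  have "((\<lambda>w. g (f w)) has_derivative (\<lambda>h. A * (f' * h) + B * cnj (f' * h))) (at z)"
    using has_derivative_compose[OF assms(2)[unfolded has_field_derivative_def]
        assms(1)[unfolded has_wirtinger_def]] .
  then show ?thesis by (simp add: has_wirtinger_def algebra_simps)
qed

lemma has_wirtinger_holomorphic_compose:
  assumes "has_wirtinger f A B z" "(g has_field_derivative g') (at (f z))"
  shows "has_wirtinger (\<lambda>w. g (f w)) (g' * A) (g' * B) z"
proof -
  have "((\<lambda>w. g (f w)) has_derivative (\<lambda>h. g' * (A * h + B * cnj h))) (at z)"
    using has_derivative_compose[OF assms(1)[unfolded has_wirtinger_def]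
        assms(2)[unfolded has_field_derivative_def]] .
  then show ?thesis by (simp add: has_wirtinger_def algebra_simps)
qed

text \<open>\<open>\<partial>\<close> and \<open>\<partial>\<^bsub>bar\<^esub>\<close> commute: up to \<open>o(r\<^sup>2)\<close> the derivative of \<open>t \<mapsto> g (z + r exp (it))\<close> consists of terms
with \<open>2\<pi>\<close>-periodic primitives and of the constant \<open>\<i> r\<^sup>2 (A2 - B1)\<close>. Since \<open>g\<close> returns to its initial
value after a full turn, this constant must vanish.\<close>
lemma wirtinger_mixed_derivatives_eq:
  assumes "open U" "z \<in> U" and g: "\<And>w. w \<in> U \<Longrightarrow> has_wirtinger g (A w) (B w) w"
    and A: "has_wirtinger A A1 A2 z" and B: "has_wirtinger B B1 B2 z"
  shows "A2 = B1"
proof (rule ccontr)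
  assume ne: "A2 \<noteq> B1"
  define e where "e = cmod (A2 - B1) / 4"
  have e: "e > 0" using ne by (simp add: e_def)
  obtain d1 where d1: "d1 > 0" "\<And>w. cmod (w - z) < d1 \<Longrightarrow>
     cmod (A w - A z - (A1 * (w - z) + A2 * cnj (w - z))) \<le> e * cmod (w - z)"
    using A e unfolding has_wirtinger_def has_derivative_at_alt by meson
  obtain d2 where d2: "d2 > 0" "\<And>w. cmod (w - z) < d2 \<Longrightarrow>
     cmod (B w - B z - (B1 * (w - z) + B2 * cnj (w - z))) \<le> e * cmod (w - z)"
    using B e unfolding has_wirtinger_def has_derivative_at_alt by meson
  obtain d3 where d3: "d3 > 0" "ball z d3 \<subseteq> U"
    using assms(1,2) openE by blast
  define r where "r = min d1 (min d2 d3) / 2"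
  have r: "r > 0" "r < d1" "r < d2" "r < d3"
    using d1 d2 d3 by (auto simp: r_def min_def)
  define E where "E t = exp (\<i> * of_real t)" for t :: real
  have cE: "cnj (E t) = exp (- \<i> * of_real t)" for t by (simp add: E_def exp_cnj)
  have nE: "cmod (E t) = 1" for t by (simp add: E_def)
  have EE: "E t * cnj (E t) = 1" for t using complex_norm_square[of "E t"] by (simp add: nE)
  have dE: "(E has_vector_derivative (\<i> * E t)) (at t)" for t
  proof -
    have "((\<lambda>x. exp (\<i> * x)) has_field_derivative (\<i> * exp (\<i> * of_real t))) (at (of_real t))"
      by (auto intro!: derivative_eq_intros)
    from has_vector_derivative_real_field[OF this] show ?thesis unfolding E_def .
  qed
  have dcE: "((\<lambda>t. cnj (E t)) has_vector_derivative (- \<i> * cnj (E t))) (at t)" for t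
    using has_vector_derivative_cnj[OF dE[of t]] by simp
  \<comment> \<open>\<open>g\<close> along the circle minus the primitive of its second order expansion, so that \<open>\<Phi>'\<close> is \<open>o(r\<^sup>2)\<close>\<close>
  define \<Phi> where "\<Phi> t = g (z + r * E t) - r * (A z * E t + B z * cnj (E t))
     - of_real (r\<^sup>2) / 2 * (A1 * (E t * E t) + B2 * (cnj (E t) * cnj (E t))) - \<i> * r\<^sup>2 * (A2 - B1) * t" for t :: real
  define \<Phi>' where "\<Phi>' t = A (z + r * E t) * (r * (\<i> * E t)) + B (z + r * E t) * cnj (r * (\<i> * E t))
     - r * (A z * (\<i> * E t) + B z * (- \<i> * cnj (E t)))
     - r\<^sup>2 * (A1 * (\<i> * (E t * E t)) - B2 * (\<i> * (cnj (E t) * cnj (E t)))) - \<i> * r\<^sup>2 * (A2 - B1)" for t :: real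
  have d\<Phi>: "(\<Phi> has_vector_derivative \<Phi>' t) (at t)" for t
  proof -
    have inU: "z + r * E t \<in> U"
      using r d3 by (intro subsetD[OF d3(2)]) (simp add: dist_norm norm_mult nE)
    have 1: "((\<lambda>t. z + r * E t) has_vector_derivative r * (\<i> * E t)) (at t)"
      by (auto intro!: derivative_eq_intros dE)
    have h1: "((\<lambda>t. g (z + r * E t)) has_vector_derivative
        A (z + r * E t) * (r * (\<i> * E t)) + B (z + r * E t) * cnj (r * (\<i> * E t))) (at t)"
      using vector_derivative_diff_chain_within[OF 1, of g "\<lambda>h. A (z + r * E t) * h + B (z + r * E t) * cnj h"] g[OF inU]
      by (auto simp: has_wirtinger_def o_def intro: has_derivative_at_withinI)
    have h2: "((\<lambda>t. of_real r * (A z * E t + B z * cnj (E t))) has_vector_derivative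
        r * (A z * (\<i> * E t) + B z * (- \<i> * cnj (E t)))) (at t)"
      by (intro has_vector_derivative_mult_right has_vector_derivative_add dE dcE)
    have h3: "((\<lambda>t. \<i> * r\<^sup>2 * (A2 - B1) * t) has_vector_derivative \<i> * r\<^sup>2 * (A2 - B1)) (at t)"
      by (auto intro!: derivative_eq_intros)
    have "((\<lambda>t. of_real (r\<^sup>2) / 2 * (A1 * (E t * E t) + B2 * (cnj (E t) * cnj (E t))))
        has_vector_derivative of_real (r\<^sup>2) / 2 * (A1 * (E t * (\<i> * E t) + \<i> * E t * E t)
          + B2 * (cnj (E t) * (- \<i> * cnj (E t)) + - \<i> * cnj (E t) * cnj (E t)))) (at t)"
      by (intro has_vector_derivative_mult_right has_vector_derivative_add
          has_vector_derivative_mult dE dcE)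
    moreover have "of_real (r\<^sup>2) / 2 * (A1 * (E t * (\<i> * E t) + \<i> * E t * E t)
          + B2 * (cnj (E t) * (- \<i> * cnj (E t)) + - \<i> * cnj (E t) * cnj (E t)))
        = r\<^sup>2 * (A1 * (\<i> * (E t * E t)) - B2 * (\<i> * (cnj (E t) * cnj (E t))))"
      by algebra
    ultimately have h4: "((\<lambda>t. of_real (r\<^sup>2) / 2 * (A1 * (E t * E t) + B2 * (cnj (E t) * cnj (E t))))
        has_vector_derivative r\<^sup>2 * (A1 * (\<i> * (E t * E t)) - B2 * (\<i> * (cnj (E t) * cnj (E t))))) (at t)"
      by (simp only:)
    show ?thesis unfolding \<Phi>_def \<Phi>'_def
      by (rule has_vector_derivative_diff[OF has_vector_derivative_diff[OF
            has_vector_derivative_diff[OF h1 h2] h4] h3])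
  qed
  have bound: "norm (\<Phi>' t) \<le> 2 * e * r\<^sup>2" for t
  proof -
    let ?w = "z + r * E t"
    let ?a = "A ?w - A z - (A1 * (?w - z) + A2 * cnj (?w - z))"
    let ?b = "B ?w - B z - (B1 * (?w - z) + B2 * cnj (?w - z))"
    have quad: "(A1 * (r * x) + A2 * (r * y)) * (r * (\<i> * x)) - (B1 * (r * x) + B2 * (r * y)) * (r * (\<i> * y))
        = r\<^sup>2 * (A1 * (\<i> * (x * x)) - B2 * (\<i> * (y * y))) + \<i> * r\<^sup>2 * (A2 - B1) * (x * y)"
      for x y r :: complex
      by (simp add: algebra_simps power2_eq_square)
    have gen: "(az + p + a) * (r * (\<i> * x)) + (bz + q + b) * (r * (- \<i> * y))
        - r * (az * (\<i> * x) + bz * (- \<i> * y)) - s - \<i> * r\<^sup>2 * (A2 - B1)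
      = \<i> * r * (a * x) - \<i> * r * (b * y) + \<i> * r\<^sup>2 * (A2 - B1) * (x * y - 1)"
      if "p * (r * (\<i> * x)) - q * (r * (\<i> * y)) = s + \<i> * r\<^sup>2 * (A2 - B1) * (x * y)"
      for x y a b az bz r p q s :: complex
      using that by (simp add: ring_distribs mult_ac) algebra
    have "\<Phi>' t = \<i> * r * (?a * E t) - \<i> * r * (?b * cnj (E t)) 
        + \<i> * r\<^sup>2 * (A2 - B1) * (E t * cnj (E t) - 1)"
      using gen[OF quad[of "of_real r" "E t" "cnj (E t)"], of "A z" ?a "B z" ?b]
      unfolding \<Phi>'_def by simp
    then have "\<Phi>' t = \<i> * r * (?a * E t) - \<i> * r * (?b * cnj (E t))" by (simp only: EE) simp
    then have "norm (\<Phi>' t) \<le> r * norm ?a + r * norm ?b"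
      using r by (simp only:, intro order_trans[OF norm_triangle_ineq4]) (simp add: norm_mult nE)
    also have "\<dots> \<le> r * (e * r) + r * (e * r)"
    proof -
      have nr: "cmod (?w - z) = r" using r by (simp add: norm_mult nE)
      have "norm ?a \<le> e * r" using d1(2)[of ?w] r nr by simp
      moreover have "norm ?b \<le> e * r" using d2(2)[of ?w] r nr by simp
      ultimately show ?thesis using r by (intro add_mono mult_left_mono) auto
    qed
    finally show ?thesis by (simp add: power2_eq_square algebra_simps)
  qed
  have "norm (\<Phi> (2 * pi) - \<Phi> 0) \<le> (2 * e * r\<^sup>2) * norm (2 * pi - 0 :: real)"
  proof (rule differentiable_bound[where S = UNIV and f' = "\<lambda>t h. h *\<^sub>R \<Phi>' t"])
    show "(\<Phi> has_derivative (\<lambda>h. h *\<^sub>R \<Phi>' x)) (at x within UNIV)" for x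
      using d\<Phi>[of x] by (simp add: has_vector_derivative_def)
    show "onorm (\<lambda>h. h *\<^sub>R \<Phi>' x) \<le> 2 * e * r\<^sup>2" for x
      using bound[of x] by (intro onorm_le) (metis abs_ge_zero mult.commute mult_left_mono norm_scaleR real_norm_def)
  qed auto
  moreover have "\<Phi> (2 * pi) - \<Phi> 0 = - (\<i> * r\<^sup>2 * (A2 - B1) * (2 * pi))"
  proof -
    have "E (2 * pi) = 1" "E 0 = 1"
      using exp_two_pi_i' by (simp_all add: E_def mult.commute)
    then show ?thesis unfolding \<Phi>_def by simp
  qed
  ultimately have "r\<^sup>2 * cmod (A2 - B1) * (2 * pi) \<le> 2 * e * r\<^sup>2 * (2 * pi)"
    by (simp add: norm_mult norm_power)
  then have "cmod (A2 - B1) \<le> 2 * e" using r by simp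
  then show False using ne by (simp add: e_def)
qed

section \<open>Liouville's equation\<close>

text \<open>\<open>P\<close> and \<open>Q\<close> are \<open>\<partial>\<phi>\<close> and \<open>\<partial>\<^sup>2\<phi>\<close>, and the clause on the antiholomorphic derivative of \<open>P\<close> is the equation
\<open>- 4 \<partial>\<^bsub>bar\<^esub>\<partial>\<phi> = K exp (2\<phi>)\<close> of curvature \<open>K\<close>. Holomorphy of the stress-energy tensor, which costs a third
derivative, is part of the structure: pull-backs then inherit it from the transformation law.\<close>
definition liouville ::
    "real \<Rightarrow> complex set \<Rightarrow> (complex \<Rightarrow> real) \<Rightarrow> (complex \<Rightarrow> complex) \<Rightarrow> (complex \<Rightarrow> complex) \<Rightarrow> bool" where
  "liouville K \<Omega> \<phi> P Q \<longleftrightarrow> open \<Omega> \<and>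
     (\<forall>z\<in>\<Omega>. has_wirtinger (\<lambda>w. of_real (\<phi> w)) (P z) (cnj (P z)) z \<and>
            has_wirtinger P (Q z) (of_real (- K / 4 * exp (2 * \<phi> z))) z) \<and>
     (\<lambda>z. 2 * (Q z - (P z)\<^sup>2)) holomorphic_on \<Omega>"

lemma liouville_stress_energy:
  assumes "liouville K \<Omega> \<phi> P Q" "z \<in> \<Omega>"
  shows "stress_energy \<phi> z = 2 * (Q z - (P z)\<^sup>2)"
proof -
  let ?g = "\<lambda>w. complex_of_real (\<phi> w)"
  have P: "wirtinger ?g w = P w" if "w \<in> \<Omega>" for w
    using assms(1) that has_wirtinger_unique(1) unfolding liouville_def by blast
  have "has_wirtinger (wirtinger ?g) (Q z) (of_real (- K / 4 * exp (2 * \<phi> z))) z"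
    by (rule has_wirtinger_transform[of P _ _ _ \<Omega>]) (use assms P in \<open>auto simp: liouville_def\<close>)
  then have "wirtinger (wirtinger ?g) z = Q z" by (rule has_wirtinger_unique)
  then show ?thesis using P[OF assms(2)] by (simp add: stress_energy_def)
qed

lemma wirtinger_of_real:
  assumes "u differentiable (at z)"
  shows "has_wirtinger (\<lambda>w. of_real (u w))
     ((of_real (frechet_derivative u (at z) 1) - \<i> * of_real (frechet_derivative u (at z) \<i>)) / 2)
     ((of_real (frechet_derivative u (at z) 1) + \<i> * of_real (frechet_derivative u (at z) \<i>)) / 2) z"
proof -
  let ?g = "\<lambda>w. complex_of_real (u w)"
  have "(u has_derivative frechet_derivative u (at z)) (at z)"
    using assms frechet_derivative_works by blast
  then have D: "(?g has_derivative (\<lambda>h. of_real (frechet_derivative u (at z) h))) (at z)"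
    by (rule has_derivative_of_real)
  then have "frechet_derivative ?g (at z) = (\<lambda>h. of_real (frechet_derivative u (at z) h))"
    by (metis frechet_derivative_at)
  with differentiable_imp_has_wirtinger[of ?g z] D show ?thesis
    unfolding wirtinger_def wirtinger_bar_def differentiable_def by auto
qed

lemma differentiable_of_real_complex:
  fixes u :: "complex \<Rightarrow> real"
  shows "u differentiable (at z) \<Longrightarrow> (\<lambda>w. complex_of_real (u w)) differentiable (at z)"
  using has_wirtinger_differentiable[OF wirtinger_of_real[of u z]] by simp

lemma Ck_on_wirtinger_differentiable:
  assumes u: "Ck_on 3 U u" and "open U"
  defines "g \<equiv> \<lambda>w. complex_of_real (u w)"
  assumes z: "z \<in> U"
  shows "has_wirtinger g (wirtinger g z) (cnj (wirtinger g z)) z"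
    and "wirtinger g differentiable (at z)"
    and "wirtinger (wirtinger g) differentiable (at z)"
proof -
  define u1 where "u1 v z = frechet_derivative u (at z) v" for v z
  define u2 where "u2 v w z = frechet_derivative (u1 v) (at z) w" for v w z
  have u0: "u differentiable (at z)" if "z \<in> U" for z
    using u that by (simp add: numeral_3_eq_3)
  have u1: "u1 v differentiable (at z)" if "z \<in> U" for v z
    using u that unfolding u1_def by (simp add: numeral_3_eq_3)
  have u2: "u2 v w differentiable (at z)" if "z \<in> U" for v w z
    using u that unfolding u1_def u2_def by (simp add: numeral_3_eq_3)
  have W1: "wirtinger g z = (of_real (u1 1 z) - \<i> * of_real (u1 \<i> z)) / 2" if "z \<in> U" for z
    using has_wirtinger_unique(1)[OF wirtinger_of_real[OF u0[OF that]]] by (simp add: g_def u1_def)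
  have "has_wirtinger g ((of_real (u1 1 z) - \<i> * of_real (u1 \<i> z)) / 2)
      ((of_real (u1 1 z) + \<i> * of_real (u1 \<i> z)) / 2) z"
    using wirtinger_of_real[OF u0[OF z]] by (simp add: g_def u1_def)
  then show "has_wirtinger g (wirtinger g z) (cnj (wirtinger g z)) z"
    by (simp add: W1[OF z])
  have H1: "has_wirtinger (wirtinger g)
     (((of_real (u2 1 1 z) - \<i> * of_real (u2 1 \<i> z)) / 2 - \<i> * ((of_real (u2 \<i> 1 z) - \<i> * of_real (u2 \<i> \<i> z)) / 2)) / 2)
     (((of_real (u2 1 1 z) + \<i> * of_real (u2 1 \<i> z)) / 2 - \<i> * ((of_real (u2 \<i> 1 z) + \<i> * of_real (u2 \<i> \<i> z)) / 2)) / 2) z"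
    if z: "z \<in> U" for z
  proof -
    have a: "has_wirtinger (\<lambda>w. of_real (u1 v w)) ((of_real (u2 v 1 z) - \<i> * of_real (u2 v \<i> z)) / 2)
       ((of_real (u2 v 1 z) + \<i> * of_real (u2 v \<i> z)) / 2) z" for v
      using wirtinger_of_real[OF u1[OF z]] by (simp add: u2_def)
    have "has_wirtinger (\<lambda>w. (of_real (u1 1 w) - \<i> * of_real (u1 \<i> w)) * (1/2))
     (((of_real (u2 1 1 z) - \<i> * of_real (u2 1 \<i> z)) / 2 - \<i> * ((of_real (u2 \<i> 1 z) - \<i> * of_real (u2 \<i> \<i> z)) / 2)) / 2)
     (((of_real (u2 1 1 z) + \<i> * of_real (u2 1 \<i> z)) / 2 - \<i> * ((of_real (u2 \<i> 1 z) + \<i> * of_real (u2 \<i> \<i> z)) / 2)) / 2) z"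
      by (rule has_wirtinger_cong_values[OF has_wirtinger_mult[OF has_wirtinger_diff[OF a 
              has_wirtinger_mult[OF has_wirtinger_const a]] has_wirtinger_const]]) simp_all
    then show ?thesis
      by (rule has_wirtinger_transform[OF _ \<open>open U\<close> z]) (simp add: W1)
  qed
  then show "wirtinger g differentiable (at z)"
    using z has_wirtinger_differentiable by blast
  have W2: "wirtinger (wirtinger g) z = ((of_real (u2 1 1 z) - \<i> * of_real (u2 1 \<i> z)) / 2 - \<i> * ((of_real (u2 \<i> 1 z) - \<i> * of_real (u2 \<i> \<i> z)) / 2)) / 2"
    if "z \<in> U" for z using H1[OF that] by (rule has_wirtinger_unique)
  have "(\<lambda>z. ((of_real (u2 1 1 z) - \<i> * of_real (u2 1 \<i> z)) / 2 - \<i> * ((of_real (u2 \<i> 1 z) - \<i> * of_real (u2 \<i> \<i> z)) / 2)) / (2::complex)) differentiable (at z)"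
    by (intro derivative_intros differentiable_of_real_complex u2 z) auto
  then show "wirtinger (wirtinger g) differentiable (at z)"
    using differentiable_transform_within[of _ z UNIV]
    by (metis (no_types, lifting) W2 \<open>open U\<close> differentiable_def has_derivative_transform_within_open z)
qed

text \<open>The antiholomorphic derivative of \<open>Q - P\<^sup>2\<close> vanishes: as mixed derivatives commute, that of \<open>Q\<close> is
\<open>\<partial>(- K/4 exp (2\<phi>)) = - K/2 exp (2\<phi>) P\<close>, and this is also \<open>2 P\<close> times that of \<open>P\<close>.\<close>
lemma liouville_of_smooth:
  assumes "open U" "smooth_on U \<phi>"
    and eq: "\<And>z. z \<in> U \<Longrightarrow> complex_of_real (exp (- 2 * \<phi> z)) *
          (- 4 * wirtinger (wirtinger_bar (\<lambda>w. complex_of_real (\<phi> w))) z) = complex_of_real K"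
  shows "\<exists>P Q. liouville K U \<phi> P Q"
proof -
  define g where "g = (\<lambda>w. complex_of_real (\<phi> w))"
  define P where "P = wirtinger g"
  define Q where "Q = wirtinger P"
  define R where "R = (\<lambda>z. complex_of_real (- K / 4 * exp (2 * \<phi> z)))"
  have C3: "Ck_on 3 U \<phi>" using assms(2) by (simp add: smooth_on_def)
  note C = Ck_on_wirtinger_differentiable[OF C3 \<open>open U\<close>, folded g_def]
  have g: "has_wirtinger g (P z) (cnj (P z)) z" if "z \<in> U" for z
    using C(1)[OF that] by (simp add: P_def)
  have P: "has_wirtinger P (Q z) (R z) z" if z: "z \<in> U" for z
  proof -
    have h: "has_wirtinger P (Q z) (wirtinger_bar P z) z"
      unfolding Q_def P_def using C(2)[OF z] by (rule differentiable_imp_has_wirtinger)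
    have "has_wirtinger (wirtinger_bar g) (cnj (wirtinger_bar P z)) (cnj (Q z)) z"
      by (rule has_wirtinger_transform[OF has_wirtinger_cnj[OF h] \<open>open U\<close> z])
        (use g has_wirtinger_unique(2) in fastforce)
    then have "wirtinger (wirtinger_bar g) z = cnj (wirtinger_bar P z)"
      by (rule has_wirtinger_unique)
    with eq[OF z] have eq': "exp (- 2 * \<phi> z) * (- 4 * cnj (wirtinger_bar P z)) = complex_of_real K"
      by (simp add: g_def)
    have solve: "4 * x = - k * e'" if "e * (- 4 * x) = k" "e * e' = 1" for x e e' k :: complex
    proof -
      have "- k * e' = 4 * x * (e * e')" unfolding that(1)[symmetric] by simp
      then show ?thesis by (simp add: that(2))
    qed
    have "4 * cnj (wirtinger_bar P z) = - of_real K * of_real (exp (2 * \<phi> z))"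
      by (rule solve[OF eq']) (simp flip: of_real_mult exp_add)
    then have "4 * cnj (wirtinger_bar P z) = 4 * of_real (- K / 4 * exp (2 * \<phi> z))"
      by simp
    then have "cnj (wirtinger_bar P z) = of_real (- K / 4 * exp (2 * \<phi> z))"
      by (simp only: mult_cancel_left) simp
    then have "wirtinger_bar P z = R z"
      unfolding R_def by (metis complex_cnj_cnj complex_cnj_complex_of_real)
    with h show ?thesis by simp
  qed
  have R: "has_wirtinger R (2 * P z * R z) (2 * cnj (P z) * R z) z" if z: "z \<in> U" for z
  proof -
    have gR: "of_real (- K / 4) * exp (2 * g w) = R w" for w
    proof -
      have "exp (2 * g w) = of_real (exp (2 * \<phi> w))" by (simp add: g_def flip: exp_of_real)
      then show ?thesis by (simp add: R_def)
    qed
    have "((\<lambda>x. of_real (- K / 4) * exp (2 * x)) has_field_derivative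
        2 * (of_real (- K / 4) * exp (2 * g z))) (at (g z))"
      by (auto intro!: derivative_eq_intros)
    from has_wirtinger_holomorphic_compose[OF g[OF z] this]
    have "has_wirtinger (\<lambda>w. of_real (- K / 4) * exp (2 * g w)) (2 * (of_real (- K / 4) * exp (2 * g z)) * P z)
        (2 * (of_real (- K / 4) * exp (2 * g z)) * cnj (P z)) z" .
    then show ?thesis unfolding gR by (simp only: mult_ac)
  qed
  have Q: "has_wirtinger Q (wirtinger Q z) (2 * P z * R z) z" if z: "z \<in> U" for z
  proof -
    have h: "has_wirtinger Q (wirtinger Q z) (wirtinger_bar Q z) z"
      unfolding Q_def P_def using C(3)[OF z] by (rule differentiable_imp_has_wirtinger)
    moreover have "wirtinger_bar Q z = 2 * P z * R z"
      using wirtinger_mixed_derivatives_eq[OF \<open>open U\<close> z P h R[OF z]] .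
    ultimately show ?thesis by simp
  qed
  have "(\<lambda>z. 2 * (Q z - (P z)\<^sup>2)) holomorphic_on U"
  proof -
    have "((\<lambda>z. 2 * (Q z - P z * P z)) has_field_derivative 2 * (wirtinger Q z - (Q z * P z + P z * Q z))) (at z)"
      if z: "z \<in> U" for z
      unfolding has_wirtinger_iff_field_derivative[symmetric]
      by (rule has_wirtinger_cong_values[OF has_wirtinger_mult[OF has_wirtinger_const
          has_wirtinger_diff[OF Q[OF z] has_wirtinger_mult[OF P[OF z] P[OF z]]]]]) simp_all
    then show ?thesis
      unfolding holomorphic_on_def field_differentiable_def power2_eq_square
      by (blast intro: has_field_derivative_at_within)
  qed
  with g P \<open>open U\<close> have "liouville K U \<phi> P Q"
    unfolding liouville_def R_def g_def by blast
  then show ?thesis by blast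
qed

definition pre_schwarzian :: "(complex \<Rightarrow> complex) \<Rightarrow> complex \<Rightarrow> complex" where
  "pre_schwarzian f z = deriv (deriv f) z / deriv f z"

definition schwarzian :: "(complex \<Rightarrow> complex) \<Rightarrow> complex \<Rightarrow> complex" where
  "schwarzian f z = deriv (pre_schwarzian f) z - (pre_schwarzian f z)\<^sup>2 / 2"

lemma of_real_Re_eq_half_sum: "of_real (Re w) = (w + cnj w) / 2"
  by (simp add: complex_add_cnj)

lemma ln_norm_has_wirtinger:
  assumes "(f has_field_derivative f') (at z)" "f z \<noteq> 0"
  shows "has_wirtinger (\<lambda>w. of_real (ln (cmod (f w)))) (f' / f z / 2) (cnj (f' / f z / 2)) z"
proof -
  have "((\<lambda>w. ln (cmod w)) has_derivative (\<lambda>h. Re (h / f z))) (at (f z))"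
  proof -
    have sgn: "sgn (f z) \<bullet> h / cmod (f z) = Re (h / f z)" for h
    proof -
      have "sgn (f z) \<bullet> h / cmod (f z) = (f z \<bullet> h) / (cmod (f z))\<^sup>2"
        by (simp add: sgn_div_norm power2_eq_square divide_inverse)
      also have "\<dots> = Re (h / f z)"
        by (simp add: inner_complex_def Re_divide cmod_power2 mult.commute)
      finally show ?thesis .
    qed
    have "((\<lambda>w. ln (cmod w)) has_derivative (\<lambda>h. (1 / cmod (f z)) * (sgn (f z) \<bullet> h))) (at (f z))"
      using has_derivative_ln[OF _ has_derivative_norm[OF assms(2)]] assms(2)
      by (simp add: inner_commute divide_inverse mult.commute)
    then show ?thesis using sgn by simp
  qed
  then have "((\<lambda>w. complex_of_real (ln (cmod w))) has_derivative (\<lambda>h. of_real (Re (h / f z)))) (at (f z))"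
    by (rule has_derivative_of_real)
  moreover have Q: "of_real (Re (h / f z)) = (1 / f z / 2) * h + cnj (1 / f z / 2) * cnj h" for h
    by (simp only: of_real_Re_eq_half_sum) (simp add: add_divide_distrib)
  ultimately have "has_wirtinger (\<lambda>w. of_real (ln (cmod w))) (1 / f z / 2) (cnj (1 / f z / 2)) (f z)"
    unfolding has_wirtinger_def by (subst (asm) Q) blast
  from has_wirtinger_compose_holomorphic[OF this assms(1)] show ?thesis by simp
qed

text \<open>The added term \<open>log |E'|\<close> is harmonic with \<open>\<partial>\<close>-derivative \<open>E'' / (2 E')\<close>; it supplies the factor \<open>|E'|\<^sup>2\<close>
by which \<open>\<partial>\<^bsub>bar\<^esub>\<partial>\<phi>\<close> scales. In \<open>Q' - P'\<^sup>2\<close> the mixed terms \<open>P(E) E''\<close> cancel, and what is left of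
\<open>E'' / (2 E')\<close> is half the Schwarzian derivative.\<close>
lemma liouville_pullback:
  assumes L: "liouville K \<Omega> \<phi> P Q" and "open U" and E: "E holomorphic_on U"
    and sub: "\<And>z. z \<in> U \<Longrightarrow> E z \<in> \<Omega>" and nz: "\<And>z. z \<in> U \<Longrightarrow> deriv E z \<noteq> 0"
  defines "P' \<equiv> \<lambda>z. P (E z) * deriv E z + pre_schwarzian E z / 2"
    and "Q' \<equiv> \<lambda>z. Q (E z) * (deriv E z)\<^sup>2 + P (E z) * deriv (deriv E) z + deriv (pre_schwarzian E) z / 2"
  shows "liouville K U (\<lambda>z. \<phi> (E z) + ln (cmod (deriv E z))) P' Q'"
    and "\<And>z. z \<in> U \<Longrightarrow> 2 * (Q' z - (P' z)\<^sup>2) = 2 * (Q (E z) - (P (E z))\<^sup>2) * (deriv E z)\<^sup>2 + schwarzian E z"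
proof -
  let ?\<psi> = "\<lambda>z. \<phi> (E z) + ln (cmod (deriv E z))"
  show T: "2 * (Q' z - (P' z)\<^sup>2) = 2 * (Q (E z) - (P (E z))\<^sup>2) * (deriv E z)\<^sup>2 + schwarzian E z"
    if "z \<in> U" for z
  proof -
    have "deriv (deriv E) z = deriv E z * pre_schwarzian E z"
      using nz[OF that] by (simp add: pre_schwarzian_def)
    moreover have "2 * (q * d\<^sup>2 + r * (d * (2 * m)) + k - (r * d + m)\<^sup>2)
       = 2 * (q - r\<^sup>2) * d\<^sup>2 + (2 * k - 2 * m\<^sup>2)" for q d r m k :: complex
      by algebra
    from this[of _ _ _ "pre_schwarzian E z / 2" "deriv (pre_schwarzian E) z / 2"]
    have "2 * (q * d\<^sup>2 + r * (d * pre_schwarzian E z) + deriv (pre_schwarzian E) z / 2 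
         - (r * d + pre_schwarzian E z / 2)\<^sup>2)
       = 2 * (q - r\<^sup>2) * d\<^sup>2 + (deriv (pre_schwarzian E) z - (pre_schwarzian E z)\<^sup>2 / 2)" for q d r
      by (simp add: power_divide)
    ultimately show ?thesis
      unfolding P'_def Q'_def schwarzian_def by (simp only:)
  qed
  have dE: "(E has_field_derivative deriv E z) (at z)" if "z \<in> U" for z
    using E \<open>open U\<close> that holomorphic_derivI by blast
  have hE': "deriv E holomorphic_on U" using E \<open>open U\<close> by (rule holomorphic_deriv)
  have hE'': "deriv (deriv E) holomorphic_on U" using hE' \<open>open U\<close> by (rule holomorphic_deriv)
  have hpre: "pre_schwarzian E holomorphic_on U"
    unfolding pre_schwarzian_def[abs_def] using hE'' hE' nz by (rule holomorphic_on_divide)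
  have dE': "(deriv E has_field_derivative deriv (deriv E) z) (at z)" if "z \<in> U" for z
    using hE' \<open>open U\<close> that holomorphic_derivI by blast
  have dpre: "(pre_schwarzian E has_field_derivative deriv (pre_schwarzian E) z) (at z)" if "z \<in> U" for z
    using hpre \<open>open U\<close> that holomorphic_derivI by blast
  have 1: "has_wirtinger (\<lambda>w. of_real (?\<psi> w)) (P' z) (cnj (P' z)) z" if z: "z \<in> U" for z
  proof -
    have "has_wirtinger (\<lambda>w. of_real (\<phi> w)) (P (E z)) (cnj (P (E z))) (E z)"
      using L sub[OF z] by (simp add: liouville_def)
    from has_wirtinger_add[OF has_wirtinger_compose_holomorphic[OF this dE[OF z]]
        ln_norm_has_wirtinger[OF dE'[OF z] nz[OF z]]]
    show ?thesis by (simp add: P'_def pre_schwarzian_def)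
  qed
  have 2: "has_wirtinger P' (Q' z) (of_real (- K / 4 * exp (2 * ?\<psi> z))) z" if z: "z \<in> U" for z
  proof -
    have "has_wirtinger P (Q (E z)) (of_real (- K / 4 * exp (2 * \<phi> (E z)))) (E z)"
      using L sub[OF z] by (simp add: liouville_def)
    note comp = has_wirtinger_compose_holomorphic[OF this dE[OF z]]
    note dE'' = dE'[OF z, folded has_wirtinger_iff_field_derivative]
    note dpre' = dpre[OF z, folded has_wirtinger_iff_field_derivative]
    have "has_wirtinger P' ((Q (E z) * deriv E z) * deriv E z + P (E z) * deriv (deriv E) z + deriv (pre_schwarzian E) z * (1/2))
       (of_real (- K / 4 * exp (2 * \<phi> (E z))) * cnj (deriv E z) * deriv E z + P (E z) * 0 + 0) z"
      unfolding P'_def divide_inverse[of "pre_schwarzian E _"] inverse_eq_divide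
      by (rule has_wirtinger_cong_values[OF has_wirtinger_add[OF has_wirtinger_mult[OF comp dE'']
          has_wirtinger_mult[OF dpre' has_wirtinger_const]]]) simp_all
    moreover have "exp (2 * ?\<psi> z) = exp (2 * \<phi> (E z)) * (cmod (deriv E z))\<^sup>2"
      using nz[OF z] by (simp add: distrib_left exp_add exp_double)
    moreover have "cnj (deriv E z) * deriv E z = of_real ((cmod (deriv E z))\<^sup>2)"
      by (metis complex_norm_square mult.commute)
    ultimately show ?thesis
      by (elim has_wirtinger_cong_values) (simp_all add: Q'_def power2_eq_square mult.assoc)
  qed
  have 3: "(\<lambda>z. 2 * (Q' z - (P' z)\<^sup>2)) holomorphic_on U"
  proof -
    have "(\<lambda>z. 2 * (Q z - (P z)\<^sup>2)) holomorphic_on \<Omega>" using L by (simp add: liouville_def)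
    with E have "(\<lambda>z. 2 * (Q (E z) - (P (E z))\<^sup>2)) holomorphic_on U"
      using holomorphic_on_compose_gen[of E U "\<lambda>z. 2 * (Q z - (P z)\<^sup>2)" \<Omega>] sub
      by (auto simp: o_def)
    moreover have "schwarzian E holomorphic_on U"
      unfolding schwarzian_def[abs_def] using hpre \<open>open U\<close>
      by (intro holomorphic_intros holomorphic_deriv) auto
    ultimately have "(\<lambda>z. 2 * (Q (E z) - (P (E z))\<^sup>2) * (deriv E z)\<^sup>2 + schwarzian E z) holomorphic_on U"
      using hE' by (intro holomorphic_on_add holomorphic_on_mult[of "\<lambda>z. 2 * (Q (E z) - (P (E z))\<^sup>2)"] holomorphic_on_power)
    then show ?thesis by (rule holomorphic_transform) (simp only: T)
  qed
  show "liouville K U ?\<psi> P' Q'"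
    unfolding liouville_def using 1 2 3 \<open>open U\<close> by blast
qed

section \<open>Integration over a period of the cylinder\<close>

definition cyl :: "real \<Rightarrow> real \<Rightarrow> complex set" where
  "cyl a c = {w. a \<le> Re w \<and> Re w \<le> c \<and> 0 \<le> Im w \<and> Im w \<le> 2 * pi}"

definition cylint :: "real \<Rightarrow> real \<Rightarrow> (complex \<Rightarrow> 'a::banach) \<Rightarrow> 'a" where
  "cylint a c F = integral (cbox (a, 0) (c, 2 * pi)) (\<lambda>(t, \<theta>). F (Complex t \<theta>))"

lemma continuous_on_Complex: "continuous_on S (\<lambda>(t, \<theta>). Complex t \<theta>)"
  unfolding Complex_eq case_prod_unfold by (intro continuous_intros)

lemma cyl_continuous:
  assumes "continuous_on (cyl a c) F"
  shows "continuous_on (cbox (a, 0) (c, 2 * pi)) (\<lambda>(t, \<theta>). F (Complex t \<theta>))"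
proof -
  have "continuous_on (cbox (a, 0) (c, 2 * pi)) (F \<circ> (\<lambda>(t, \<theta>). Complex t \<theta>))"
    by (intro continuous_on_compose continuous_on_Complex continuous_on_subset[OF assms])
      (auto simp: cyl_def)
  then show ?thesis by (simp add: o_def case_prod_unfold)
qed

lemma cyl_integrable:
  fixes F :: "complex \<Rightarrow> 'a::banach"
  assumes "continuous_on (cyl a c) F"
  shows "(\<lambda>(t, \<theta>). F (Complex t \<theta>)) integrable_on cbox (a, 0) (c, 2 * pi)"
  using cyl_continuous[OF assms] by (rule integrable_continuous)

lemma cylint_add:
  assumes "continuous_on (cyl a c) F" "continuous_on (cyl a c) G"
  shows "cylint a c (\<lambda>w. F w + G w) = cylint a c F + cylint a c G"
  using integral_add[OF cyl_integrable[OF assms(1)] cyl_integrable[OF assms(2)]]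
  by (simp add: cylint_def case_prod_unfold)

lemma cylint_mult_left:
  fixes F :: "complex \<Rightarrow> 'a::{real_normed_field, banach}"
  assumes "continuous_on (cyl a c) F"
  shows "cylint a c (\<lambda>w. k * F w) = k * cylint a c F"
  using integral_mult_right[of "cbox (a, 0) (c, 2 * pi)" k "\<lambda>(t, \<theta>). F (Complex t \<theta>)"]
  by (simp add: cylint_def case_prod_unfold)

lemma cylint_of_real:
  assumes "continuous_on (cyl a c) F"
  shows "cylint a c (\<lambda>w. complex_of_real (F w)) = of_real (cylint a c F)"
  using integral_linear[OF cyl_integrable[OF assms] bounded_linear_of_real[where 'a = complex]]
  by (simp add: cylint_def case_prod_unfold o_def)

lemma cylint_norm_le:
  fixes F :: "complex \<Rightarrow> 'a::banach"
  assumes "continuous_on (cyl a c) F" "continuous_on (cyl a c) g"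
    and "\<And>w. w \<in> cyl a c \<Longrightarrow> norm (F w) \<le> g w"
  shows "norm (cylint a c F) \<le> cylint a c g"
  unfolding cylint_def
  by (rule integral_norm_bound_integral[OF cyl_integrable[OF assms(1)] cyl_integrable[OF assms(2)]])
    (use assms(3) in \<open>auto simp: cyl_def\<close>)

lemma cylint_const:
  "a \<le> c \<Longrightarrow> cylint a c (\<lambda>w. k) = 2 * pi * (c - a) * (k :: real)"
  by (simp add: cylint_def case_prod_unfold content_Pair)

lemma cylint_iterated:
  assumes "continuous_on (cyl a c) F"
  shows "cylint a c F = integral {a..c} (\<lambda>t. integral {0..2 * pi} (\<lambda>\<theta>. F (Complex t \<theta>)))"
    and "cylint a c F = integral {0..2 * pi} (\<lambda>\<theta>. integral {a..c} (\<lambda>t. F (Complex t \<theta>)))"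
proof -
  show 1: "cylint a c F = integral {a..c} (\<lambda>t. integral {0..2 * pi} (\<lambda>\<theta>. F (Complex t \<theta>)))"
    using integral_prod_continuous[OF cyl_continuous[OF assms]]
    by (simp add: cylint_def)
  show "cylint a c F = integral {0..2 * pi} (\<lambda>\<theta>. integral {a..c} (\<lambda>t. F (Complex t \<theta>)))"
    using integral_swap_continuous[OF cyl_continuous[OF assms]] 1 by simp
qed

text \<open>Stokes' theorem on a period of the cylinder, with \<open>w = t + i\<theta>\<close>: \<open>\<partial>X + \<partial>\<^bsub>bar\<^esub>X\<close> is the \<open>t\<close>-derivative of \<open>X\<close>,
whose integral vanishes because \<open>X\<close> vanishes at both ends, and \<open>i (\<partial>X - \<partial>\<^bsub>bar\<^esub>X)\<close> is the \<open>\<theta>\<close>-derivative,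
whose integral vanishes by periodicity.\<close>
lemma cylint_wirtinger_zero:
  assumes "a \<le> c"
    and X: "\<And>w. w \<in> cyl a c \<Longrightarrow> has_wirtinger X (A w) (B w) w"
    and A: "continuous_on (cyl a c) A" and B: "continuous_on (cyl a c) B"
    and periodic: "\<And>t. a \<le> t \<Longrightarrow> t \<le> c \<Longrightarrow> X (Complex t 0) = X (Complex t (2 * pi))"
    and ends: "\<And>\<theta>. X (Complex a \<theta>) = 0" "\<And>\<theta>. X (Complex c \<theta>) = 0"
  shows "cylint a c A = 0" "cylint a c B = 0"
proof -
  have dX: "((\<lambda>s. X (g s)) has_vector_derivative A (g s) * g' + B (g s) * cnj g') (at s within S)"
    if "(g has_vector_derivative g') (at s within S)" "g s \<in> cyl a c" for g g' s S
  proof -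
    have "(X has_derivative (\<lambda>h. A (g s) * h + B (g s) * cnj h)) (at (g s) within g ` S)"
      using X[OF that(2)] by (simp add: has_wirtinger_def has_derivative_at_withinI)
    from vector_derivative_diff_chain_within[OF that(1) this] show ?thesis by (simp add: o_def)
  qed
  have "((\<lambda>t. A (Complex t \<theta>) + B (Complex t \<theta>)) has_integral X (Complex c \<theta>) - X (Complex a \<theta>)) {a..c}"
    if "0 \<le> \<theta>" "\<theta> \<le> 2 * pi" for \<theta>
  proof (rule fundamental_theorem_of_calculus[OF \<open>a \<le> c\<close>])
    fix t assume "t \<in> {a..c}"
    moreover have "((\<lambda>t. Complex t \<theta>) has_vector_derivative 1) (at t within {a..c})"
      unfolding Complex_eq by (auto intro!: derivative_eq_intros)
    ultimately show "((\<lambda>t. X (Complex t \<theta>)) has_vector_derivative A (Complex t \<theta>) + B (Complex t \<theta>)) (at t within {a..c})"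
      using dX[of "\<lambda>t. Complex t \<theta>" 1 t] that by (simp add: cyl_def)
  qed
  then have "integral {a..c} (\<lambda>t. A (Complex t \<theta>) + B (Complex t \<theta>)) = 0" if "\<theta> \<in> {0..2 * pi}" for \<theta>
    using that ends by (auto dest!: integral_unique)
  then have "integral {0..2 * pi} (\<lambda>\<theta>. integral {a..c} (\<lambda>t. A (Complex t \<theta>) + B (Complex t \<theta>)))
      = integral {0..2 * pi} (\<lambda>\<theta>. 0)" by (rule integral_cong)
  then have "cylint a c (\<lambda>w. A w + B w) = 0"
    using cylint_iterated(2)[of a c "\<lambda>w. A w + B w"] A B by (simp add: continuous_intros)
  then have sum: "cylint a c A + cylint a c B = 0"
    using cylint_add[OF A B] by simp
  have contB: "continuous_on (cyl a c) (\<lambda>w. - 1 * B w)" by (intro continuous_intros B)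
  have contB': "continuous_on (cyl a c) (\<lambda>w. A w + - 1 * B w)" by (intro continuous_on_add A contB)
  have contAB: "continuous_on (cyl a c) (\<lambda>w. \<i> * (A w + - 1 * B w))" by (intro continuous_on_mult continuous_on_const contB')
  have FT: "((\<lambda>\<theta>. \<i> * (A (Complex t \<theta>) + - 1 * B (Complex t \<theta>))) has_integral X (Complex t (2 * pi)) - X (Complex t 0)) {0..2 * pi}"
    if t: "t \<in> {a..c}" for t
  proof (rule fundamental_theorem_of_calculus)
    fix \<theta> assume "\<theta> \<in> {0..2 * pi}"
    moreover have "((\<lambda>\<theta>. Complex t \<theta>) has_vector_derivative \<i>) (at \<theta> within {0..2 * pi})"
      unfolding Complex_eq by (auto intro!: derivative_eq_intros)
    ultimately show "((\<lambda>\<theta>. X (Complex t \<theta>)) has_vector_derivative \<i> * (A (Complex t \<theta>) + - 1 * B (Complex t \<theta>))) (at \<theta> within {0..2 * pi})"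
      using dX[of "\<lambda>\<theta>. Complex t \<theta>" \<i> \<theta>] t by (simp add: cyl_def algebra_simps)
  qed simp
  have "integral {0..2 * pi} (\<lambda>\<theta>. \<i> * (A (Complex t \<theta>) + - 1 * B (Complex t \<theta>))) = 0" if "t \<in> {a..c}" for t
    using integral_unique[OF FT[OF that]] periodic[of t] that by (simp only: atLeastAtMost_iff diff_self simp_thms)
  then have "integral {a..c} (\<lambda>t. integral {0..2 * pi} (\<lambda>\<theta>. \<i> * (A (Complex t \<theta>) + - 1 * B (Complex t \<theta>))))
      = integral {a..c} (\<lambda>t. 0)" by (rule integral_cong)
  then have "cylint a c (\<lambda>w. \<i> * (A w + - 1 * B w)) = 0"
    using cylint_iterated(1)[of a c "\<lambda>w. \<i> * (A w + - 1 * B w)"] contAB by simp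
  moreover have "cylint a c (\<lambda>w. \<i> * (A w + - 1 * B w)) = \<i> * (cylint a c A + - 1 * cylint a c B)"
    using cylint_mult_left[OF contB', of \<i>] cylint_add[OF A contB] cylint_mult_left[OF B, of "-1"] by simp
  ultimately have "cylint a c A = cylint a c B" by simp
  with sum show "cylint a c A = 0" "cylint a c B = 0" by simp_all
qed

section \<open>Conical ends of solutions of Liouville's equation\<close>

text \<open>The weight on a window is the square of this function. It vanishes at both ends, and its derivative is at
most \<open>2 / (c - a)\<close> times its square root, so that terms in which the weight is differentiated can be
absorbed into an energy that carries the weight itself.\<close>
definition cutoff :: "real \<Rightarrow> real \<Rightarrow> complex \<Rightarrow> real" where
  "cutoff a c w = (Re w - a) * (c - Re w) / (c - a)\<^sup>2"

text \<open>The derivative of \<^const>\<open>cutoff\<close> with respect to \<open>Re w\<close>.\<close>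
definition cutoff' :: "real \<Rightarrow> real \<Rightarrow> complex \<Rightarrow> real" where
  "cutoff' a c w = (a + c - 2 * Re w) / (c - a)\<^sup>2"

lemma cutoff_bounds:
  assumes "a < c" "w \<in> cyl a c"
  shows "0 \<le> cutoff a c w" "cutoff a c w \<le> 1" "\<bar>cutoff' a c w\<bar> \<le> 1 / (c - a)"
proof -
  have w: "0 \<le> Re w - a" "Re w - a \<le> c - a" "0 \<le> c - Re w" "c - Re w \<le> c - a"
    using assms by (auto simp: cyl_def)
  show "0 \<le> cutoff a c w" using w by (simp add: cutoff_def)
  have "(Re w - a) * (c - Re w) \<le> (c - a) * (c - a)"
    using w by (intro mult_mono) auto
  then show "cutoff a c w \<le> 1"
    using assms by (simp add: cutoff_def power2_eq_square)
  have "\<bar>a + c - 2 * Re w\<bar> \<le> c - a" using w by linarith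
  then have "\<bar>a + c - 2 * Re w\<bar> / (c - a)\<^sup>2 \<le> (c - a) / (c - a)\<^sup>2"
    by (rule divide_right_mono) simp
  then show "\<bar>cutoff' a c w\<bar> \<le> 1 / (c - a)"
    using assms by (simp add: cutoff'_def power2_eq_square)
qed

lemma has_wirtinger_Re: "has_wirtinger (\<lambda>w. of_real (Re w)) (1/2) (1/2) z"
proof -
  have "has_wirtinger (\<lambda>w. 1/2 * (w + cnj w)) (1/2) (1/2) z"
  proof -
    have id: "has_wirtinger (\<lambda>w. w) 1 0 z" by (simp add: has_wirtinger_def)
    show ?thesis
      by (rule has_wirtinger_cong_values[OF has_wirtinger_mult[OF has_wirtinger_const
          has_wirtinger_add[OF id has_wirtinger_cnj[OF id]]]]) simp_all
  qed
  then show ?thesis by (simp add: of_real_Re_eq_half_sum)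
qed

text \<open>A function of \<open>Re w\<close> has both Wirtinger derivatives equal to half its ordinary derivative.\<close>
lemma has_wirtinger_cutoff_squared:
  assumes "a < c"
  shows "has_wirtinger (\<lambda>w. of_real ((cutoff a c w)\<^sup>2))
    (of_real (cutoff a c z * cutoff' a c z)) (of_real (cutoff a c z * cutoff' a c z)) z"
proof -
  let ?s = "\<lambda>w. (of_real (Re w) - of_real a) * (of_real c - of_real (Re w)) * of_real (1 / (c - a)\<^sup>2)"
  have s: "has_wirtinger ?s (of_real (cutoff' a c z) / 2) (of_real (cutoff' a c z) / 2) z"
    by (rule has_wirtinger_cong_values[OF has_wirtinger_mult[OF has_wirtinger_mult[OF 
        has_wirtinger_diff[OF has_wirtinger_Re has_wirtinger_const] 
        has_wirtinger_diff[OF has_wirtinger_const has_wirtinger_Re]] has_wirtinger_const]])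
      (simp_all add: cutoff'_def diff_divide_distrib add_divide_distrib mult.commute)
  have eq: "?s w = complex_of_real (cutoff a c w)" for w by (simp add: cutoff_def)
  have "has_wirtinger (\<lambda>w. ?s w * ?s w) (of_real (cutoff a c z * cutoff' a c z)) (of_real (cutoff a c z * cutoff' a c z)) z"
    by (rule has_wirtinger_cong_values[OF has_wirtinger_mult[OF s s]]) (unfold eq, simp_all)
  then show ?thesis unfolding eq by (simp add: power2_eq_square)
qed

lemma integral_cutoff_squared:
  assumes "a < c"
  shows "((\<lambda>t. (cutoff a c (Complex t \<theta>))\<^sup>2) has_integral (c - a) / 30) {a..c}"
proof -
  let ?L = "c - a"
  define k where "k = 1 / ?L ^ 4"
  \<comment> \<open>the primitive of \<open>x\<^sup>2 (L - x)\<^sup>2 / L\<^sup>4\<close> at \<open>x = t - a\<close>\<close>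
  let ?F = "\<lambda>t. k * (?L\<^sup>2 * (t - a) ^ 3 / 3 - ?L * (t - a) ^ 4 / 2 + (t - a) ^ 5 / 5)"
  have "((\<lambda>t. (cutoff a c (Complex t \<theta>))\<^sup>2) has_integral ?F c - ?F a) {a..c}"
  proof (rule fundamental_theorem_of_calculus)
    show "a \<le> c" using assms by simp
    fix t
    have "(?F has_real_derivative k * (?L\<^sup>2 * (t - a)\<^sup>2 - ?L * (2 * (t - a) ^ 3) + (t - a) ^ 4)) (at t within {a..c})"
      by (auto intro!: derivative_eq_intros)
    moreover have "(cutoff a c (Complex t \<theta>))\<^sup>2 = k * (?L\<^sup>2 * (t - a)\<^sup>2 - ?L * (2 * (t - a) ^ 3) + (t - a) ^ 4)"
    proof -
      have "(cutoff a c (Complex t \<theta>))\<^sup>2 = k * ((t - a) * (?L - (t - a)))\<^sup>2"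
        by (simp add: cutoff_def k_def power_divide)
      also have "((t - a) * (?L - (t - a)))\<^sup>2 = ?L\<^sup>2 * (t - a)\<^sup>2 - ?L * (2 * (t - a) ^ 3) + (t - a) ^ 4"
        by algebra
      finally show ?thesis .
    qed
    ultimately show "(?F has_vector_derivative (cutoff a c (Complex t \<theta>))\<^sup>2) (at t within {a..c})"
      by (simp add: has_real_derivative_iff_has_vector_derivative)
  qed
  moreover have "?F c - ?F a = ?L / 30"
  proof -
    have "?F c - ?F a = k * ?L ^ 4 * ?L / 30" by (simp add: eval_nat_numeral field_simps)
    also have "k * ?L ^ 4 = 1" using assms by (simp add: k_def)
    finally show ?thesis by simp
  qed
  ultimately show ?thesis by (simp only:)
qed

lemma isCont_of_complex_of_real:
  assumes "isCont (\<lambda>w. complex_of_real (u w)) z"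
  shows "isCont u z"
  using isCont_Re[OF assms] by simp

lemma liouville_continuous:
  assumes "liouville K \<Omega> \<phi> P Q"
  shows "continuous_on \<Omega> \<phi>" "continuous_on \<Omega> P" "continuous_on \<Omega> Q"
proof -
  have "isCont (\<lambda>w. complex_of_real (\<phi> w)) z" "isCont P z" if "z \<in> \<Omega>" for z
    using assms that has_wirtinger_isCont unfolding liouville_def by blast+
  then show \<phi>: "continuous_on \<Omega> \<phi>" and P: "continuous_on \<Omega> P"
    by (auto intro!: continuous_at_imp_continuous_on isCont_of_complex_of_real)
  have "continuous_on \<Omega> (\<lambda>z. 2 * (Q z - (P z)\<^sup>2))"
    using assms unfolding liouville_def by (blast intro: holomorphic_on_imp_continuous_on)
  then have "continuous_on \<Omega> (\<lambda>z. 2 * (Q z - (P z)\<^sup>2) / 2 + (P z)\<^sup>2)"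
    by (rule continuous_on_add[OF continuous_on_divide[OF _ continuous_on_const]
          continuous_on_power[OF P]]) simp
  then show "continuous_on \<Omega> Q" by (simp add: diff_divide_distrib)
qed

lemma liouville_periodic_derivative:
  assumes L: "liouville K \<Omega> \<phi> P Q" and "z \<in> \<Omega>" "z + s \<in> \<Omega>"
    and per: "\<And>w. w \<in> \<Omega> \<Longrightarrow> \<phi> (w + s) = \<phi> w"
  shows "P (z + s) = P z"
proof -
  have "has_wirtinger (\<lambda>w. of_real (\<phi> w)) (P (z + s)) (cnj (P (z + s))) (z + s)"
    using assms by (simp add: liouville_def)
  then have "has_wirtinger (\<lambda>w. of_real (\<phi> (w + s))) (P (z + s) * 1) (cnj (P (z + s)) * cnj 1) z"
    by (rule has_wirtinger_compose_holomorphic) (auto intro!: derivative_eq_intros)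
  then have "has_wirtinger (\<lambda>w. of_real (\<phi> w)) (P (z + s) * 1) (cnj (P (z + s)) * cnj 1) z"
    by (rule has_wirtinger_transform[where U = \<Omega>]) (use assms in \<open>auto simp: liouville_def\<close>)
  moreover have "has_wirtinger (\<lambda>w. of_real (\<phi> w)) (P z) (cnj (P z)) z"
    using assms by (simp add: liouville_def)
  ultimately show ?thesis by (metis has_wirtinger_unique(1) mult.right_neutral)
qed

text \<open>A cone in logarithmic coordinates: in the coordinate \<open>z = exp w\<close> it has total angle \<open>2 \<pi> b\<close> and order
\<open>b - 1\<close>.\<close>
locale conical_end =
  fixes K \<tau> b B :: real and \<Psi> :: "complex \<Rightarrow> real" and P Q :: "complex \<Rightarrow> complex"
  assumes L: "liouville K {w. Re w < \<tau>} \<Psi> P Q"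
    and periodic: "\<And>w. Re w < \<tau> \<Longrightarrow> \<Psi> (w + 2 * pi * \<i>) = \<Psi> w"
    and bounded: "\<And>w. Re w < \<tau> \<Longrightarrow> \<bar>\<Psi> w - b * Re w\<bar> \<le> B"
    and b_pos: "b > 0"
begin

text \<open>The bounded part of the potential, its derivative \<open>\<partial>U\<close>, and \<open>\<partial>\<^bsub>bar\<^esub>\<partial>U\<close>, a quarter of its Laplacian.\<close>
definition U where "U w = \<Psi> w - b * Re w"
definition p where "p w = P w - of_real (b / 2)"
definition r where "r w = - K / 4 * exp (2 * \<Psi> w)"

lemma B_nonneg: "B \<ge> 0"
proof -
  have "Re (of_real (\<tau> - 1)) < \<tau>" by simp
  from bounded[OF this] show ?thesis by linarith
qed

lemma U_wirtinger:
  assumes "Re w < \<tau>"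
  shows "has_wirtinger (\<lambda>w. of_real (U w)) (p w) (cnj (p w)) w"
proof -
  have "has_wirtinger (\<lambda>w. of_real (\<Psi> w)) (P w) (cnj (P w)) w"
    using L assms by (simp add: liouville_def)
  from has_wirtinger_diff[OF this has_wirtinger_mult[OF has_wirtinger_const[of "of_real b"] has_wirtinger_Re]]
  show ?thesis by (simp add: U_def p_def)
qed

lemma p_wirtinger:
  assumes "Re w < \<tau>"
  shows "has_wirtinger p (Q w) (of_real (r w)) w"
proof -
  have "has_wirtinger P (Q w) (of_real (r w)) w"
    using L assms by (simp add: liouville_def r_def)
  from has_wirtinger_diff[OF this has_wirtinger_const]
  show ?thesis unfolding p_def by simp
qed

lemma cyl_subset: "c < \<tau> \<Longrightarrow> cyl a c \<subseteq> {w. Re w < \<tau>}"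
  by (auto simp: cyl_def)

lemma continuous:
  assumes "c < \<tau>"
  shows "continuous_on (cyl a c) \<Psi>" "continuous_on (cyl a c) U" "continuous_on (cyl a c) P"
    "continuous_on (cyl a c) p" "continuous_on (cyl a c) Q" "continuous_on (cyl a c) r"
proof -
  note c = liouville_continuous[OF L, THEN continuous_on_subset, OF cyl_subset[OF assms]]
  show "continuous_on (cyl a c) \<Psi>" "continuous_on (cyl a c) P" "continuous_on (cyl a c) Q"
    by (rule c)+
  show "continuous_on (cyl a c) U" "continuous_on (cyl a c) p" "continuous_on (cyl a c) r"
    unfolding U_def[abs_def] p_def[abs_def] r_def[abs_def] by (intro continuous_intros c; simp)+
qed

lemma continuous_cutoff: 
  "continuous_on S (cutoff a c)" "continuous_on S (cutoff' a c)"
  unfolding cutoff_def[abs_def] cutoff'_def[abs_def] divide_inverse by (intro continuous_intros)+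

lemma shift:
  assumes "t < \<tau>"
  shows "U (Complex t (2 * pi)) = U (Complex t 0)" "p (Complex t (2 * pi)) = p (Complex t 0)"
proof -
  have eq: "Complex t (2 * pi) = Complex t 0 + 2 * pi * \<i>" by (simp add: complex_eq_iff)
  show "U (Complex t (2 * pi)) = U (Complex t 0)"
    unfolding eq U_def using periodic[of "Complex t 0"] assms by simp
  show "p (Complex t (2 * pi)) = p (Complex t 0)"
    unfolding eq p_def
    using liouville_periodic_derivative[OF L, of "Complex t 0" "2 * pi * \<i>"] periodic assms by simp
qed

text \<open>On a window of length \<open>l\<close> contained in \<open>Re w \<le> - l\<close> the Laplacian is of order \<open>exp (- 2 b l)\<close>, hence at
most a constant over \<open>l\<^sup>2\<close>, by \<open>exp (2 b l) \<ge> 2 b\<^sup>2 l\<^sup>2\<close>.\<close>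
definition curvature_const where "curvature_const = \<bar>K\<bar> / 4 * exp (2 * B) / (2 * b\<^sup>2)"

lemma curvature_const_nonneg: "curvature_const \<ge> 0"
  by (simp add: curvature_const_def)

lemma curvature_bound:
  assumes "l > 0" "c < \<tau>" "c \<le> - l" "w \<in> cyl a c"
  shows "\<bar>r w\<bar> \<le> curvature_const / l\<^sup>2"
proof -
  have w: "Re w \<le> c" "Re w < \<tau>" using assms by (auto simp: cyl_def)
  have "\<Psi> w \<le> B + b * Re w" using bounded[OF w(2)] by linarith
  also have "\<dots> \<le> B - b * l" using w assms(3) b_pos mult_left_mono[of "Re w" "- l" b] by simp
  finally have "exp (2 * \<Psi> w) \<le> exp (2 * B - 2 * b * l)" by simp
  also have "\<dots> = exp (2 * B) / exp (2 * b * l)" by (simp add: exp_diff)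
  also have "\<dots> \<le> exp (2 * B) / (2 * b\<^sup>2 * l\<^sup>2)"
  proof (rule divide_left_mono)
    have "2 * b\<^sup>2 * l\<^sup>2 \<le> 1 + 2 * b * l + (2 * b * l)\<^sup>2 / 2"
      using b_pos assms(1) by (simp add: power_mult_distrib)
    also have "\<dots> \<le> exp (2 * b * l)"
      using b_pos assms(1) by (intro exp_lower_Taylor_quadratic) simp
    finally show "2 * b\<^sup>2 * l\<^sup>2 \<le> exp (2 * b * l)" .
  qed (use b_pos assms(1) in auto)
  finally have "\<bar>K\<bar> / 4 * exp (2 * \<Psi> w) \<le> \<bar>K\<bar> / 4 * (exp (2 * B) / (2 * b\<^sup>2 * l\<^sup>2))"
    by (rule mult_left_mono) simp
  then show ?thesis by (simp add: r_def curvature_const_def abs_mult)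
qed

definition energy where
  "energy a c = cylint a c (\<lambda>w. (cutoff a c w)\<^sup>2 * (cmod (p w))\<^sup>2)"

definition energy_const where
  "energy_const = 2 * pi * (B\<^sup>2 + 2 * B * curvature_const)"

lemma cutoff_ends: "cutoff a c (Complex a \<theta>) = 0" "cutoff a c (Complex c \<theta>) = 0"
  by (simp_all add: cutoff_def)

text \<open>Caccioppoli's inequality. With the weight \<open>\<chi>\<close> the integral of
\<open>\<partial>\<^bsub>bar\<^esub>(\<chi> U p) = \<chi> |p|\<^sup>2 + (\<partial>\<^bsub>bar\<^esub>\<chi>) U p + \<chi> U r\<close> vanishes. The term with \<open>\<partial>\<^bsub>bar\<^esub>\<chi>\<close>, of size \<open>B / l\<close> times
\<open>sqrt \<chi> |p|\<close>, is absorbed up to \<open>B\<^sup>2 / l\<^sup>2\<close>, and the remaining terms are integrated over an area of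
order \<open>l\<close>.\<close>
lemma energy_bound:
  assumes l: "c - a > 0" "c < \<tau>" "c \<le> - (c - a)"
  shows "(c - a) * energy a c \<le> energy_const"
proof -
  define l where "l = c - a"
  let ?s = "cutoff a c" and ?s' = "cutoff' a c"
  let ?g = "\<lambda>w. (?s w)\<^sup>2 * (cmod (p w))\<^sup>2"
  let ?rest = "\<lambda>w. of_real (?s w * ?s' w * U w) * p w + of_real ((?s w)\<^sup>2 * U w * r w)"
  note cont = continuous[OF l(2)] continuous_cutoff
  let ?X = "\<lambda>w. of_real ((?s w)\<^sup>2) * (of_real (U w) * p w)"
  let ?A = "\<lambda>w. of_real (?s w * ?s' w) * (of_real (U w) * p w) + of_real ((?s w)\<^sup>2) * (p w * p w + of_real (U w) * Q w)"
  let ?B = "\<lambda>w. of_real (?s w * ?s' w) * (of_real (U w) * p w) + of_real ((?s w)\<^sup>2) * (cnj (p w) * p w + of_real (U w) * of_real (r w))"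
  have "cylint a c ?B = 0"
  proof (rule cylint_wirtinger_zero(2)[where X = ?X and A = ?A])
    fix w assume "w \<in> cyl a c"
    then have w: "Re w < \<tau>" using cyl_subset[OF l(2)] by auto
    show "has_wirtinger ?X (?A w) (?B w) w"
      by (intro has_wirtinger_mult has_wirtinger_cutoff_squared U_wirtinger p_wirtinger w) (use l in simp)
  qed (use l shift in \<open>auto intro!: continuous_intros cont simp: cutoff_ends cutoff_def\<close>)
  moreover have "?B = (\<lambda>w. complex_of_real (?g w) + ?rest w)"
  proof
    fix w
    have "p w * cnj (p w) = of_real ((cmod (p w))\<^sup>2)" by (rule complex_norm_square[symmetric])
    then show "?B w = complex_of_real (?g w) + ?rest w" by (simp add: algebra_simps)
  qed
  ultimately have "cylint a c (\<lambda>w. complex_of_real (?g w) + ?rest w) = 0" by (simp only:)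
  moreover have cg: "continuous_on (cyl a c) ?g" by (intro continuous_intros cont)
  moreover have cr: "continuous_on (cyl a c) ?rest" by (intro continuous_intros cont)
  moreover have "continuous_on (cyl a c) (\<lambda>w. complex_of_real (?g w))"
    by (rule continuous_on_of_real[OF cg])
  ultimately have "of_real (energy a c) + cylint a c ?rest = 0"
    using cylint_add[of a c "\<lambda>w. complex_of_real (?g w)" ?rest] cylint_of_real[OF cg]
    unfolding energy_def by (simp only:)
  then have neg: "of_real (energy a c) = - cylint a c ?rest" by (simp only: eq_neg_iff_add_eq_0)
  have "energy a c \<le> cmod (of_real (energy a c))" by simp
  also have "\<dots> = cmod (cylint a c ?rest)" unfolding neg by (rule norm_minus_cancel)
  also have "\<dots> \<le> cylint a c (\<lambda>w. 1/2 * ?g w + (B\<^sup>2 / 2 + B * curvature_const) / l\<^sup>2)"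
  proof (rule cylint_norm_le[OF cr])
    show "continuous_on (cyl a c) (\<lambda>w. 1/2 * ?g w + (B\<^sup>2 / 2 + B * curvature_const) / l\<^sup>2)"
      by (intro continuous_intros cg)
    fix w assume w: "w \<in> cyl a c"
    have s: "0 \<le> ?s w" "?s w \<le> 1" "\<bar>?s' w\<bar> \<le> 1 / l"
      using cutoff_bounds[OF _ w] l by (auto simp: l_def)
    have U: "\<bar>U w\<bar> \<le> B" using bounded[of w] w l by (auto simp: U_def cyl_def)
    have r: "\<bar>r w\<bar> \<le> curvature_const / l\<^sup>2"
      using curvature_bound[of l c w a] l w by (simp add: l_def)
    have "cmod (?rest w) \<le> \<bar>?s w * ?s' w * U w\<bar> * cmod (p w) + \<bar>(?s w)\<^sup>2 * U w * r w\<bar>"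
      using norm_triangle_ineq[of "of_real (?s w * ?s' w * U w) * p w" "of_real ((?s w)\<^sup>2 * U w * r w)"]
      by (simp only: norm_mult norm_of_real)
    also have "\<bar>?s w * ?s' w * U w\<bar> * cmod (p w) \<le> (?s w * cmod (p w)) * (B / l)"
    proof -
      have "\<bar>?s' w\<bar> * \<bar>U w\<bar> \<le> 1 / l * B" using s U l by (intro mult_mono) (auto simp: l_def)
      then have "(?s w * cmod (p w)) * (\<bar>?s' w\<bar> * \<bar>U w\<bar>) \<le> (?s w * cmod (p w)) * (1 / l * B)"
        using s by (intro mult_left_mono) auto
      then show ?thesis using s by (simp add: abs_mult mult_ac)
    qed
    also have "\<dots> \<le> ((?s w * cmod (p w))\<^sup>2 + (B / l)\<^sup>2) / 2"
      using sum_squares_bound[of "?s w * cmod (p w)" "B / l"] by (simp add: mult_ac)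
    also have "\<bar>(?s w)\<^sup>2 * U w * r w\<bar> \<le> 1 * (B * (curvature_const / l\<^sup>2))"
    proof -
      have "(?s w)\<^sup>2 \<le> 1" using s by (simp add: power_le_one)
      then have "(?s w)\<^sup>2 * (\<bar>U w\<bar> * \<bar>r w\<bar>) \<le> 1 * (B * (curvature_const / l\<^sup>2))"
        using U r B_nonneg by (intro mult_mono) auto
      then show ?thesis by (simp add: abs_mult mult_ac)
    qed
    finally show "cmod (?rest w) \<le> 1/2 * ?g w + (B\<^sup>2 / 2 + B * curvature_const) / l\<^sup>2"
      by (simp add: power_mult_distrib power_divide add_divide_distrib)
  qed
  also have "\<dots> = 1/2 * energy a c + 2 * pi * l * ((B\<^sup>2 / 2 + B * curvature_const) / l\<^sup>2)"
  proof -
    have "cylint a c (\<lambda>w. 1/2 * ?g w + (B\<^sup>2 / 2 + B * curvature_const) / l\<^sup>2)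
      = cylint a c (\<lambda>w. 1/2 * ?g w) + cylint a c (\<lambda>w. (B\<^sup>2 / 2 + B * curvature_const) / l\<^sup>2)"
      by (rule cylint_add) (intro continuous_intros cg)+
    also have "cylint a c (\<lambda>w. 1/2 * ?g w) = 1/2 * energy a c"
      unfolding energy_def by (rule cylint_mult_left[OF cg])
    also have "cylint a c (\<lambda>w. (B\<^sup>2 / 2 + B * curvature_const) / l\<^sup>2)
      = 2 * pi * l * ((B\<^sup>2 / 2 + B * curvature_const) / l\<^sup>2)"
      using cylint_const[of a c] l by (simp add: l_def)
    finally show ?thesis .
  qed
  finally have "energy a c \<le> 4 * pi * l * ((B\<^sup>2 / 2 + B * curvature_const) / l\<^sup>2)" by simp
  then have "l * energy a c \<le> l * (4 * pi * l * ((B\<^sup>2 / 2 + B * curvature_const) / l\<^sup>2))"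
    using l by (intro mult_left_mono) (auto simp: l_def)
  also have "\<dots> = energy_const"
  proof -
    have "l > 0" using l by (simp add: l_def)
    then have eq: "l * (4 * pi * l * (x / l\<^sup>2)) = 4 * pi * x" for x
      by (simp add: power2_eq_square)
    show ?thesis unfolding eq by (simp add: energy_const_def algebra_simps)
  qed
  finally show ?thesis by (simp add: l_def)
qed

definition window_const where
  "window_const = 2 * pi * (2 + b) + (4 + b) * energy_const"

text \<open>The tensor is \<open>T + b\<^sup>2/2 = 2 \<partial>p - 2 b p - 2 p\<^sup>2\<close>. The derivative of \<open>p\<close> is moved to the weight and to the
test function \<open>k\<close>, and all remaining terms are estimated by the energy. The term linear in \<open>p\<close> is split as
\<open>2 x \<le> l x\<^sup>2 + 1 / l\<close>: over an area of order \<open>l\<close> both parts are bounded, since \<open>l\<close> times the energy is.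
Independence of \<open>a\<close>, \<open>c\<close> and \<open>k\<close> is what makes the estimate useful.\<close>
lemma window_bound:
  assumes l: "c - a \<ge> 1" "c < \<tau>" "c \<le> - (c - a)"
    and k: "\<And>w. w \<in> cyl a c \<Longrightarrow> (k has_field_derivative k' w) (at w)"
    and contk': "continuous_on (cyl a c) k'"
    and M: "\<And>w. w \<in> cyl a c \<Longrightarrow> cmod (k w) \<le> M" "\<And>w. w \<in> cyl a c \<Longrightarrow> cmod (k' w) \<le> M"
    and perk: "\<And>t. a \<le> t \<Longrightarrow> t \<le> c \<Longrightarrow> k (Complex t 0) = k (Complex t (2 * pi))"
  shows "cmod (cylint a c (\<lambda>w. of_real ((cutoff a c w)\<^sup>2) * (k w * (2 * (Q w - (P w)\<^sup>2) + of_real (b\<^sup>2 / 2)))))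
    \<le> window_const * M"
proof -
  define l where "l = c - a"
  let ?s = "cutoff a c" and ?s' = "cutoff' a c"
  note cont = continuous[OF l(2)] continuous_cutoff contk'
  have contk: "continuous_on (cyl a c) k"
    using k DERIV_isCont continuous_at_imp_continuous_on by blast
  let ?X = "\<lambda>w. of_real ((?s w)\<^sup>2) * (k w * p w)"
  let ?A = "\<lambda>w. of_real (?s w * ?s' w) * (k w * p w) + of_real ((?s w)\<^sup>2) * (k' w * p w + k w * Q w)"
  let ?B = "\<lambda>w. of_real (?s w * ?s' w) * (k w * p w) + of_real ((?s w)\<^sup>2) * (0 * p w + k w * of_real (r w))"
  have A0: "cylint a c ?A = 0"
  proof (rule cylint_wirtinger_zero(1)[where X = ?X and B = ?B])
    fix w assume wc: "w \<in> cyl a c"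
    then have w: "Re w < \<tau>" using cyl_subset[OF l(2)] by auto
    show "has_wirtinger ?X (?A w) (?B w) w"
      by (intro has_wirtinger_mult has_wirtinger_cutoff_squared p_wirtinger w
          k[OF wc, folded has_wirtinger_iff_field_derivative]) (use l in simp)
  qed (use l shift perk in \<open>auto intro!: continuous_intros cont contk simp: cutoff_ends cutoff_def\<close>)
  have cA: "continuous_on (cyl a c) ?A" by (intro continuous_intros cont contk)
  let ?G = "\<lambda>w. - 2 * (of_real (?s w * ?s' w) * (k w * p w) + of_real ((?s w)\<^sup>2) * (k' w * p w))
      - 2 * of_real b * (of_real ((?s w)\<^sup>2) * (k w * p w)) - 2 * (of_real ((?s w)\<^sup>2) * (k w * (p w)\<^sup>2))"
  have cG: "continuous_on (cyl a c) ?G" by (intro continuous_intros cont contk)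
  have "of_real ((?s w)\<^sup>2) * (k w * (2 * (Q w - (P w)\<^sup>2) + of_real (b\<^sup>2 / 2))) = 2 * ?A w + ?G w" for w
  proof -
    have "P w = p w + of_real b / 2" by (simp add: p_def)
    moreover have "s2 * (k * (2 * (Q - (p + b / 2)\<^sup>2) + b\<^sup>2 / 2))
      = 2 * (ss * (k * p) + s2 * (k' * p + k * Q)) + (- 2 * (ss * (k * p) + s2 * (k' * p))
      - 2 * b * (s2 * (k * p)) - 2 * (s2 * (k * p\<^sup>2)))" for s2 k Q p b ss k' :: complex
      by (simp add: power2_eq_square field_simps)
    ultimately show ?thesis by simp
  qed
  then have "cylint a c (\<lambda>w. of_real ((?s w)\<^sup>2) * (k w * (2 * (Q w - (P w)\<^sup>2) + of_real (b\<^sup>2 / 2))))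
     = cylint a c (\<lambda>w. 2 * ?A w + ?G w)" by (simp only:)
  also have "\<dots> = 2 * cylint a c ?A + cylint a c ?G"
    using cylint_add[OF continuous_on_mult_left[OF cA, of 2] cG] cylint_mult_left[OF cA, of 2] by (simp only:)
  also have "\<dots> = cylint a c ?G" unfolding A0 by simp
  finally have eq: "cylint a c (\<lambda>w. of_real ((?s w)\<^sup>2) * (k w * (2 * (Q w - (P w)\<^sup>2) + of_real (b\<^sup>2 / 2))))
     = cylint a c ?G" .
  let ?g = "\<lambda>w. (?s w)\<^sup>2 * (cmod (p w))\<^sup>2"
  have cg: "continuous_on (cyl a c) ?g" by (intro continuous_intros cont)
  have M0: "M \<ge> 0"
  proof -
    have "Complex a 0 \<in> cyl a c" using l by (simp add: cyl_def)
    from M(1)[OF this] show ?thesis using norm_ge_zero order_trans by blast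
  qed
  have "cmod (cylint a c ?G) \<le> cylint a c (\<lambda>w. M * (((2 + b) * l + 2) * ?g w + (2 + b) / l))"
  proof (rule cylint_norm_le[OF cG])
    show "continuous_on (cyl a c) (\<lambda>w. M * (((2 + b) * l + 2) * ?g w + (2 + b) / l))"
      by (intro continuous_intros cg)
    fix w assume w: "w \<in> cyl a c"
    have l1: "l \<ge> 1" using l by (simp add: l_def)
    have s: "0 \<le> ?s w" "?s w \<le> 1" "\<bar>?s' w\<bar> \<le> 1 / l"
      using cutoff_bounds[OF _ w] l by (auto simp: l_def)
    have s'1: "\<bar>?s' w\<bar> \<le> 1" using s(3) l1 by (elim order_trans) simp
    have s2: "(?s w)\<^sup>2 \<le> ?s w" using s by (simp add: power2_eq_square mult_left_le)
    \<comment> \<open>the square of \<open>x\<close> is the energy density\<close>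
    define x where "x = ?s w * cmod (p w)"
    have x0: "x \<ge> 0" using s by (simp add: x_def)
    have "cmod (?G w) \<le> cmod (- 2 * (of_real (?s w * ?s' w) * (k w * p w) + of_real ((?s w)\<^sup>2) * (k' w * p w)))
       + cmod (2 * of_real b * (of_real ((?s w)\<^sup>2) * (k w * p w))) + cmod (2 * (of_real ((?s w)\<^sup>2) * (k w * (p w)\<^sup>2)))"
      by (intro order_trans[OF norm_triangle_ineq4] add_mono order_refl)
    also have "cmod (- 2 * (of_real (?s w * ?s' w) * (k w * p w) + of_real ((?s w)\<^sup>2) * (k' w * p w)))
       \<le> 2 * (M * x + M * x)"
    proof -
      have 1: "cmod (of_real (?s w * ?s' w) * (k w * p w)) \<le> M * x"
      proof -
        have "\<bar>?s' w\<bar> * cmod (k w) \<le> 1 * M" using s'1 M(1)[OF w] by (intro mult_mono) auto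
        then have "x * (\<bar>?s' w\<bar> * cmod (k w)) \<le> x * (1 * M)" using x0 by (rule mult_left_mono)
        then show ?thesis using s by (simp add: norm_mult x_def abs_mult mult_ac)
      qed
      have 2: "cmod (of_real ((?s w)\<^sup>2) * (k' w * p w)) \<le> M * x"
      proof -
        have "?s w * cmod (k' w) \<le> 1 * M" using s M(2)[OF w] by (intro mult_mono) auto
        then have "x * (?s w * cmod (k' w)) \<le> x * (1 * M)" using x0 by (rule mult_left_mono)
        then show ?thesis using s by (simp add: norm_mult x_def power2_eq_square mult_ac)
      qed
      have "cmod (of_real (?s w * ?s' w) * (k w * p w) + of_real ((?s w)\<^sup>2) * (k' w * p w)) \<le> M * x + M * x"
        using norm_triangle_ineq 1 2 add_mono order_trans by blast
      then show ?thesis by (simp only: norm_mult) simp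
    qed
    also have "cmod (2 * of_real b * (of_real ((?s w)\<^sup>2) * (k w * p w))) \<le> 2 * b * (M * x)"
    proof -
      have "?s w * cmod (k w) \<le> 1 * M" using s M(1)[OF w] by (intro mult_mono) auto
      then have "x * (?s w * cmod (k w)) \<le> x * (1 * M)" using x0 by (rule mult_left_mono)
      then have "2 * b * (x * (?s w * cmod (k w))) \<le> 2 * b * (x * (1 * M))" using b_pos by simp
      then show ?thesis using s b_pos by (simp add: norm_mult x_def power2_eq_square mult_ac)
    qed
    also have "cmod (2 * (of_real ((?s w)\<^sup>2) * (k w * (p w)\<^sup>2))) \<le> 2 * (M * x\<^sup>2)"
    proof -
      have "x\<^sup>2 * cmod (k w) \<le> x\<^sup>2 * M" using M(1)[OF w] by (intro mult_left_mono) auto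
      then show ?thesis using s by (simp add: norm_mult x_def power2_eq_square mult_ac)
    qed
    also have "2 * (M * x + M * x) + 2 * b * (M * x) + 2 * (M * x\<^sup>2) = M * ((2 + b) * (2 * x) + 2 * x\<^sup>2)"
      by (simp add: algebra_simps)
    also have "\<dots> \<le> M * ((2 + b) * (l * x\<^sup>2 + 1 / l) + 2 * x\<^sup>2)"
    proof -
      have "0 \<le> (l * x - 1)\<^sup>2 / l" using l1 by simp
      also have "\<dots> = l * x\<^sup>2 - 2 * x + 1 / l" using l1 by (simp add: power2_eq_square field_simps)
      finally show ?thesis using M0 b_pos by (intro mult_left_mono add_mono) auto
    qed
    also have "\<dots> = M * (((2 + b) * l + 2) * ?g w + (2 + b) / l)"
      by (simp add: x_def power_mult_distrib algebra_simps add_divide_distrib)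
    finally show "cmod (?G w) \<le> M * (((2 + b) * l + 2) * ?g w + (2 + b) / l)" by simp
  qed
  also have "\<dots> = M * (((2 + b) * l + 2) * energy a c + 2 * pi * l * ((2 + b) / l))"
  proof -
    have "continuous_on (cyl a c) (\<lambda>w. ((2 + b) * l + 2) * ?g w + (2 + b) / l)"
      by (intro continuous_intros cg)
    then have "cylint a c (\<lambda>w. M * (((2 + b) * l + 2) * ?g w + (2 + b) / l)) =
      M * cylint a c (\<lambda>w. ((2 + b) * l + 2) * ?g w + (2 + b) / l)" by (rule cylint_mult_left)
    also have "cylint a c (\<lambda>w. ((2 + b) * l + 2) * ?g w + (2 + b) / l) =
       cylint a c (\<lambda>w. ((2 + b) * l + 2) * ?g w) + cylint a c (\<lambda>w. (2 + b) / l)"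
      by (rule cylint_add) (intro continuous_intros cg)+
    also have "cylint a c (\<lambda>w. ((2 + b) * l + 2) * ?g w) = ((2 + b) * l + 2) * energy a c"
      unfolding energy_def by (rule cylint_mult_left[OF cg])
    also have "cylint a c (\<lambda>w. (2 + b) / l) = 2 * pi * l * ((2 + b) / l)"
      using cylint_const[of a c] l by (simp add: l_def)
    finally show ?thesis .
  qed
  also have "\<dots> \<le> M * window_const"
  proof (rule mult_left_mono[OF _ M0])
    have l1: "l \<ge> 1" using l by (simp add: l_def)
    have E: "l * energy a c \<le> energy_const" using energy_bound[of c a] l by (simp add: l_def)
    have "0 \<le> energy a c"
    proof -
      have "norm (cylint a c (\<lambda>w. 0 :: real)) \<le> energy a c"
        unfolding energy_def by (rule cylint_norm_le) (auto intro!: continuous_intros cg)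
      then show ?thesis using norm_ge_zero order_trans by blast
    qed
    then have "energy a c \<le> l * energy a c" using l1 by (simp add: mult_le_cancel_right1)
    then have "((2 + b) * l + 2) * energy a c \<le> (4 + b) * (l * energy a c)"
      by (simp add: algebra_simps)
    also have "\<dots> \<le> (4 + b) * energy_const" using E b_pos by (intro mult_left_mono) auto
    finally show "((2 + b) * l + 2) * energy a c + 2 * pi * l * ((2 + b) / l) \<le> window_const"
      using l1 by (simp add: window_const_def)
  qed
  finally show ?thesis unfolding eq by (simp add: mult.commute)
qed

end

text \<open>The weight depends on \<open>Re w\<close> only and has integral \<open>(c - a) / 30\<close>; for a test function whose mean over
circles does not depend on the radius the window integral is therefore a multiple of this mean.\<close>
lemma cylint_cutoff_product:
  fixes G :: "complex \<Rightarrow> complex"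
  assumes "a < c" and G: "continuous_on (cyl a c) G"
    and J: "\<And>t. a \<le> t \<Longrightarrow> t \<le> c \<Longrightarrow> integral {0..2 * pi} (\<lambda>\<theta>. G (Complex t \<theta>)) = J"
  shows "cylint a c (\<lambda>w. of_real ((cutoff a c w)\<^sup>2) * G w) = of_real ((c - a) / 30) * J"
proof -
  define S where "S t = (cutoff a c (Complex t 0))\<^sup>2" for t
  have s: "(cutoff a c (Complex t \<theta>))\<^sup>2 = S t" for t \<theta> by (simp add: cutoff_def S_def)
  have "continuous_on (cyl a c) (\<lambda>w. of_real ((cutoff a c w)\<^sup>2) * G w)"
    unfolding cutoff_def divide_inverse by (intro continuous_intros G)
  then have "cylint a c (\<lambda>w. of_real ((cutoff a c w)\<^sup>2) * G w)
     = integral {a..c} (\<lambda>t. integral {0..2 * pi} (\<lambda>\<theta>. of_real (S t) * G (Complex t \<theta>)))"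
    by (subst cylint_iterated(1)) (simp_all add: s)
  also have "\<dots> = integral {a..c} (\<lambda>t. of_real (S t) * J)"
    by (rule integral_cong) (simp add: J)
  also have "\<dots> = integral {a..c} (\<lambda>t. complex_of_real (S t)) * J"
    by simp
  also have "integral {a..c} (\<lambda>t. complex_of_real (S t)) = of_real ((c - a) / 30)"
    using has_integral_of_real[OF integral_cutoff_squared[OF \<open>a < c\<close>, of 0], where 'b = complex]
    unfolding S_def by (rule integral_unique)
  finally show ?thesis .
qed

text \<open>By the residue theorem the integral of a function on a punctured disc against the Cauchy kernel of \<open>z0\<close> jumps
by \<open>2 \<pi> F z0\<close> as the circle crosses \<open>z0\<close>; the contribution of the puncture is the same on both sides.\<close>
lemma circle_mean_Cauchy_kernel:
  assumes F: "F holomorphic_on ball 0 \<rho> - {0}" and z0: "z0 \<noteq> 0" "cmod z0 < \<rho>"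
    and r: "0 < r" "r < \<rho>" "r \<noteq> cmod z0"
  shows "integral {0..2 * pi} (\<lambda>\<theta>. of_real r * cis \<theta> / (of_real r * cis \<theta> - z0) * F (of_real r * cis \<theta>))
    = 2 * pi * (residue (\<lambda>z. F z / (z - z0)) 0 + (if cmod z0 < r then F z0 else 0))"
proof -
  let ?f = "\<lambda>z. F z / (z - z0)" and ?g = "circlepath 0 r"
  have "contour_integral ?g ?f = 2 * pi * \<i> * (\<Sum>p\<in>{0, z0}. winding_number ?g p * residue ?f p)"
  proof (rule Residue_theorem[where S = "ball 0 \<rho>"])
    show "?f holomorphic_on ball 0 \<rho> - {0, z0}"
      by (intro holomorphic_intros holomorphic_on_subset[OF F]) auto
    show "path_image ?g \<subseteq> ball 0 \<rho> - {0, z0}" using r z0 by auto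
    show "\<forall>z. z \<notin> ball 0 \<rho> \<longrightarrow> winding_number ?g z = 0"
      using r by (intro allI impI winding_number_zero_outside[of _ "cball 0 r"]) auto
  qed (auto)
  also have "(\<Sum>p\<in>{0, z0}. winding_number ?g p * residue ?f p) =
      residue ?f 0 + winding_number ?g z0 * F z0"
  proof -
    have "residue ?f z0 = F z0"
      using z0 F by (intro residue_simple[of "ball 0 \<rho> - {0}"]) auto
    moreover have "winding_number ?g 0 = 1" using r by (intro winding_number_circlepath) auto
    ultimately show ?thesis using z0 by simp
  qed
  also have "winding_number ?g z0 * F z0 = (if cmod z0 < r then F z0 else 0)"
  proof (cases "cmod z0 < r")
    case True then show ?thesis by (simp add: winding_number_circlepath)
  next
    case False
    then have "winding_number ?g z0 = 0"
      using r by (intro winding_number_zero_outside[of _ "cball 0 r"]) auto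
    with False show ?thesis by simp
  qed
  finally have 1: "contour_integral ?g ?f = \<i> * (2 * pi * (residue ?f 0 + (if cmod z0 < r then F z0 else 0)))"
    by simp
  have "contour_integral ?g ?f = integral {0..2 * pi} (\<lambda>t. ?f (0 + r * cis t) * r * \<i> * cis t)"
    unfolding circlepath_def by (rule contour_integral_part_circlepath_eq) simp
  also have "\<dots> = integral {0..2 * pi} (\<lambda>\<theta>. \<i> * (of_real r * cis \<theta> / (of_real r * cis \<theta> - z0) * F (of_real r * cis \<theta>)))"
    by (rule integral_cong) (simp add: field_simps)
  also have "\<dots> = \<i> * integral {0..2 * pi} (\<lambda>\<theta>. of_real r * cis \<theta> / (of_real r * cis \<theta> - z0) * F (of_real r * cis \<theta>))"
    by (rule integral_mult_right)
  finally show ?thesis using 1 by simp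
qed

lemma circle_mean_value:
  fixes F :: "complex \<Rightarrow> complex"
  assumes F: "F holomorphic_on ball 0 \<rho>" and r: "0 < r" "r < \<rho>"
  shows "integral {0..2 * pi} (\<lambda>\<theta>. F (of_real r * cis \<theta>)) = 2 * pi * F 0"
proof -
  let ?f = "\<lambda>z. F z / (z - 0)" and ?g = "circlepath 0 r"
  have "F holomorphic_on cball 0 r" by (rule holomorphic_on_subset[OF F]) (use r in auto)
  then have "(?f has_contour_integral (2 * of_real pi * \<i> * F 0)) ?g"
    using r by (intro Cauchy_integral_circlepath_simple) auto
  then have "\<i> * (2 * pi * F 0) = contour_integral ?g ?f"
    by (simp add: contour_integral_unique)
  also have "contour_integral ?g ?f = integral {0..2 * pi} (\<lambda>t. ?f (0 + r * cis t) * r * \<i> * cis t)"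
    unfolding circlepath_def by (rule contour_integral_part_circlepath_eq) simp
  also have "\<dots> = integral {0..2 * pi} (\<lambda>\<theta>. \<i> * F (of_real r * cis \<theta>))"
    using r by (intro integral_cong) (simp add: field_simps)
  also have "\<dots> = \<i> * integral {0..2 * pi} (\<lambda>\<theta>. F (of_real r * cis \<theta>))"
    by (rule integral_mult_right)
  finally show ?thesis by simp
qed

text \<open>For \<open>x = exp w\<close> the last two expressions are, up to sign, the Cauchy kernel \<open>x / (x - y)\<close> and its derivative in
\<open>w\<close>. Both are bounded as soon as \<open>w\<close> stays one unit away from \<open>ln |y|\<close>.\<close>
lemma Cauchy_kernel_bounds:
  assumes "2 * cmod x \<le> cmod y \<or> 2 * cmod y \<le> cmod x" "x \<noteq> 0" "y \<noteq> 0"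
  shows "x - y \<noteq> 0" "cmod (x / (x - y)) \<le> 2" "cmod (x * y / (x - y)\<^sup>2) \<le> 2"
proof -
  let ?m = "max (cmod x) (cmod y)"
  have m: "?m > 0" using assms by (simp add: less_max_iff_disj)
  have d: "?m / 2 \<le> cmod (x - y)"
    using assms(1) norm_triangle_ineq2[of x y] norm_triangle_ineq3[of x y] by (auto simp: max_def)
  then show nz: "x - y \<noteq> 0" using m by auto
  have "cmod x \<le> 2 * cmod (x - y)" using d by auto
  then show "cmod (x / (x - y)) \<le> 2" using nz by (simp add: norm_divide divide_le_eq)
  have "cmod x * cmod y \<le> 2 * (?m / 2)\<^sup>2"
  proof -
    have "2 * (cmod x * cmod y) \<le> ?m * ?m"
      using assms(1)
    proof
      assume h: "2 * cmod x \<le> cmod y"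
      then have "(2 * cmod x) * cmod y \<le> cmod y * cmod y" by (intro mult_right_mono) auto
      moreover have "?m = cmod y" using h norm_ge_zero[of x] by (intro max_absorb2) linarith
      ultimately show ?thesis by simp
    next
      assume h: "2 * cmod y \<le> cmod x"
      then have "(2 * cmod y) * cmod x \<le> cmod x * cmod x" by (intro mult_right_mono) auto
      moreover have "?m = cmod x" using h norm_ge_zero[of y] by (intro max_absorb1) linarith
      ultimately show ?thesis by (simp add: mult_ac)
    qed
    then show ?thesis by (simp add: power2_eq_square)
  qed
  also have "(?m / 2)\<^sup>2 \<le> (cmod (x - y))\<^sup>2" using d m by (intro power_mono) auto
  finally have "cmod x * cmod y \<le> 2 * (cmod (x - y))\<^sup>2" by simp
  then show "cmod (x * y / (x - y)\<^sup>2) \<le> 2"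
    using nz by (simp add: norm_divide norm_mult norm_power divide_le_eq)
qed

context conical_end
begin

lemma Complex_exp: "exp (Complex t \<theta>) = of_real (exp t) * cis \<theta>"
  by (simp add: exp_eq_polar)

text \<open>The value at \<open>z0\<close> is the difference of its Cauchy integrals over circles outside and inside. Each of them is
averaged over a window of length 1 at distance 1 from \<open>ln |z0|\<close>, where the window estimate applies uniformly
in \<open>z0\<close>.\<close>
lemma stress_end_bounded:
  assumes F: "F holomorphic_on ball 0 (exp \<tau>) - {0}"
    and FT: "\<And>w. Re w < \<tau> \<Longrightarrow> F (exp w) = 2 * (Q w - (P w)\<^sup>2) + of_real (b\<^sup>2 / 2)"
    and z0: "z0 \<noteq> 0" "cmod z0 < exp (\<tau> - 2)" "cmod z0 < exp (-3)"
  shows "cmod (F z0) \<le> 60 * window_const"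
proof -
  define s where "s = ln (cmod z0)"
  have es: "exp s = cmod z0" using z0 by (simp add: s_def)
  then have s: "s < \<tau> - 2" "s < - 3" using z0 by (metis exp_less_cancel_iff)+
  let ?k = "\<lambda>w. exp w / (exp w - z0)" and ?k' = "\<lambda>w. - (exp w * z0 / (exp w - z0)\<^sup>2)"
  define R where "R = residue (\<lambda>z. F z / (z - z0)) 0"
  have e2: "2 \<le> exp (1::real)" using exp_ge_add_one_self[of 1] by simp
  \<comment> \<open>one argument for the window inside and the window outside the circle through \<open>z0\<close>\<close>
  have main: "cmod J \<le> 60 * window_const"
    if ac: "a = s - 2 \<and> c = s - 1 \<and> J = 2 * pi * R \<or> a = s + 1 \<and> c = s + 2 \<and> J = 2 * pi * (R + F z0)" for a c J
  proof -
    have l: "c - a = 1" "c < \<tau>" "c \<le> - (c - a)" "a < c" using ac s by auto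
    have sep: "2 * cmod (exp w) \<le> cmod z0 \<or> 2 * cmod z0 \<le> cmod (exp w)"
      if w: "w \<in> cyl a c" for w
    proof -
      have "Re w \<le> s - 1 \<or> s + 1 \<le> Re w" using ac w by (auto simp: cyl_def)
      then have "exp (Re w + 1) \<le> exp s \<or> exp (s + 1) \<le> exp (Re w)" by auto
      moreover have "exp x * 2 \<le> exp (x + 1)" for x :: real
        using e2 by (simp add: exp_add)
      ultimately have "exp (Re w) * 2 \<le> exp s \<or> exp s * 2 \<le> exp (Re w)"
        by (meson order_trans)
      then show ?thesis by (simp add: es mult.commute)
    qed
    note kb = Cauchy_kernel_bounds[OF sep exp_not_eq_zero z0(1)]
    have eqF: "F (exp w) = 2 * (Q w - (P w)\<^sup>2) + of_real (b\<^sup>2 / 2)" if "w \<in> cyl a c" for w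
      using FT that l by (auto simp: cyl_def)
    let ?G = "\<lambda>w. ?k w * (2 * (Q w - (P w)\<^sup>2) + of_real (b\<^sup>2 / 2))"
    have ck: "continuous_on (cyl a c) ?k" "continuous_on (cyl a c) ?k'"
      using kb(1) by (auto intro!: continuous_intros)
    have cG: "continuous_on (cyl a c) ?G"
      by (intro continuous_on_mult ck(1)) (intro continuous_intros continuous l)
    have "cmod (cylint a c (\<lambda>w. of_real ((cutoff a c w)\<^sup>2) * ?G w)) \<le> window_const * 2"
    proof (rule window_bound[where k' = ?k'])
      show "(?k has_field_derivative ?k' w) (at w)" if "w \<in> cyl a c" for w
        using kb(1)[OF that]
        by (auto intro!: derivative_eq_intros simp: power2_eq_square field_simps)
      show "?k (Complex t 0) = ?k (Complex t (2 * pi))" for t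
        by (simp add: Complex_exp)
    qed (use l kb ck in auto)
    also have "cylint a c (\<lambda>w. of_real ((cutoff a c w)\<^sup>2) * ?G w) = of_real ((c - a) / 30) * J"
    proof (rule cylint_cutoff_product[OF \<open>a < c\<close> cG])
      fix t assume t: "a \<le> t" "t \<le> c"
      have Fx: "2 * (Q (Complex t \<theta>) - (P (Complex t \<theta>))\<^sup>2) + of_real (b\<^sup>2 / 2) = F (of_real (exp t) * cis \<theta>)"
        if "\<theta> \<in> {0..2 * pi}" for \<theta>
        using eqF[of "Complex t \<theta>"] t that by (simp add: cyl_def Complex_exp)
      have "integral {0..2 * pi} (\<lambda>\<theta>. ?G (Complex t \<theta>)) =
        integral {0..2 * pi} (\<lambda>\<theta>. of_real (exp t) * cis \<theta> / (of_real (exp t) * cis \<theta> - z0) * F (of_real (exp t) * cis \<theta>))"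
        by (rule integral_cong) (simp only: Fx Complex_exp)
      also have "\<dots> = 2 * pi * (R + (if cmod z0 < exp t then F z0 else 0))"
        unfolding R_def
      proof (rule circle_mean_Cauchy_kernel[OF F z0(1)])
        have "t \<noteq> s" using t ac by auto
        then show "exp t \<noteq> cmod z0" by (simp flip: es)
        show "cmod z0 < exp \<tau>" using s by (simp flip: es)
      qed (use t l in auto)
      also have "\<dots> = J"
      proof -
        have "cmod z0 < exp t \<longleftrightarrow> s < t" by (simp flip: es)
        then show ?thesis using ac t by auto
      qed
      finally show "integral {0..2 * pi} (\<lambda>\<theta>. ?G (Complex t \<theta>)) = J" .
    qed
    finally show ?thesis using l by (simp add: norm_mult norm_divide)
  qed
  have "2 * pi * cmod (F z0) = cmod (2 * pi * (R + F z0) - 2 * pi * R)"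
    by (simp add: algebra_simps norm_mult)
  also have "\<dots> \<le> cmod (2 * pi * (R + F z0)) + cmod (2 * pi * R)" by (rule norm_triangle_ineq4)
  also have "\<dots> \<le> 60 * window_const + 60 * window_const"
    by (intro add_mono main[of "s + 1" "s + 2"] main[of "s - 2" "s - 1"]) auto
  finally have "pi * cmod (F z0) \<le> 60 * window_const" by simp
  moreover have "1 * cmod (F z0) \<le> pi * cmod (F z0)"
    using pi_ge_two by (intro mult_right_mono) auto
  ultimately show ?thesis by simp
qed

text \<open>By the mean value property the window integral with the test function 1 is \<open>F 0\<close> times a multiple of the length,
while the window estimate does not depend on the length.\<close>
lemma stress_end_value:
  assumes F: "F holomorphic_on ball 0 (exp \<tau>)"
    and FT: "\<And>w. Re w < \<tau> \<Longrightarrow> F (exp w) = 2 * (Q w - (P w)\<^sup>2) + of_real (b\<^sup>2 / 2)"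
  shows "F 0 = 0"
proof -
  have bound: "l * cmod (F 0) \<le> 15 * window_const" if l: "l \<ge> 1" "- l < \<tau>" for l
  proof -
    define c a where "c = - l" and "a = - 2 * l"
    have ac: "c - a = l" "c < \<tau>" "a < c" using l by (auto simp: c_def a_def)
    let ?G = "\<lambda>w. 1 * (2 * (Q w - (P w)\<^sup>2) + of_real (b\<^sup>2 / 2))"
    have cG: "continuous_on (cyl a c) ?G"
      by (intro continuous_intros continuous ac)
    have eqF: "F (exp w) = 2 * (Q w - (P w)\<^sup>2) + of_real (b\<^sup>2 / 2)" if "w \<in> cyl a c" for w
      using FT that ac by (auto simp: cyl_def)
    have "cmod (cylint a c (\<lambda>w. of_real ((cutoff a c w)\<^sup>2) * ?G w)) \<le> window_const * 1"
      by (rule window_bound[where k' = "\<lambda>w. 0"]) (use l ac in \<open>auto simp: c_def\<close>)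
    also have "cylint a c (\<lambda>w. of_real ((cutoff a c w)\<^sup>2) * ?G w) = of_real ((c - a) / 30) * (2 * pi * F 0)"
    proof (rule cylint_cutoff_product[OF \<open>a < c\<close> cG])
      fix t assume t: "a \<le> t" "t \<le> c"
      have Fx: "2 * (Q (Complex t \<theta>) - (P (Complex t \<theta>))\<^sup>2) + of_real (b\<^sup>2 / 2) = F (of_real (exp t) * cis \<theta>)"
        if "\<theta> \<in> {0..2 * pi}" for \<theta>
        using eqF[of "Complex t \<theta>"] t that by (simp add: cyl_def Complex_exp)
      have "integral {0..2 * pi} (\<lambda>\<theta>. ?G (Complex t \<theta>)) =
        integral {0..2 * pi} (\<lambda>\<theta>. F (of_real (exp t) * cis \<theta>))"
        by (rule integral_cong) (simp only: Fx mult_1)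
      also have "\<dots> = 2 * pi * F 0"
        by (rule circle_mean_value[OF F]) (use t ac in auto)
      finally show "integral {0..2 * pi} (\<lambda>\<theta>. ?G (Complex t \<theta>)) = 2 * pi * F 0" .
    qed
    finally have "pi * (l * cmod (F 0)) \<le> 15 * window_const"
      using ac l by (simp add: norm_mult norm_divide mult_ac)
    moreover have "1 * (l * cmod (F 0)) \<le> pi * (l * cmod (F 0))"
      using pi_ge_two l by (intro mult_right_mono) auto
    ultimately show ?thesis by simp
  qed
  show ?thesis
  proof (rule ccontr)
    assume "F 0 \<noteq> 0"
    then have n: "cmod (F 0) > 0" by simp
    define l where "l = max (max 1 (1 - \<tau>)) ((15 * window_const + 1) / cmod (F 0))"
    have "15 * window_const + 1 \<le> l * cmod (F 0)"
      using n by (simp add: l_def pos_divide_le_eq[symmetric])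
    also have "\<dots> \<le> 15 * window_const"
      by (rule bound) (auto simp: l_def)
    finally show False by simp
  qed
qed

lemma stress_end_limit:
  assumes F: "F holomorphic_on ball 0 (exp \<tau>) - {0}"
    and FT: "\<And>w. Re w < \<tau> \<Longrightarrow> F (exp w) = 2 * (Q w - (P w)\<^sup>2) + of_real (b\<^sup>2 / 2)"
  shows "(F \<longlongrightarrow> 0) (at 0)"
proof -
  define \<rho> where "\<rho> = min (exp (\<tau> - 2)) (exp (-3))"
  have "\<rho> > 0" by (simp add: \<rho>_def)
  have "F \<in> O[at 0](\<lambda>_. 1)"
  proof (rule bigoI[where c = "60 * window_const"])
    have "\<forall>\<^sub>F z in at 0. z \<noteq> 0 \<and> cmod z < \<rho>"
      using \<open>\<rho> > 0\<close> by (auto simp: eventually_at dist_norm intro!: exI[of _ \<rho>])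
    then show "\<forall>\<^sub>F z in at 0. norm (F z) \<le> 60 * window_const * norm (1 :: complex)"
      by eventually_elim (use stress_end_bounded[OF assms] in \<open>simp add: \<rho>_def\<close>)
  qed
  then obtain G where G: "G holomorphic_on ball 0 (exp \<tau>)" and GF: "\<And>z. z \<in> ball 0 (exp \<tau>) - {0} \<Longrightarrow> G z = F z"
    using holomorphic_on_extend[OF F] by auto
  have "G 0 = 0"
  proof (rule stress_end_value[OF G])
    fix w assume "Re w < \<tau>"
    then show "G (exp w) = 2 * (Q w - (P w)\<^sup>2) + of_real (b\<^sup>2 / 2)"
      using GF[of "exp w"] FT[of w] by simp
  qed
  moreover have "isCont G 0"
    using G holomorphic_on_imp_continuous_on continuous_on_interior by fastforce
  ultimately have "(G \<longlongrightarrow> 0) (at 0)" by (simp add: isCont_def)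
  moreover have "\<forall>\<^sub>F z in at 0. G z = F z"
    using GF by (auto simp: eventually_at dist_norm intro!: exI[of _ "exp \<tau>"])
  ultimately show ?thesis using Lim_transform_eventually by blast
qed

end

text \<open>The substitution \<open>z = exp w\<close> adds \<open>Re w\<close> to the potential and the Schwarzian derivative \<open>- 1/2\<close> to the tensor
\<open>z\<^sup>2 T\<close>; therefore \<open>z\<^sup>2 T\<close> tends to \<open>1/2 - (\<beta> + 1)\<^sup>2 / 2 = - \<beta> (\<beta> + 2) / 2\<close>.\<close>
lemma conical_singularity_stress_limit:
  assumes lv: "liouville K (ball 0 \<delta> - {0}) \<phi> P Q" and "\<delta> > 0"
    and bd: "(\<lambda>z. \<phi> z - \<beta> * ln (cmod z)) \<in> O[at 0](\<lambda>_. 1)" and \<beta>: "\<beta> > -1"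
  shows "((\<lambda>z. z\<^sup>2 * (2 * (Q z - (P z)\<^sup>2))) \<longlongrightarrow> of_real (weight \<beta> / 2)) (at 0)"
proof -
  obtain B where "\<forall>\<^sub>F z in at 0. \<bar>\<phi> z - \<beta> * ln (cmod z)\<bar> \<le> B"
    using bd by (elim landau_o.bigE) auto
  then obtain e where e: "e > 0" "\<And>z. z \<noteq> 0 \<Longrightarrow> cmod z < e \<Longrightarrow> \<bar>\<phi> z - \<beta> * ln (cmod z)\<bar> \<le> B"
    by (auto simp: eventually_at dist_norm)
  define \<tau> where "\<tau> = ln (min e \<delta>)"
  have e\<tau>: "exp \<tau> = min e \<delta>" using e \<open>\<delta> > 0\<close> by (simp add: \<tau>_def)
  let ?H = "{w. Re w < \<tau>}"
  have small: "cmod (exp w) < e \<and> cmod (exp w) < \<delta>" if "w \<in> ?H" for w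
  proof -
    have "exp (Re w) < exp \<tau>" using that by simp
    then show ?thesis by (simp add: e\<tau>)
  qed
  have dexp: "deriv exp = (exp :: complex \<Rightarrow> complex)" by (auto simp: fun_eq_iff intro!: DERIV_imp_deriv derivative_eq_intros)
  have pre: "pre_schwarzian exp = (\<lambda>w. 1)"
    by (auto simp: pre_schwarzian_def dexp fun_eq_iff)
  have S: "schwarzian exp w = - (1/2)" for w by (simp add: schwarzian_def pre)
  let ?\<Psi> = "\<lambda>w. \<phi> (exp w) + ln (cmod (deriv exp w))"
  let ?P = "\<lambda>z. P (exp z) * deriv exp z + pre_schwarzian exp z / 2"
  let ?Q = "\<lambda>z. Q (exp z) * (deriv exp z)\<^sup>2 + P (exp z) * deriv (deriv exp) z + deriv (pre_schwarzian exp) z / 2"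
  have oH: "open ?H" by (rule open_halfspace_Re_lt)
  have L': "liouville K ?H ?\<Psi> ?P ?Q"
    by (rule liouville_pullback(1)[OF lv oH]) (use small in \<open>auto simp: dexp intro: holomorphic_intros\<close>)
  have T: "2 * (?Q w - (?P w)\<^sup>2) = 2 * (Q (exp w) - (P (exp w))\<^sup>2) * (exp w)\<^sup>2 - 1/2" if "w \<in> ?H" for w
    using liouville_pullback(2)[OF lv oH, of exp w] small that
    by (auto simp: dexp S intro: holomorphic_intros)
  interpret conical_end K \<tau> "\<beta> + 1" B ?\<Psi> ?P ?Q
  proof
    show "liouville K ?H ?\<Psi> ?P ?Q" by (rule L')
    show "?\<Psi> (w + 2 * pi * \<i>) = ?\<Psi> w" for w
      using exp_plus_2pin[of w 1] by (simp add: dexp mult_ac)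
    show "\<bar>?\<Psi> w - (\<beta> + 1) * Re w\<bar> \<le> B" if "Re w < \<tau>" for w
      using e(2)[of "exp w"] small[of w] that by (simp add: dexp algebra_simps)
  qed (use \<beta> in simp)
  let ?F = "\<lambda>z. z\<^sup>2 * (2 * (Q z - (P z)\<^sup>2)) - 1/2 + of_real ((\<beta> + 1)\<^sup>2 / 2)"
  have "(?F \<longlongrightarrow> 0) (at 0)"
  proof (rule stress_end_limit)
    have "(\<lambda>z. 2 * (Q z - (P z)\<^sup>2)) holomorphic_on ball 0 (exp \<tau>) - {0}"
      using lv unfolding liouville_def by (elim conjE holomorphic_on_subset) (auto simp: e\<tau>)
    then show "?F holomorphic_on ball 0 (exp \<tau>) - {0}"
      by (intro holomorphic_on_add holomorphic_on_diff holomorphic_on_mult[of "\<lambda>z. z\<^sup>2"]) (auto intro: holomorphic_intros)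
    show "?F (exp w) = 2 * (?Q w - (?P w)\<^sup>2) + of_real ((\<beta> + 1)\<^sup>2 / 2)" if "Re w < \<tau>" for w
      using T[of w] that by (simp add: mult.commute)
  qed
  then have "((\<lambda>z. ?F z + of_real (weight \<beta> / 2)) \<longlongrightarrow> 0 + of_real (weight \<beta> / 2)) (at 0)"
    by (rule tendsto_add) simp
  moreover have "?F z + of_real (weight \<beta> / 2) = z\<^sup>2 * (2 * (Q z - (P z)\<^sup>2))" for z
  proof -
    have "- 1/2 + (\<beta> + 1)\<^sup>2 / 2 + weight \<beta> / 2 = 0"
      by (simp add: weight_def power2_eq_square field_simps)
    then have "complex_of_real (- 1/2 + (\<beta> + 1)\<^sup>2 / 2 + weight \<beta> / 2) = 0"
      by (simp only: of_real_0)
    then show ?thesis by (simp add: algebra_simps)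
  qed
  ultimately show ?thesis by (simp only: add_0)
qed

section \<open>The Schwarzian derivative\<close>

lemma pre_schwarzian_holomorphic:
  assumes "open A" "f holomorphic_on A" "\<And>z. z \<in> A \<Longrightarrow> deriv f z \<noteq> 0"
  shows "pre_schwarzian f holomorphic_on A"
  unfolding pre_schwarzian_def[abs_def]
  by (intro holomorphic_on_divide holomorphic_deriv assms)

lemma deriv_compose:
  assumes "open A" "open B" "f holomorphic_on B" "g holomorphic_on A" "\<And>z. z \<in> A \<Longrightarrow> g z \<in> B" "z \<in> A"
  shows "deriv (\<lambda>z. f (g z)) z = deriv f (g z) * deriv g z"
    "((\<lambda>z. f (g z)) has_field_derivative deriv f (g z) * deriv g z) (at z)"
proof -
  show "((\<lambda>z. f (g z)) has_field_derivative deriv f (g z) * deriv g z) (at z)"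
    by (rule DERIV_chain2[where f = f]) (use assms in \<open>auto intro: holomorphic_derivI\<close>)
  then show "deriv (\<lambda>z. f (g z)) z = deriv f (g z) * deriv g z"
    by (rule DERIV_imp_deriv)
qed

text \<open>The cocycle rule. It follows from the rule \<open>N (f \<circ> g) = (N f \<circ> g) g' + N g\<close> for the logarithmic derivative
\<open>N f = f'' / f'\<close>, as the term \<open>(N f \<circ> g) g''\<close> from differentiating cancels the mixed term of the square.\<close>
lemma schwarzian_compose:
  assumes A: "open A" and B: "open B" and f: "f holomorphic_on B" and g: "g holomorphic_on A"
    and gAB: "\<And>z. z \<in> A \<Longrightarrow> g z \<in> B" and f': "\<And>z. z \<in> B \<Longrightarrow> deriv f z \<noteq> 0"
    and g': "\<And>z. z \<in> A \<Longrightarrow> deriv g z \<noteq> 0" and "u \<in> A"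
  shows "schwarzian (\<lambda>z. f (g z)) u = schwarzian f (g u) * (deriv g u)\<^sup>2 + schwarzian g u"
proof -
  have d1: "deriv (\<lambda>z. f (g z)) z = deriv f (g z) * deriv g z" if "z \<in> A" for z
    by (rule deriv_compose[OF A B f g gAB that])
  have d2: "deriv (deriv (\<lambda>z. f (g z))) z =
      deriv (deriv f) (g z) * deriv g z * deriv g z + deriv (deriv g) z * deriv f (g z)" if z: "z \<in> A" for z
  proof -
    have "((\<lambda>z. deriv f (g z) * deriv g z) has_field_derivative
      deriv (deriv f) (g z) * deriv g z * deriv g z + deriv (deriv g) z * deriv f (g z)) (at z)"
      by (intro DERIV_mult deriv_compose(2)[OF A B _ g gAB z] holomorphic_deriv f B
          holomorphic_derivI[OF holomorphic_deriv[OF g A] A z])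
    then have "(deriv (\<lambda>z. f (g z)) has_field_derivative
      deriv (deriv f) (g z) * deriv g z * deriv g z + deriv (deriv g) z * deriv f (g z)) (at z)"
      by (rule has_field_derivative_transform_within_open[OF _ A z]) (simp add: d1)
    then show ?thesis by (rule DERIV_imp_deriv)
  qed
  have pre: "pre_schwarzian (\<lambda>z. f (g z)) z = pre_schwarzian f (g z) * deriv g z + pre_schwarzian g z"
    if z: "z \<in> A" for z
    using f'[OF gAB[OF z]] g'[OF z]
    by (simp add: pre_schwarzian_def d1[OF z] d2[OF z] add_divide_distrib)
  have "((\<lambda>z. pre_schwarzian f (g z) * deriv g z + pre_schwarzian g z) has_field_derivative
    deriv (pre_schwarzian f) (g u) * deriv g u * deriv g u + deriv (deriv g) u * pre_schwarzian f (g u)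
     + deriv (pre_schwarzian g) u) (at u)"
    by (intro DERIV_add DERIV_mult deriv_compose(2)[OF A B _ g gAB \<open>u \<in> A\<close>] holomorphic_derivI[OF _ A \<open>u \<in> A\<close>]
        holomorphic_deriv g A pre_schwarzian_holomorphic f B f' g')
  then have "(pre_schwarzian (\<lambda>z. f (g z)) has_field_derivative
    deriv (pre_schwarzian f) (g u) * deriv g u * deriv g u + deriv (deriv g) u * pre_schwarzian f (g u)
     + deriv (pre_schwarzian g) u) (at u)"
    by (rule has_field_derivative_transform_within_open[OF _ A \<open>u \<in> A\<close>]) (simp add: pre)
  then have dpre: "deriv (pre_schwarzian (\<lambda>z. f (g z))) u = deriv (pre_schwarzian f) (g u) * deriv g u * deriv g u
     + deriv (deriv g) u * pre_schwarzian f (g u) + deriv (pre_schwarzian g) u"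
    by (rule DERIV_imp_deriv)
  have gg: "deriv (deriv g) u = pre_schwarzian g u * deriv g u"
    using g'[OF \<open>u \<in> A\<close>] by (simp add: pre_schwarzian_def)
  have "x * d * d + n * d * m + y - (m * d + n)\<^sup>2 / 2 = (x - m\<^sup>2 / 2) * d\<^sup>2 + (y - n\<^sup>2 / 2)"
    for x d n m y :: complex
  proof -
    have h: "(m * d + n)\<^sup>2 / 2 = m\<^sup>2 / 2 * d\<^sup>2 + n * d * m + n\<^sup>2 / 2"
      by (simp add: power2_sum power_mult_distrib add_divide_distrib)
    show ?thesis unfolding h by (simp add: left_diff_distrib power2_eq_square[of d])
  qed
  then show ?thesis
    unfolding schwarzian_def dpre pre[OF \<open>u \<in> A\<close>] gg by blast
qed

section \<open>Charts of the sphere\<close>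

lemma deriv_chart:
  "deriv (chart (Fin a)) u = 1" "u \<noteq> 0 \<Longrightarrow> deriv (chart Infty) u = - 1 / u\<^sup>2"
proof -
  show "deriv (chart (Fin a)) u = 1"
  proof -
    have "chart (Fin a) = (\<lambda>w. a + w)" by (simp add: fun_eq_iff)
    then show ?thesis by (auto intro!: DERIV_imp_deriv derivative_eq_intros)
  qed
  show "deriv (chart Infty) u = - 1 / u\<^sup>2" if "u \<noteq> 0"
  proof -
    have "chart Infty = (\<lambda>w. 1 / w)" by (simp add: fun_eq_iff)
    with that show ?thesis
      by (auto simp: power2_eq_square divide_inverse intro!: DERIV_imp_deriv derivative_eq_intros)
  qed
qed

lemma deriv_chart_nonzero: "u \<noteq> 0 \<Longrightarrow> deriv (chart k) u \<noteq> 0"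
  by (cases k) (simp_all add: deriv_chart)

lemma chart_holomorphic: "chart k holomorphic_on - {0}"
proof (cases k)
  case (Fin a)
  have "(\<lambda>w. a + w) holomorphic_on - {0}" by (intro holomorphic_intros)
  then show ?thesis by (simp add: Fin cong: holomorphic_cong)
next
  case Infty
  have "(\<lambda>w. 1 / w) holomorphic_on - {0}" by (intro holomorphic_intros) auto
  then show ?thesis by (simp add: Infty cong: holomorphic_cong)
qed

lemma pre_schwarzian_chart:
  assumes "u \<noteq> 0"
  shows "pre_schwarzian (chart k) u = (case k of Fin a \<Rightarrow> 0 | Infty \<Rightarrow> - 2 / u)"
proof (cases k)
  case (Fin a)
  have "deriv (chart (Fin a)) = (\<lambda>u. 1)" by (rule ext) (rule deriv_chart)
  then show ?thesis by (simp add: Fin pre_schwarzian_def)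
next
  case Infty
  have "((\<lambda>u. - 1 / u\<^sup>2) has_field_derivative 2 / u ^ 3) (at u)"
    using assms by (auto intro!: derivative_eq_intros simp: eval_nat_numeral divide_inverse)
  then have "(deriv (chart Infty) has_field_derivative 2 / u ^ 3) (at u)"
    by (rule has_field_derivative_transform_within_open[where S = "- {0}"]) (use assms deriv_chart(2) in auto)
  then have "deriv (deriv (chart Infty)) u = 2 / u ^ 3" by (rule DERIV_imp_deriv)
  then show ?thesis using assms
    by (simp add: Infty pre_schwarzian_def deriv_chart eval_nat_numeral)
qed

text \<open>The charts are Moebius maps.\<close>
lemma schwarzian_chart:
  assumes "u \<noteq> 0"
  shows "schwarzian (chart k) u = 0"
proof (cases k)
  case (Fin a)
  have "(pre_schwarzian (chart k) has_field_derivative 0) (at u)"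
    by (rule has_field_derivative_transform_within_open[where S = "- {0}" and f = "\<lambda>u. 0"])
      (use assms Fin pre_schwarzian_chart in auto)
  then have "deriv (pre_schwarzian (chart k)) u = 0" by (rule DERIV_imp_deriv)
  then show ?thesis using assms Fin by (simp add: schwarzian_def pre_schwarzian_chart)
next
  case Infty
  have "((\<lambda>u. - 2 / u) has_field_derivative 2 / u\<^sup>2) (at u)"
    using assms by (auto intro!: derivative_eq_intros simp: power2_eq_square divide_inverse)
  then have "(pre_schwarzian (chart k) has_field_derivative 2 / u\<^sup>2) (at u)"
    by (rule has_field_derivative_transform_within_open[where S = "- {0}"])
      (use assms Infty pre_schwarzian_chart[of _ Infty] in auto)
  then have "deriv (pre_schwarzian (chart k)) u = 2 / u\<^sup>2" by (rule DERIV_imp_deriv)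
  then show ?thesis using assms Infty
    by (simp add: schwarzian_def pre_schwarzian_chart power2_eq_square)
qed

text \<open>\<open>T\<close> as a quadratic differential in the chart centred at \<open>k\<close>; since the charts have Schwarzian derivative 0,
this is also the transformation law of the stress-energy tensor. At infinity it turns
\<open>s / (2 x\<^sup>2) + h / x\<^sup>3\<close> into \<open>s / (2 u\<^sup>2) + h / u\<close>, and thereby treats all points alike.\<close>
definition chart_pullback :: "csphere \<Rightarrow> (complex \<Rightarrow> complex) \<Rightarrow> complex \<Rightarrow> complex" where
  "chart_pullback k T u = T (chart k u) * (deriv (chart k) u)\<^sup>2"

lemma chart_pullback_simps:
  "chart_pullback (Fin a) T u = T (a + u)"
  "u \<noteq> 0 \<Longrightarrow> chart_pullback Infty T u = T (1 / u) / u ^ 4"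
  by (simp_all add: chart_pullback_def deriv_chart power_divide flip: power_mult)

section \<open>Isolated singularities\<close>

lemma bigo_1_of_tendsto:
  fixes f :: "complex \<Rightarrow> complex"
  assumes "(f \<longlongrightarrow> l) F" shows "f \<in> O[F](\<lambda>_. 1)"
  by (rule bigoI_tendsto[where c = l]) (use assms in auto)

lemma bigo_1_divide_of_tendsto_0:
  assumes f: "f holomorphic_on U - {a}" and U: "open U" "a \<in> U" and lim: "(f \<longlongrightarrow> 0) (at a)"
  shows "(\<lambda>z. f z / (z - a)) \<in> O[at a](\<lambda>_. 1)"
proof -
  obtain g where g: "g holomorphic_on U" "\<And>z. z \<in> U - {a} \<Longrightarrow> g z = f z"
    using holomorphic_on_extend[OF f _ bigo_1_of_tendsto[OF lim]] U interior_open by blast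
  have gf: "\<forall>\<^sub>F z in at a. g z = f z"
    using g(2) U unfolding eventually_at_topological by blast
  have "isCont g a"
    using g(1) U holomorphic_on_imp_continuous_on continuous_on_eq_continuous_at by blast
  then have "(g \<longlongrightarrow> g a) (at a)" by (simp add: isCont_def)
  then have "(f \<longlongrightarrow> g a) (at a)" using gf by (rule Lim_transform_eventually)
  then have "g a = 0" using lim LIM_unique by blast
  moreover have "(g has_field_derivative deriv g a) (at a)"
    using g(1) U by (rule holomorphic_derivI)
  ultimately have "((\<lambda>z. g z / (z - a)) \<longlongrightarrow> deriv g a) (at a)"
    by (simp add: has_field_derivative_iff)
  then have "((\<lambda>z. f z / (z - a)) \<longlongrightarrow> deriv g a) (at a)"
    by (rule Lim_transform_eventually) (use gf in \<open>auto elim: eventually_mono\<close>)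
  then show ?thesis by (rule bigo_1_of_tendsto)
qed

lemma eq_zero_of_removable_singularities:
  assumes f: "f holomorphic_on - S" and "finite S"
    and rem: "\<And>a. a \<in> S \<Longrightarrow> f \<in> O[at a](\<lambda>_. 1)"
    and inf: "(f \<longlongrightarrow> 0) at_infinity" and z: "z \<notin> S"
  shows "f z = 0"
proof -
  obtain g where g: "g holomorphic_on UNIV" "\<And>z. z \<in> UNIV - S \<Longrightarrow> g z = f z"
    using removable_singularities[of S UNIV f] assms by (auto simp: Compl_eq_Diff_UNIV)
  have "\<forall>\<^sub>F z in at_infinity. g z = f z"
  proof -
    obtain b where b: "\<And>a. a \<in> S \<Longrightarrow> cmod a \<le> b"
      using finite_imp_bounded[OF \<open>finite S\<close>] bounded_iff by blast
    have "g z = f z" if "b + 1 \<le> cmod z" for z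
      using b[of z] g(2)[of z] that by force
    then show ?thesis by (auto simp: eventually_at_infinity)
  qed
  then have "(g \<longlongrightarrow> 0) at_infinity"
    using inf Lim_transform_eventually[of f 0 at_infinity g] by (simp add: eq_commute)
  then have "g z = 0" by (rule Liouville_weak_0[OF g(1)])
  then show ?thesis using g(2) z by simp
qed

section \<open>The stress-energy tensor of the three-point metric\<close>

text \<open>The rational function with double poles of coefficients \<open>s\<^sub>0/2\<close>, \<open>s\<^sub>1/2\<close> at 0 and 1 and leading term
\<open>s\<^sub>\<infinity> / (2 z\<^sup>2)\<close> at infinity. The numerator is the quadratic polynomial that has the values \<open>s\<^sub>0\<close> at 0 and
\<open>s\<^sub>1\<close> at 1 and the leading coefficient \<open>s\<^sub>\<infinity>\<close>.\<close>
definition base_stress :: "(csphere \<Rightarrow> real) \<Rightarrow> complex \<Rightarrow> complex" where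
  "base_stress \<beta> z =
     (of_real (weight (\<beta> Infty)) * z\<^sup>2
       + of_real (weight (\<beta> (Fin 1)) - weight (\<beta> (Fin 0)) - weight (\<beta> Infty)) * z
       + of_real (weight (\<beta> (Fin 0)))) / (2 * z\<^sup>2 * (z - 1)\<^sup>2)"

lemma base_stress_holomorphic: "base_stress \<beta> holomorphic_on UNIV - {0, 1}"
proof -
  have "(\<lambda>z. (a * z\<^sup>2 + b * z + c) / (2 * z\<^sup>2 * (z - 1)\<^sup>2)) holomorphic_on UNIV - {0, 1}" for a b c :: complex
    by (intro holomorphic_intros) auto
  then show ?thesis unfolding base_stress_def[abs_def] .
qed

text \<open>In its chart every marked point is a cone of order \<open>\<beta> j\<close> at 0; at infinity the factor \<open>|du/u\<^sup>2|\<close> turns the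
exponent \<open>\<beta> Infty + 2\<close> into \<open>\<beta> Infty\<close>.\<close>
lemma metric_potential_conical:
  assumes \<phi>: "metric_potential \<beta> \<phi>" and j: "j \<in> marked"
  shows "(\<lambda>u. \<phi> (chart j u) + ln (cmod (deriv (chart j) u)) - \<beta> j * ln (cmod u)) \<in> O[at 0](\<lambda>_. 1)"
proof -
  have fin: "(\<lambda>u. \<phi> (a + u) - \<beta> (Fin a) * ln (cmod u)) \<in> O[at 0](\<lambda>_. 1)"
    if "(\<lambda>z. \<phi> z - \<beta> (Fin a) * ln (cmod (z - a))) \<in> O[at a](\<lambda>_. 1)" for a
  proof -
    have "filterlim (\<lambda>u. a + u) (at a) (at 0)"
      by (auto simp: filterlim_at eventually_at_filter intro!: tendsto_eq_intros)
    from landau_o.big.compose[OF that this] show ?thesis by simp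
  qed
  have inf: "(\<lambda>u. \<phi> (1 / u) + ln (cmod (deriv (chart Infty) u)) - \<beta> Infty * ln (cmod u)) \<in> O[at 0](\<lambda>_. 1)"
  proof -
    have "(\<lambda>z. \<phi> z + (\<beta> Infty + 2) * ln (cmod z)) \<in> O[at_infinity](\<lambda>_. 1)"
      using \<phi> unfolding metric_potential_def by blast
    from landau_o.big.compose[OF this filterlim_inverse_at_infinity]
    have "(\<lambda>u. \<phi> (inverse u) + (\<beta> Infty + 2) * ln (cmod (inverse u))) \<in> O[at 0](\<lambda>_. 1)" .
    moreover have "\<forall>\<^sub>F u in at 0. \<phi> (inverse u) + (\<beta> Infty + 2) * ln (cmod (inverse u))
       = \<phi> (1 / u) + ln (cmod (deriv (chart Infty) u)) - \<beta> Infty * ln (cmod u)"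
    proof -
      have "\<forall>\<^sub>F u in at 0. u \<noteq> (0 :: complex)" by (simp add: eventually_at_filter)
      then show ?thesis
      proof eventually_elim
        case (elim u)
        have "ln (cmod (inverse u)) = - ln (cmod u)" 
          by (simp add: norm_inverse ln_inverse)
        moreover have "ln (cmod (deriv (chart Infty) u)) = - 2 * ln (cmod u)"
          using elim by (simp add: deriv_chart norm_divide norm_power ln_div ln_realpow)
        ultimately show ?case by (simp add: divide_inverse algebra_simps)
      qed
    qed
    ultimately show ?thesis by (rule landau_o.big.in_cong[THEN iffD1, rotated])
  qed
  from j consider "j = Fin 0" | "j = Fin 1" | "j = Infty" by (auto simp: marked_def)
  then show ?thesis
  proof cases
    case 1
    have "(\<lambda>z. \<phi> z - \<beta> (Fin 0) * ln (cmod z)) \<in> O[at 0](\<lambda>_. 1)"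
      using \<phi> unfolding metric_potential_def by blast
    then show ?thesis using fin[of 0] 1 by (simp add: deriv_chart)
  next
    case 2
    have "(\<lambda>z. \<phi> z - \<beta> (Fin 1) * ln (cmod (z - 1))) \<in> O[at 1](\<lambda>_. 1)"
      using \<phi> unfolding metric_potential_def by blast
    then show ?thesis using fin[of 1] 2 by (simp add: deriv_chart)
  next
    case 3
    then show ?thesis using inf by simp
  qed
qed

text \<open>Let \<open>G\<close> be \<open>z\<^sup>2 (z - 1)\<^sup>2 T\<close> minus half the numerator of the candidate. The leading terms at the three cones agree,
hence \<open>G\<close> vanishes at 0 and 1 and is \<open>o(z\<^sup>2)\<close> at infinity, and \<open>G / (z (z - 1))\<close> is entire and tends to 0.\<close>
lemma three_point_stress:
  assumes \<beta>: "\<forall>j\<in>marked. \<beta> j > -1" and \<phi>: "metric_potential \<beta> \<phi>"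
    and L: "liouville K (UNIV - {0, 1}) \<phi> P Q" and z: "z \<notin> {0, 1}"
  shows "2 * (Q z - (P z)\<^sup>2) = base_stress \<beta> z"
proof -
  define T where "T z = 2 * (Q z - (P z)\<^sup>2)" for z
  have hT: "T holomorphic_on UNIV - {0, 1}"
    using L unfolding liouville_def T_def by blast
  have lim: "((\<lambda>u. u\<^sup>2 * chart_pullback j T u) \<longlongrightarrow> of_real (weight (\<beta> j) / 2)) (at 0)"
    if j: "j \<in> marked" for j
  proof -
    let ?D = "ball 0 1 - {0 :: complex}"
    have sub: "chart j u \<in> UNIV - {0, 1}" if "u \<in> ?D" for u
      using that j by (auto simp: marked_def add_eq_0_iff)
    have oD: "open ?D" by (simp add: open_delete)
    have hc: "chart j holomorphic_on ?D"
      by (rule holomorphic_on_subset[OF chart_holomorphic]) auto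
    note pb = liouville_pullback[OF L oD hc sub]
    have nz: "deriv (chart j) u \<noteq> 0" if "u \<in> ?D" for u
      using that deriv_chart_nonzero by auto
    let ?T = "\<lambda>u. 2 * ((Q (chart j u) * (deriv (chart j) u)\<^sup>2 + P (chart j u) * deriv (deriv (chart j)) u +
        deriv (pre_schwarzian (chart j)) u / 2) -
          (P (chart j u) * deriv (chart j) u + pre_schwarzian (chart j) u / 2)\<^sup>2)"
    have "((\<lambda>u. u\<^sup>2 * ?T u) \<longlongrightarrow> of_real (weight (\<beta> j) / 2)) (at 0)"
      by (rule conical_singularity_stress_limit[OF pb(1)[OF _ nz] _ metric_potential_conical[OF \<phi> j]])
        (use \<beta> j in auto)
    moreover have "\<forall>\<^sub>F u in at 0. u\<^sup>2 * ?T u = u\<^sup>2 * chart_pullback j T u"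
    proof -
      have "\<forall>\<^sub>F u in at 0. u \<in> ?D"
        by (auto simp: eventually_at dist_norm intro!: exI[of _ 1])
      then show ?thesis
      proof eventually_elim
        case (elim u)
        then have "u \<noteq> 0" by auto
        then show ?case
          using pb(2)[OF _ nz elim] schwarzian_chart[of u j]
          by (simp add: chart_pullback_def T_def)
      qed
    qed
    ultimately show ?thesis by (rule Lim_transform_eventually)
  qed
  define w where "w j = complex_of_real (weight (\<beta> j))" for j
  define N where "N z = (w Infty * z\<^sup>2 + (w (Fin 1) - w (Fin 0) - w Infty) * z + w (Fin 0)) / 2" for z
  define G where "G z = z\<^sup>2 * (z - 1)\<^sup>2 * T z - N z" for z
  have hG: "G holomorphic_on UNIV - {0, 1}"
    unfolding G_def N_def by (intro holomorphic_intros hT) auto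
  have N01: "N 0 = w (Fin 0) / 2" "N 1 = w (Fin 1) / 2" by (simp_all add: N_def)
  have G0: "(G \<longlongrightarrow> 0) (at 0)"
  proof -
    have "((\<lambda>z. (z - 1)\<^sup>2 * (z\<^sup>2 * T z) - N z) \<longlongrightarrow> (0 - 1)\<^sup>2 * (w (Fin 0) / 2) - N 0) (at 0)"
      using lim[of "Fin 0"]
      unfolding N_def by (intro tendsto_intros) (auto simp: marked_def chart_pullback_simps w_def)
    moreover have "G = (\<lambda>z. (z - 1)\<^sup>2 * (z\<^sup>2 * T z) - N z)" by (simp add: fun_eq_iff G_def)
    ultimately show ?thesis by (simp add: N01)
  qed
  have G1: "(G \<longlongrightarrow> 0) (at 1)"
  proof -
    have "((\<lambda>u. (1 + u)\<^sup>2 * (u\<^sup>2 * T (1 + u)) - N (1 + u)) \<longlongrightarrow> (1 + 0)\<^sup>2 * (w (Fin 1) / 2) - N (1 + 0)) (at 0)"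
      using lim[of "Fin 1"]
      unfolding N_def by (intro tendsto_intros) (auto simp: marked_def chart_pullback_simps w_def)
    moreover have "(\<lambda>u. G (1 + u)) = (\<lambda>u. (1 + u)\<^sup>2 * (u\<^sup>2 * T (1 + u)) - N (1 + u))"
      by (simp add: fun_eq_iff G_def)
    ultimately have "((\<lambda>u. G (1 + u)) \<longlongrightarrow> 0) (at 0)" by (simp add: N01)
    then show ?thesis by (simp add: at_to_0[of 1] filterlim_filtermap add.commute)
  qed
  have Ginf: "((\<lambda>z. G z / (z * (z - 1))) \<longlongrightarrow> 0) at_infinity"
  proof -
    let ?n = "\<lambda>u. (w Infty + (w (Fin 1) - w (Fin 0) - w Infty) * u + w (Fin 0) * u\<^sup>2) / 2"
    let ?H = "\<lambda>u. 1 / (1 - u) * ((1 - u)\<^sup>2 * (u\<^sup>2 * chart_pullback Infty T u) - ?n u)"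
    have "(?H \<longlongrightarrow> (1 / (1 - 0)) * ((1 - 0)\<^sup>2 * (w Infty / 2) - ?n 0)) (at 0)"
      using lim[of Infty] by (intro tendsto_intros) (auto simp: marked_def w_def)
    then have "(?H \<longlongrightarrow> 0) (at 0)" by simp
    moreover have "\<forall>\<^sub>F u in at 0. ?H u = G (inverse u) / (inverse u * (inverse u - 1))"
    proof -
      have "\<forall>\<^sub>F u in at 0. u \<noteq> 0 \<and> u \<noteq> (1::complex)"
        by (auto simp: eventually_at dist_norm intro!: exI[of _ 1])
      then show ?thesis
      proof eventually_elim
        case (elim u)
        have n: "N (inverse u) = ?n u / u\<^sup>2"
          using elim by (simp add: N_def field_simps power2_eq_square)
        have t: "(inverse u)\<^sup>2 * (inverse u - 1)\<^sup>2 * T (inverse u) = (1 - u)\<^sup>2 * (u\<^sup>2 * chart_pullback Infty T u) / u\<^sup>2"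
          using elim by (simp add: chart_pullback_simps field_simps eval_nat_numeral)
        have q: "inverse u * (inverse u - 1) = (1 - u) / u\<^sup>2"
          using elim by (simp add: field_simps power2_eq_square)
        have gen: "1 / (1 - u) * (X - Y) = (X / u\<^sup>2 - Y / u\<^sup>2) / ((1 - u) / u\<^sup>2)" for X Y
          using elim by (simp flip: diff_divide_distrib)
        show ?case
          unfolding G_def n t q by (rule gen)
      qed
    qed
    ultimately have "((\<lambda>u. G (inverse u) / (inverse u * (inverse u - 1))) \<longlongrightarrow> 0) (at 0)"
      by (rule Lim_transform_eventually)
    then show ?thesis by (simp add: lim_at_infinity_0 o_def)
  qed
  have sets: "- {1} - {0} = UNIV - {0, 1 :: complex}" "- {0} - {1} = UNIV - {0, 1 :: complex}" by auto
  have "G z / (z * (z - 1)) = 0"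
  proof (rule eq_zero_of_removable_singularities[where S = "{0, 1}" and f = "\<lambda>z. G z / (z * (z - 1))"])
    show "(\<lambda>z. G z / (z * (z - 1))) holomorphic_on - {0, 1}"
      using hG by (auto intro!: holomorphic_intros simp: Compl_eq_Diff_UNIV)
    fix a :: complex assume "a \<in> {0, 1}"
    then consider "a = 0" | "a = 1" by auto
    then show "(\<lambda>z. G z / (z * (z - 1))) \<in> O[at a](\<lambda>_. 1)"
    proof cases
      case 1
      have "(\<lambda>z. G z / (z - 0)) \<in> O[at 0](\<lambda>_. 1)"
        by (rule bigo_1_divide_of_tendsto_0[where U = "- {1}"]) (use hG G0 in \<open>simp_all add: sets open_Compl\<close>)
      moreover have "(\<lambda>z. 1 / (z - 1)) \<in> O[at 0](\<lambda>_. 1 :: complex)"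
        by (rule bigo_1_of_tendsto[where l = "1 / (0 - 1)"]) (auto intro!: tendsto_eq_intros)
      ultimately have "(\<lambda>z. G z / (z - 0) * (1 / (z - 1))) \<in> O[at 0](\<lambda>_. 1 * 1)"
        by (rule landau_o.big.mult)
      then show ?thesis by (simp add: 1)
    next
      case 2
      have "(\<lambda>z. G z / (z - 1)) \<in> O[at 1](\<lambda>_. 1)"
        by (rule bigo_1_divide_of_tendsto_0[where U = "- {0}"]) (use hG G1 in \<open>simp_all add: sets open_Compl\<close>)
      moreover have "(\<lambda>z. 1 / z) \<in> O[at 1](\<lambda>_. 1 :: complex)"
        by (rule bigo_1_of_tendsto[where l = "1 / 1"]) (auto intro!: tendsto_eq_intros)
      ultimately have "(\<lambda>z. G z / (z - 1) * (1 / z)) \<in> O[at 1](\<lambda>_. 1 * 1)"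
        by (rule landau_o.big.mult)
      then show ?thesis by (simp add: 2 mult.commute)
    qed
  qed (use Ginf z in auto)
  then have "z\<^sup>2 * (z - 1)\<^sup>2 * T z = N z" using z by (simp add: G_def)
  then have "T z = N z / (z\<^sup>2 * (z - 1)\<^sup>2)" using z by (simp add: eq_divide_eq mult_ac)
  then show ?thesis
    by (simp add: base_stress_def T_def N_def w_def)
qed

section \<open>Germs with a double pole\<close>

text \<open>\<open>F u = s / u\<^sup>2 + h / u + O(1)\<close>, with the coefficients encoded as value and derivative of the analytic function
\<open>u\<^sup>2 F u\<close>, so that they follow from the product and chain rules.\<close>
definition double_pole_germ :: "(complex \<Rightarrow> complex) \<Rightarrow> complex \<Rightarrow> complex \<Rightarrow> bool" where
  "double_pole_germ F s h \<longleftrightarrow>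
     (\<exists>M. M analytic_on {0} \<and> M 0 = s \<and> deriv M 0 = h \<and> (\<forall>\<^sub>F u in at 0. F u = M u / u\<^sup>2))"

lemma base_stress_germ:
  assumes "j \<in> marked"
  shows "double_pole_germ (chart_pullback j (base_stress \<beta>)) (of_real (weight (\<beta> j)) / 2) (of_real (base_accessory \<beta> j))"
proof -
  define s0 s1 si where "s0 = complex_of_real (weight (\<beta> (Fin 0)))" and "s1 = complex_of_real (weight (\<beta> (Fin 1)))"
    and "si = complex_of_real (weight (\<beta> Infty))"
  have B: "base_stress \<beta> z = (si * z\<^sup>2 + (s1 - s0 - si) * z + s0) / (2 * z\<^sup>2 * (z - 1)\<^sup>2)" for z
    by (simp add: base_stress_def s0_def s1_def si_def)
  have ev: "\<forall>\<^sub>F u in at 0. u \<noteq> 0 \<and> u \<noteq> (1::complex) \<and> u \<noteq> -1"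
    by (auto simp: eventually_at dist_norm intro!: exI[of _ 1])
  consider "j = Fin 0" | "j = Fin 1" | "j = Infty" using assms by (auto simp: marked_def)
  then show ?thesis
  proof cases
    case 1
    let ?M = "\<lambda>u. (si * u\<^sup>2 + (s1 - s0 - si) * u + s0) / (2 * (u - 1)\<^sup>2)"
    have "(?M has_field_derivative of_real (base_accessory \<beta> j)) (at 0)"
      using 1 by (auto intro!: derivative_eq_intros simp: base_accessory_def Let_def s0_def s1_def si_def field_simps power2_eq_square)
    moreover have "\<forall>\<^sub>F u in at 0. chart_pullback j (base_stress \<beta>) u = ?M u / u\<^sup>2"
      using ev by eventually_elim (simp add: 1 chart_pullback_simps B mult_ac)
    moreover have "?M analytic_on {0}" by (intro analytic_intros) auto
    moreover have "?M 0 = of_real (weight (\<beta> j)) / 2" by (simp add: 1 s0_def)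
    ultimately show ?thesis unfolding double_pole_germ_def using DERIV_imp_deriv by blast
  next
    case 2
    let ?M = "\<lambda>u. (s1 + (s1 - s0 + si) * u + si * u\<^sup>2) / (2 * (1 + u)\<^sup>2)"
    have "(?M has_field_derivative of_real (base_accessory \<beta> j)) (at 0)"
      using 2 by (auto intro!: derivative_eq_intros simp: base_accessory_def Let_def s0_def s1_def si_def field_simps power2_eq_square)
    moreover have "\<forall>\<^sub>F u in at 0. chart_pullback j (base_stress \<beta>) u = ?M u / u\<^sup>2"
    proof -
      have "si * (1 + u)\<^sup>2 + (s1 - s0 - si) * (1 + u) + s0 = s1 + (s1 - s0 + si) * u + si * u\<^sup>2" for u
        by (simp add: power2_eq_square algebra_simps)
      then show ?thesis by (simp add: 2 chart_pullback_simps B mult_ac)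
    qed
    moreover have "?M analytic_on {0}" by (intro analytic_intros) auto
    moreover have "?M 0 = of_real (weight (\<beta> j)) / 2" by (simp add: 2 s1_def)
    ultimately show ?thesis unfolding double_pole_germ_def using DERIV_imp_deriv by blast
  next
    case 3
    let ?M = "\<lambda>u. (si + (s1 - s0 - si) * u + s0 * u\<^sup>2) / (2 * (1 - u)\<^sup>2)"
    have "(?M has_field_derivative of_real (base_accessory \<beta> j)) (at 0)"
      using 3 by (auto intro!: derivative_eq_intros simp: base_accessory_def Let_def s0_def s1_def si_def field_simps power2_eq_square)
    moreover have "\<forall>\<^sub>F u in at 0. chart_pullback j (base_stress \<beta>) u = ?M u / u\<^sup>2"
      using ev
    proof eventually_elim
      case (elim u)
      have "si * (1 / u)\<^sup>2 + (s1 - s0 - si) * (1 / u) + s0 = (si + (s1 - s0 - si) * u + s0 * u\<^sup>2) / u\<^sup>2"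
        using elim by (simp add: field_simps power2_eq_square)
      moreover have "2 * (1 / u)\<^sup>2 * (1 / u - 1)\<^sup>2 = 2 * (1 - u)\<^sup>2 / u ^ 4"
        using elim by (simp add: field_simps eval_nat_numeral)
      ultimately show ?case using elim
        by (simp add: 3 chart_pullback_simps B eval_nat_numeral)
    qed
    moreover have "?M analytic_on {0}" by (intro analytic_intros) auto
    moreover have "?M 0 = of_real (weight (\<beta> j)) / 2" by (simp add: 3 si_def)
    ultimately show ?thesis unfolding double_pole_germ_def using DERIV_imp_deriv by blast
  qed
qed

lemma analytic_at_ball:
  assumes "f analytic_on {z}"
  obtains e where "e > 0" "f holomorphic_on ball z e"
  using assms by (auto simp: analytic_on_def)

lemma analytic_at_deriv_eventually:
  assumes "f analytic_on {0}"
  shows "\<forall>\<^sub>F u in nhds 0. (f has_field_derivative deriv f u) (at u)"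
proof -
  obtain e where e: "e > 0" "f holomorphic_on ball 0 e" using assms by (rule analytic_at_ball)
  have "\<forall>\<^sub>F u in nhds 0. u \<in> ball 0 e"
    using e by (intro eventually_nhds_in_open) auto
  then show ?thesis by eventually_elim (use e holomorphic_derivI in blast)
qed

lemma analytic_at_DERIV: "f analytic_on {z} \<Longrightarrow> (f has_field_derivative deriv f z) (at z)"
  using analytic_on_imp_differentiable_at[of f "{z}" z] DERIV_deriv_iff_field_differentiable by blast

text \<open>Allows an identity that holds in a punctured neighbourhood to be differentiated there.\<close>
lemma eventually_eventually_at:
  assumes "eventually P (at (x::complex))"
  shows "\<forall>\<^sub>F y in at x. eventually P (nhds y)"
proof -
  have "\<forall>\<^sub>F y in nhds x. \<forall>\<^sub>F z in nhds y. z \<noteq> x \<longrightarrow> P z"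
    using assms by (simp add: eventually_at_filter eventually_eventually)
  then show ?thesis unfolding eventually_at_filter
  proof eventually_elim
    case (elim y)
    show ?case
    proof (intro impI)
      assume "y \<noteq> x"
      then have "\<forall>\<^sub>F z in nhds y. z \<noteq> x" by (rule t1_space_nhds)
      with elim show "eventually P (nhds y)" by eventually_elim simp
    qed
  qed
qed

lemma DERIV_ident_mult_at_0:
  fixes q :: "complex \<Rightarrow> complex"
  assumes "q analytic_on {0}"
  shows "((\<lambda>u. u * q u) has_field_derivative q 0) (at 0)"
  using DERIV_mult[OF DERIV_ident analytic_at_DERIV[OF assms]] by simp

text \<open>The functions \<open>J = u g'/g = m + u G'/G\<close> and \<open>Y = u g''/g' = J - 1 + u J'/J\<close> are analytic at 0. If
\<open>F u = M u / u\<^sup>2\<close>, then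
\<open>u\<^sup>2 (F(g) g'\<^sup>2 + S g) = M(g) J\<^sup>2 + u Y' - Y - Y\<^sup>2/2\<close>, from which value and derivative at 0 are read off with
\<open>J(0) = m\<close>, \<open>J'(0) = \<delta>\<close>, \<open>Y(0) = m - 1\<close> and \<open>Y'(0) = \<delta> + \<delta>/m\<close>. The derivative of \<open>M\<close> enters only if \<open>g'(0) \<noteq> 0\<close>,
that is for \<open>m = 1\<close>.\<close>
lemma double_pole_germ_compose:
  assumes F: "double_pole_germ F s h" and m: "m \<ge> 1" and G: "G analytic_on {0}" and G0: "G 0 \<noteq> 0"
    and g: "\<forall>\<^sub>F u in at 0. g u = u ^ m * G u"
  defines "\<delta> \<equiv> deriv G 0 / G 0"
  shows "double_pole_germ (\<lambda>u. F (g u) * (deriv g u)\<^sup>2 + schwarzian g u)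
     (s * of_nat m ^ 2 + (1 - of_nat m ^ 2) / 2)
     (2 * s * of_nat m * \<delta> + (if m = 1 then G 0 * h else 0) - (of_nat m ^ 2 - 1) / of_nat m * \<delta>)"
proof -
  obtain n where n: "m = Suc n" using m by (cases m) auto
  define g0 where "g0 u = u ^ m * G u" for u
  obtain M where M: "M analytic_on {0}" "M 0 = s" "deriv M 0 = h" and FM: "\<forall>\<^sub>F u in at 0. F u = M u / u\<^sup>2"
    using F unfolding double_pole_germ_def by blast
  have G': "deriv G analytic_on {0}" using G by (rule analytic_deriv)
  define J where "J u = of_nat m + u * (deriv G u / G u)" for u
  have J: "J analytic_on {0}"
    unfolding J_def[abs_def] by (intro analytic_intros G G') (use G0 in simp)
  have J0: "J 0 = of_nat m" "of_nat m \<noteq> (0 :: complex)" using m by (simp_all add: J_def)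
  have dJ: "(J has_field_derivative \<delta>) (at 0)"
  proof -
    have "(\<lambda>u. deriv G u / G u) analytic_on {0}"
      by (rule analytic_on_divide[OF G' G]) (use G0 in simp)
    from DERIV_add[OF DERIV_const DERIV_ident_mult_at_0[OF this]]
    show ?thesis unfolding J_def[abs_def] \<delta>_def by (simp only: add_0)
  qed
  have J': "deriv J analytic_on {0}" using J by (rule analytic_deriv)
  define Y where "Y u = J u - 1 + u * (deriv J u / J u)" for u
  have Y: "Y analytic_on {0}"
    unfolding Y_def[abs_def] by (intro analytic_intros J J') (use J0 in simp)
  have Y0: "Y 0 = of_nat m - 1" by (simp add: Y_def J0)
  have dY: "(Y has_field_derivative \<delta> + \<delta> / of_nat m) (at 0)"
  proof -
    have "(\<lambda>u. deriv J u / J u) analytic_on {0}"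
      by (rule analytic_on_divide[OF J' J]) (use J0 in simp)
    from DERIV_add[OF DERIV_diff[OF dJ DERIV_const] DERIV_ident_mult_at_0[OF this]]
    show ?thesis unfolding Y_def[abs_def] by (simp only: DERIV_imp_deriv[OF dJ] J0 diff_0_right)
  qed
  have Y': "deriv Y analytic_on {0}" using Y by (rule analytic_deriv)
  have g0: "g0 analytic_on {0}" unfolding g0_def[abs_def] by (intro analytic_intros G)
  have g00: "g0 0 = 0" using m by (simp add: g0_def)
  have dg0: "(g0 has_field_derivative (if m = 1 then G 0 else 0)) (at 0)"
  proof -
    have "(\<lambda>u. u ^ (m - 1) * G u) analytic_on {0}" by (intro analytic_intros G)
    from DERIV_ident_mult_at_0[OF this]
    have "((\<lambda>u. u * (u ^ (m - 1) * G u)) has_field_derivative 0 ^ (m - 1) * G 0) (at 0)" .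
    moreover have "0 ^ (m - 1) * G 0 = (if m = 1 then G 0 else 0)" using m by auto
    moreover have "g0 = (\<lambda>u. u * (u ^ (m - 1) * G u))"
      by (simp add: g0_def fun_eq_iff n)
    ultimately show ?thesis by (simp only:)
  qed
  define W where "W u = M (g0 u) * (J u * J u) + (u * deriv Y u - Y u - Y u * Y u / 2)" for u
  have Mg: "(\<lambda>u. M (g0 u)) analytic_on {0}"
    using analytic_on_compose[of g0 "{0}" M] g0 M(1) g00 by (simp add: o_def)
  have W: "W analytic_on {0}"
    unfolding W_def[abs_def] by (intro analytic_intros Mg J Y Y') simp
  have W0: "W 0 = s * of_nat m ^ 2 + (1 - of_nat m ^ 2) / 2"
    by (simp add: W_def g00 M J0 Y0 power2_eq_square field_simps)
  have dW: "deriv W 0 = 2 * s * of_nat m * \<delta> + (if m = 1 then G 0 * h else 0) - (of_nat m ^ 2 - 1) / of_nat m * \<delta>"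
  proof -
    have dMg: "((\<lambda>u. M (g0 u)) has_field_derivative h * (if m = 1 then G 0 else 0)) (at 0)"
      by (rule DERIV_chain2[OF _ dg0]) (use analytic_at_DERIV[OF M(1)] g00 M(3) in simp)
    have dY': "((\<lambda>u. u * deriv Y u) has_field_derivative (\<delta> + \<delta> / of_nat m)) (at 0)"
      using DERIV_mult[OF DERIV_ident analytic_at_DERIV[OF Y']] DERIV_imp_deriv[OF dY] by simp
    have "(W has_field_derivative (h * (if m = 1 then G 0 else 0)) * (J 0 * J 0) + (\<delta> * J 0 + \<delta> * J 0) * M (g0 0)
       + ((\<delta> + \<delta> / of_nat m) - (\<delta> + \<delta> / of_nat m)
          - ((\<delta> + \<delta> / of_nat m) * Y 0 + (\<delta> + \<delta> / of_nat m) * Y 0) / 2)) (at 0)"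
      unfolding W_def[abs_def]
      by (intro DERIV_add DERIV_diff DERIV_mult DERIV_cdivide dMg dJ dY dY')
    then have "deriv W 0 = (h * (if m = 1 then G 0 else 0)) * (J 0 * J 0) + (\<delta> * J 0 + \<delta> * J 0) * M (g0 0)
       + ((\<delta> + \<delta> / of_nat m) - (\<delta> + \<delta> / of_nat m)
          - ((\<delta> + \<delta> / of_nat m) * Y 0 + (\<delta> + \<delta> / of_nat m) * Y 0) / 2)"
      by (rule DERIV_imp_deriv)
    also have "\<dots> = 2 * s * of_nat m * \<delta> + (if m = 1 then G 0 * h else 0) - (of_nat m ^ 2 - 1) / of_nat m * \<delta>"
      using J0(2) by (simp add: g00 M J0 Y0 power2_eq_square field_simps)
    finally show ?thesis .
  qed
  have J_ne: "\<forall>\<^sub>F u in at 0. J u \<noteq> 0"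
    using analytic_at_imp_isCont[OF J] J0
    by (intro tendsto_imp_eventually_ne[where c = "of_nat m"]) (auto simp: isCont_def)
  have G_ne: "\<forall>\<^sub>F u in at 0. G u \<noteq> 0"
    using analytic_at_imp_isCont[OF G] G0
    by (intro tendsto_imp_eventually_ne[where c = "G 0"]) (auto simp: isCont_def)
  have near: "\<forall>\<^sub>F u in at 0. u \<noteq> 0 \<and> G u \<noteq> 0 \<and> J u \<noteq> 0 \<and> g u = g0 u \<and>
      (G has_field_derivative deriv G u) (at u) \<and> (J has_field_derivative deriv J u) (at u)
       \<and> (Y has_field_derivative deriv Y u) (at u) \<and> F (g0 u) = M (g0 u) / (g0 u)\<^sup>2"
  proof -
    have lim: "filterlim g0 (at 0) (at 0)"
    proof -
      have "(g0 \<longlongrightarrow> 0) (at 0)"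
        using analytic_at_imp_isCont[OF g0] g00 by (simp add: isCont_def)
      moreover have "\<forall>\<^sub>F u in at 0. g0 u \<noteq> 0"
        using G_ne eventually_neq_at_within[of 0 0 UNIV]
        by eventually_elim (simp add: g0_def)
      ultimately show ?thesis by (simp add: filterlim_at)
    qed
    have nh: "eventually P (at 0)" if "eventually P (nhds (0::complex))" for P
      using that eventually_nhds_conv_at by blast
    show ?thesis
      using J_ne G_ne g nh[OF analytic_at_deriv_eventually[OF G]]
        nh[OF analytic_at_deriv_eventually[OF J]] nh[OF analytic_at_deriv_eventually[OF Y]]
        eventually_compose_filterlim[OF FM lim] eventually_neq_at_within[of 0 0 UNIV]
      by eventually_elim (simp add: g0_def)
  qed
  have dg: "(g0 has_field_derivative g0 u * J u / u) (at u)"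
    if "u \<noteq> 0" "G u \<noteq> 0" "(G has_field_derivative deriv G u) (at u)" for u
  proof -
    have "((\<lambda>u. u ^ m * G u) has_field_derivative (of_nat m * u ^ (m - 1) * G u + deriv G u * u ^ m)) (at u)"
      using that by (auto intro!: derivative_eq_intros)
    moreover have "of_nat m * u ^ (m - 1) * G u + deriv G u * u ^ m = g0 u * J u / u"
      using that by (simp add: g0_def J_def n field_simps)
    ultimately show ?thesis unfolding g0_def[abs_def] by simp
  qed
  have d1: "\<forall>\<^sub>F u in at 0. deriv g u = g0 u * J u / u"
    using eventually_eventually_at[OF near]
  proof eventually_elim
    case (elim u)
    note u = eventually_nhds_x_imp_x[OF elim]
    have "deriv g u = deriv g0 u"
      by (rule deriv_cong_ev[OF _ refl]) (use elim in \<open>auto elim: eventually_mono\<close>)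
    then show ?case using DERIV_imp_deriv[OF dg[of u]] u by simp
  qed
  have d2: "\<forall>\<^sub>F u in at 0. pre_schwarzian g u = Y u / u"
    using eventually_eventually_at[OF eventually_conj[OF near d1]]
  proof eventually_elim
    case (elim u)
    note u = eventually_nhds_x_imp_x[OF elim]
    have dg0: "(g0 has_field_derivative g0 u * J u / u) (at u)" using dg u by blast
    have "((\<lambda>u. g0 u * J u / u) has_field_derivative
       ((g0 u * J u / u * J u + deriv J u * g0 u) * u - g0 u * J u * 1) / (u * u)) (at u)"
      using u by (intro DERIV_divide DERIV_mult dg0 DERIV_ident) auto
    moreover have "((g0 u * J u / u * J u + deriv J u * g0 u) * u - g0 u * J u * 1) / (u * u) = (g0 u * J u / u) * (Y u / u)"
      using u by (simp add: Y_def field_simps)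
    moreover have "deriv (deriv g) u = deriv (\<lambda>u. g0 u * J u / u) u"
      by (rule deriv_cong_ev[OF _ refl]) (use elim in \<open>auto elim: eventually_mono\<close>)
    ultimately have "deriv (deriv g) u = (g0 u * J u / u) * (Y u / u)"
      by (simp only: DERIV_imp_deriv)
    then show ?case using u by (simp add: pre_schwarzian_def g0_def)
  qed
  have "\<forall>\<^sub>F u in at 0. F (g u) * (deriv g u)\<^sup>2 + schwarzian g u = W u / u\<^sup>2"
    using eventually_eventually_at[OF eventually_conj[OF near eventually_conj[OF d1 d2]]]
  proof eventually_elim
    case (elim u)
    note u = eventually_nhds_x_imp_x[OF elim]
    have "((\<lambda>u. Y u / u) has_field_derivative (deriv Y u * u - Y u * 1) / (u * u)) (at u)"
      using u by (intro DERIV_divide DERIV_ident) auto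
    moreover have "deriv (pre_schwarzian g) u = deriv (\<lambda>u. Y u / u) u"
      by (rule deriv_cong_ev[OF _ refl]) (use elim in \<open>auto elim: eventually_mono\<close>)
    ultimately have dpre: "deriv (pre_schwarzian g) u = (deriv Y u * u - Y u * 1) / (u * u)"
      by (simp only: DERIV_imp_deriv)
    have pre: "pre_schwarzian g u = Y u / u" using u by simp
    have "g0 u \<noteq> 0" using u by (simp add: g0_def)
    then have "F (g u) * (deriv g u)\<^sup>2 = M (g0 u) * (J u * J u) / u\<^sup>2"
      using u by (simp add: power_mult_distrib power_divide power2_eq_square)
    moreover have "schwarzian g u = (u * deriv Y u - Y u - Y u * Y u / 2) / u\<^sup>2"
      using u by (simp add: schwarzian_def pre dpre power2_eq_square field_simps)
    ultimately show ?case by (simp add: W_def add_divide_distrib)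
  qed
  with W W0 dW show ?thesis
    unfolding double_pole_germ_def by blast
qed

section \<open>Counting the preimages of the marked points\<close>

text \<open>The numerator of \<open>(p/q)'\<close> over \<open>q\<^sup>2\<close>. Passing from \<open>(p, q)\<close> to \<open>(q, p)\<close> or \<open>(p - q, q)\<close> changes it at most by
the sign, so that the points over 0, 1 and infinity, which are the zeros of \<open>p\<close>, \<open>p - q\<close> and \<open>q\<close>, are treated alike.\<close>
definition wronskian :: "complex poly \<Rightarrow> complex poly \<Rightarrow> complex poly" where
  "wronskian p q = pderiv p * q - p * pderiv q"

lemma wronskian_swap: "wronskian q p = - wronskian p q"
  by (simp add: wronskian_def mult.commute)

lemma wronskian_diff: "wronskian (p - q) q = wronskian p q"
  by (simp add: wronskian_def pderiv_diff algebra_simps)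

lemma coprime_no_common_root:
  fixes p q :: "complex poly"
  assumes "coprime p q" "poly p x = 0"
  shows "poly q x \<noteq> 0"
proof
  assume "poly q x = 0"
  then have "[:-x, 1:] dvd p" "[:-x, 1:] dvd q" using assms(2) by (simp_all add: poly_eq_0_iff_dvd)
  with assms(1) have "is_unit [:-x, 1:]" by (rule coprime_common_divisor)
  then show False by (simp add: is_unit_poly_iff)
qed

text \<open>The candidates for the leading terms of \<open>p' q\<close> and \<open>p q'\<close> have the coefficients \<open>deg p\<close> and \<open>deg q\<close> times the
product of the leading coefficients; they do not cancel.\<close>
lemma degree_wronskian:
  assumes pq: "p \<noteq> 0" "q \<noteq> 0" and ne: "degree p \<noteq> degree q"
  shows "wronskian p q \<noteq> 0" "degree (wronskian p q) = degree p + degree q - 1"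
proof -
  define n where "n = degree p + degree q - 1"
  have c: "coeff (pderiv a * b) n = of_nat (degree a) * (lead_coeff a * lead_coeff b)
      \<and> degree (pderiv a * b) \<le> n"
    if n: "n = degree a + degree b - 1" for a b :: "complex poly"
  proof (cases "degree a")
    case 0
    then have "pderiv a = 0" by (simp add: pderiv_eq_0_iff)
    with 0 show ?thesis by simp
  next
    case (Suc k)
    then have d: "degree (pderiv a) = k" "n = degree (pderiv a) + degree b" using n by (simp_all add: degree_pderiv)
    have "coeff (pderiv a * b) n = lead_coeff (pderiv a) * lead_coeff b"
      unfolding d(2) by (rule coeff_mult_degree_sum)
    also have "lead_coeff (pderiv a) = of_nat (degree a) * lead_coeff a"
      using Suc by (simp add: d(1) coeff_pderiv)
    finally show ?thesis using degree_mult_le[of "pderiv a" b] d(2) by simp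
  qed
  have 1: "coeff (pderiv p * q) n = of_nat (degree p) * (lead_coeff p * lead_coeff q)" "degree (pderiv p * q) \<le> n"
    using c[of p q] by (simp_all add: n_def)
  have 2: "coeff (p * pderiv q) n = of_nat (degree q) * (lead_coeff p * lead_coeff q)" "degree (p * pderiv q) \<le> n"
    using c[of q p] by (simp_all add: n_def mult_ac add.commute)
  have "coeff (wronskian p q) n = (of_nat (degree p) - of_nat (degree q)) * (lead_coeff p * lead_coeff q)"
    by (simp add: wronskian_def 1(1) 2(1) left_diff_distrib)
  then have nz: "coeff (wronskian p q) n \<noteq> 0" using pq ne by simp
  then show "wronskian p q \<noteq> 0" by auto
  have "degree (wronskian p q) \<le> n"
    unfolding wronskian_def by (rule degree_diff_le[OF 1(2) 2(2)])
  moreover have "n \<le> degree (wronskian p q)" using nz by (rule le_degree)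
  ultimately show "degree (wronskian p q) = degree p + degree q - 1" by (simp add: n_def)
qed

text \<open>The order of \<open>p\<close> at a root drops by one in \<open>p' q\<close>, where \<open>q\<close> does not vanish, and does not drop in \<open>p q'\<close>.\<close>
lemma order_wronskian:
  assumes "coprime p q" "p \<noteq> 0" "poly p x = 0"
  shows "Suc (order x (wronskian p q)) = order x p"
proof -
  have q: "poly q x \<noteq> 0" using assms(1,3) by (rule coprime_no_common_root)
  have dp: "pderiv p \<noteq> 0"
  proof
    assume "pderiv p = 0"
    then have "degree p = 0" by (simp add: pderiv_eq_0_iff)
    then show False using assms(2,3) by (metis degree_eq_zeroE mult_zero_right pCons_0_0 poly_pCons poly_0 add.right_neutral)
  qed
  define k where "k = order x (pderiv p)"
  have ok: "order x p = Suc k" using order_pderiv[OF assms(2,3)] by (simp add: k_def)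
  have "q \<noteq> 0" using q by auto
  have o1: "order x (pderiv p * q) = k"
    using order_mult[of "pderiv p" q x] dp \<open>q \<noteq> 0\<close> q by (simp add: k_def order_root)
  have d2: "[:-x, 1:] ^ Suc k dvd p * pderiv q" using order_1[of x p] ok by simp
  have d1: "[:-x, 1:] ^ k dvd pderiv p * q" using order_1[of x "pderiv p * q"] o1 by simp
  have n1: "\<not> [:-x, 1:] ^ Suc k dvd pderiv p * q"
    using order_2[of "pderiv p * q" x] o1 dp \<open>q \<noteq> 0\<close> by simp
  have "order x (wronskian p q) = k"
  proof (rule order_unique_lemma)
    show "[:-x, 1:] ^ k dvd wronskian p q"
      unfolding wronskian_def using d1 d2 by (meson dvd_diff dvd_power_le dvd_refl dvd_trans le_imp_power_dvd le_SucI order_refl)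
    show "\<not> [:-x, 1:] ^ Suc k dvd wronskian p q"
    proof
      assume "[:-x, 1:] ^ Suc k dvd wronskian p q"
      then have "[:-x, 1:] ^ Suc k dvd wronskian p q + p * pderiv q" using d2 by (rule dvd_add)
      then show False using n1 by (simp add: wronskian_def)
    qed
  qed
  then show ?thesis using ok by simp
qed

lemma sum_order_roots_eq_degree:
  assumes "p \<noteq> (0 :: complex poly)" "finite A" "{x. poly p x = 0} \<subseteq> A"
  shows "(\<Sum>x\<in>A. order x p) = degree p"
proof -
  have "degree p = size (proots p)" by (simp add: size_proots_complex)
  also have "\<dots> = (\<Sum>x\<in>set_mset (proots p). count (proots p) x)" by (rule size_multiset_overloaded_eq)
  also have "\<dots> = (\<Sum>x | poly p x = 0. order x p)" using assms(1) by simp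
  also have "\<dots> = (\<Sum>x\<in>A. order x p)"
    using assms by (intro sum.mono_neutral_left) (auto simp: order_root)
  finally show ?thesis ..
qed

locale rational_function =
  fixes p q :: "complex poly"
  assumes q_nonzero: "q \<noteq> 0" and cop: "coprime p q" and deg: "0 < rat_degree p q"
begin

lemma p_nonzero: "p \<noteq> 0"
proof
  assume "p = 0"
  with cop have "is_unit q" by simp
  then have "degree q = 0" by (rule is_unit_polyE) simp
  with \<open>p = 0\<close> deg show False by (simp add: rat_degree_def)
qed

lemma coprime_diff: "coprime (p - q) q"
proof (rule coprimeI)
  fix c assume c: "c dvd p - q" "c dvd q"
  then have "c dvd (p - q) + q" by (rule dvd_add)
  then have "c dvd p" by simp
  then show "is_unit c" using coprime_common_divisor[OF cop] c(2) by simp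
qed

lemma diff_nonzero: "p - q \<noteq> 0"
proof
  assume "p - q = 0"
  then have "p = q" by simp
  with cop have "is_unit q" by simp
  then have "degree q = 0" by (rule is_unit_polyE) simp
  with \<open>p = q\<close> deg show False by (simp add: rat_degree_def)
qed

lemma not_proportional: "smult a p \<noteq> smult b q" if "a \<noteq> 0"
proof
  assume eq: "smult a p = smult b q"
  then have "q dvd smult a p" by (simp add: dvd_smult)
  then have "q dvd p" using that by (simp add: dvd_smult_iff)
  then have "is_unit q" using coprime_common_divisor[OF cop, of q] by simp
  then have q: "degree q = 0" by (rule is_unit_polyE) simp
  have "degree p = degree (smult b q)" using eq[symmetric] that by simp
  then have "degree p = 0" using q degree_smult_le[of b q] by simp
  with q deg show False by (simp add: rat_degree_def)
qed

lemma aff_holomorphic: "aff p q holomorphic_on {x. poly q x \<noteq> 0}"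
  unfolding aff_def[abs_def] by (intro holomorphic_intros) auto

lemma open_nonpoles: "open {x. poly q x \<noteq> 0}"
  by (intro open_Collect_neq continuous_intros)

lemma deriv_aff:
  assumes "poly q x \<noteq> 0"
  shows "deriv (aff p q) x = poly (wronskian p q) x / (poly q x)\<^sup>2"
  unfolding aff_def[abs_def] wronskian_def
  by (rule DERIV_imp_deriv)
    (use assms in \<open>auto intro!: derivative_eq_intros simp: power2_eq_square\<close>)

text \<open>The derivative of \<open>f\<close> is the Wronskian over \<open>q\<^sup>2\<close>; if it vanishes at \<open>x\<close>, then the zero of \<open>f - f x\<close> is not simple.\<close>
lemma ram_ord_pos:
  assumes x: "poly q x \<noteq> 0" and W: "poly (wronskian p q) x = 0"
  shows "0 < ram_ord p q (Fin x)"
proof -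
  let ?f = "\<lambda>w. aff p q (x + w) - aff p q x"
  let ?S = "(\<lambda>w. x + w) -` {x. poly q x \<noteq> 0}"
  have "open ?S" by (intro open_vimage open_nonpoles continuous_intros)
  moreover have "0 \<in> ?S" using x by simp
  ultimately obtain e where e: "e > 0" "ball 0 e \<subseteq> ?S" by (rule openE)
  then have qe: "poly q (x + w) \<noteq> 0" if "w \<in> ball 0 e" for w using that by blast
  have hol: "?f holomorphic_on ball 0 e"
  proof -
    have "(\<lambda>w. x + w) holomorphic_on ball 0 e" by (intro holomorphic_intros)
    then have "(aff p q \<circ> (\<lambda>w. x + w)) holomorphic_on ball 0 e"
      by (rule holomorphic_on_compose_gen[OF _ aff_holomorphic])
        (use e(2) in \<open>simp only: image_subset_iff_subset_vimage\<close>)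
    then have "(\<lambda>w. aff p q (x + w)) holomorphic_on ball 0 e" by (simp add: o_def)
    then show ?thesis by (intro holomorphic_intros)
  qed
  have nc: "\<exists>w\<in>ball 0 e. ?f w \<noteq> 0"
  proof (rule ccontr)
    assume "\<not> ?thesis"
    then have z: "?f w = 0" if "w \<in> ball 0 e" for w using that by blast
    let ?R = "smult (poly q x) p - smult (poly p x) q"
    have "poly ?R y = 0" if "y \<in> ball x e" for y
    proof -
      have "y - x \<in> ball 0 e" using that by (simp add: dist_norm norm_minus_commute)
      then have "aff p q y = aff p q x" "poly q y \<noteq> 0" using z[of "y - x"] qe[of "y - x"] by auto
      then show ?thesis using x by (simp add: aff_def frac_eq_eq mult.commute)
    qed
    then have "ball x e \<subseteq> {y. poly ?R y = 0}" by blast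
    moreover have "?R \<noteq> 0" using not_proportional[OF x] by simp
    ultimately have "finite (ball x e)" using poly_roots_finite finite_subset by blast
    then show False using uncountable_ball[OF e(1), of x] countable_finite by blast
  qed
  define F where "F = ?f"
  have F0: "F 0 = 0" by (simp add: F_def)
  have nc': "\<exists>w\<in>ball 0 e. F w \<noteq> 0" using nc by (simp only: F_def)
  define n where "n = zorder F 0"
  have "0 \<in> ball 0 e" using e(1) by simp
  note Z = zorder_exist_zero[OF hol[folded F_def] open_ball connected_ball this nc',
      unfolded if_P[OF F0], folded n_def]
  obtain r where r: "r > 0" and g: "zor_poly F 0 holomorphic_on cball 0 r"
    and gr: "\<forall>w\<in>cball 0 r. F w = zor_poly F 0 w * (w - 0) ^ nat n \<and> zor_poly F 0 w \<noteq> 0"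
    using conjunct2[OF Z] by (elim exE conjE)
  have n0: "n > 0" by (rule conjunct1[OF Z])
  have "n \<noteq> 1"
  proof
    assume "n = 1"
    let ?g = "zor_poly F 0"
    have "?g holomorphic_on ball 0 r" by (rule holomorphic_on_subset[OF g]) auto
    then have "(?g has_field_derivative deriv ?g 0) (at 0)"
      using r by (intro holomorphic_derivI) auto
    then have "((\<lambda>w. ?g w * w) has_field_derivative ?g 0) (at 0)"
      by (auto intro!: derivative_eq_intros)
    then have "(F has_field_derivative ?g 0) (at 0)"
      by (rule has_field_derivative_transform_within_open[where S = "ball 0 r"])
        (use r gr \<open>n = 1\<close> in auto)
    moreover have "(F has_field_derivative deriv (aff p q) x) (at 0)"
    proof -
      have "(aff p q has_field_derivative deriv (aff p q) x) (at (x + 0))"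
        using holomorphic_derivI[OF aff_holomorphic open_nonpoles] x by simp
      then have "((\<lambda>w. aff p q (x + w)) has_field_derivative deriv (aff p q) x * 1) (at 0)"
        by (rule DERIV_chain2) (auto intro!: derivative_eq_intros)
      then show ?thesis unfolding F_def by (auto intro!: derivative_eq_intros)
    qed
    ultimately have "?g 0 = deriv (aff p q) x" by (rule DERIV_unique)
    also have "\<dots> = 0" using W by (simp add: deriv_aff[OF x])
    finally show False using gr[rule_format, of 0] r by simp
  qed
  then have "n \<ge> 2" using n0 by simp
  then show ?thesis using x by (simp add: ram_ord_def n_def F_def)
qed

definition affine_preimages :: "complex set" where
  "affine_preimages = {x. poly (p * q * (p - q)) x = 0}"

lemma product_nonzero: "p * q * (p - q) \<noteq> 0" using p_nonzero q_nonzero diff_nonzero by simp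

lemma finite_affine_preimages: "finite affine_preimages"
  unfolding affine_preimages_def using product_nonzero by (rule poly_roots_finite)

lemma Fin_in_preimages_iff: "Fin x \<in> preimages p q \<longleftrightarrow> x \<in> affine_preimages"
  by (auto simp: preimages_def marked_def affine_preimages_def aff_def)

lemma order_wronskian_affine_preimage:
  assumes "x \<in> affine_preimages"
  shows "Suc (order x (wronskian p q)) = order x p + order x q + order x (p - q)"
proof -
  from assms consider "poly p x = 0" | "poly q x = 0" | "poly (p - q) x = 0"
    by (auto simp: affine_preimages_def)
  then show ?thesis
  proof cases
    case 1
    then have "poly q x \<noteq> 0" using cop coprime_no_common_root by blast
    then have "order x q = 0" "order x (p - q) = 0" using 1 by (simp_all add: order_0I)
    then show ?thesis using order_wronskian[OF cop p_nonzero 1] by simp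
  next
    case 2
    then have "poly p x \<noteq> 0" using cop coprime_no_common_root by blast
    then have "order x p = 0" "order x (p - q) = 0" using 2 by (simp_all add: order_0I)
    then show ?thesis using order_wronskian[OF _ q_nonzero 2, of p] cop
      by (simp add: coprime_commute wronskian_swap[of q p] order_uminus)
  next
    case 3
    then have q: "poly q x \<noteq> 0" using coprime_diff coprime_no_common_root by blast
    then have "poly p x \<noteq> 0" using 3 by auto
    then have "order x p = 0" "order x q = 0" using q by (simp_all add: order_0I)
    then show ?thesis using order_wronskian[OF coprime_diff diff_nonzero 3] by (simp add: wronskian_diff)
  qed
qed

end

locale belyi_function = rational_function +
  assumes ramified: "\<And>x. 0 < ram_ord p q x \<Longrightarrow> ratmap p q x \<in> marked"
    and inf_marked: "ratmap p q Infty \<in> marked"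
begin

lemma wronskian_nonzero:
  assumes "x \<notin> affine_preimages"
  shows "poly (wronskian p q) x \<noteq> 0"
proof
  assume "poly (wronskian p q) x = 0"
  moreover have "poly q x \<noteq> 0" using assms by (simp add: affine_preimages_def)
  ultimately have "ratmap p q (Fin x) \<in> marked" using ram_ord_pos ramified by blast
  then have "Fin x \<in> preimages p q" unfolding preimages_def by (rule vimageI2)
  then show False using assms by (simp add: Fin_in_preimages_iff)
qed

text \<open>According to the value of \<open>f\<close> at infinity exactly one of \<open>q\<close>, \<open>p\<close> and \<open>p - q\<close> has degree less than the
degree of \<open>f\<close>, and the Wronskian can be formed from that one and a polynomial of full degree.\<close>
lemma wronskian_degree_sum:
  "wronskian p q \<noteq> 0"
  "degree p + degree q + degree (p - q) = degree (wronskian p q) + rat_degree p q + 1"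
proof -
  let ?d = "degree p" and ?e = "degree q"
  consider "?e < ?d" | "?d < ?e" | "?d = ?e" "lead_coeff p = lead_coeff q"
  proof -
    have "?e < ?d \<or> coeff p ?e / lead_coeff q \<in> {0, 1}"
      using inf_marked by (auto simp: marked_def split: if_splits)
    then have "?e < ?d \<or> (?d \<le> ?e \<and> (coeff p ?e = 0 \<or> coeff p ?e = lead_coeff q))"
      using q_nonzero by (auto simp: not_less)
    moreover have "?d < ?e" if "?d \<le> ?e" "coeff p ?e = 0"
      using that p_nonzero by (metis le_neq_implies_less leading_coeff_0_iff)
    moreover have "?d = ?e \<and> lead_coeff p = lead_coeff q" if "?d \<le> ?e" "coeff p ?e = lead_coeff q"
    proof -
      have "coeff p ?e \<noteq> 0" using that q_nonzero by simp
      then have "?e \<le> ?d" by (rule le_degree)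
      with that show ?thesis by simp
    qed
    ultimately show thesis using that by blast
  qed
  then have "wronskian p q \<noteq> 0 \<and> ?d + ?e + degree (p - q) = degree (wronskian p q) + rat_degree p q + 1"
  proof cases
    case 1
    then have "degree (p - q) = ?d" using degree_add_eq_left[of "- q" p] by simp
    with 1 degree_wronskian[OF p_nonzero q_nonzero] show ?thesis by (simp add: rat_degree_def)
  next
    case 2
    then have "degree (p - q) = ?e" using degree_add_eq_right[of p "- q"] by simp
    with 2 degree_wronskian[OF p_nonzero q_nonzero] show ?thesis by (simp add: rat_degree_def)
  next
    case 3
    have e: "?e > 0" using deg 3 by (simp add: rat_degree_def)
    have "coeff (p - q) ?e = 0" using 3 by simp
    moreover have "degree (p - q) \<le> ?e" using 3 by (intro degree_diff_le) auto
    ultimately have "degree (p - q) < ?e" using diff_nonzero e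
      by (metis le_neq_implies_less leading_coeff_0_iff)
    with 3 e degree_wronskian[OF diff_nonzero q_nonzero] show ?thesis by (simp add: rat_degree_def wronskian_diff)
  qed
  then show "wronskian p q \<noteq> 0"
    "degree p + degree q + degree (p - q) = degree (wronskian p q) + rat_degree p q + 1" by auto
qed

text \<open>The Riemann-Hurwitz formula. All roots of the Wronskian are affine preimages by the assumption on the critical
values, and the multiplicity of the root is one less than that of the preimage. Summing over the preimages
gives \<open>deg p + deg q + deg (p - q)\<close> on one side and the degree of the Wronskian plus their number on the other.\<close>
lemma card_affine_preimages: "card affine_preimages = rat_degree p q + 1"
proof -
  note fin = finite_affine_preimages
  have sub: "{x. poly (wronskian p q) x = 0} \<subseteq> affine_preimages"
    using wronskian_nonzero by blast
  have "degree p + degree q + degree (p - q) =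
      (\<Sum>x\<in>affine_preimages. order x p) + (\<Sum>x\<in>affine_preimages. order x q) + (\<Sum>x\<in>affine_preimages. order x (p - q))"
  proof -
    have "{x. poly p x = 0} \<subseteq> affine_preimages" "{x. poly q x = 0} \<subseteq> affine_preimages"
      "{x. poly (p - q) x = 0} \<subseteq> affine_preimages"
      by (auto simp: affine_preimages_def)
    then show ?thesis
      using sum_order_roots_eq_degree[OF p_nonzero fin] sum_order_roots_eq_degree[OF q_nonzero fin] sum_order_roots_eq_degree[OF diff_nonzero fin]
      by simp
  qed
  also have "\<dots> = (\<Sum>x\<in>affine_preimages. Suc (order x (wronskian p q)))"
    by (simp add: order_wronskian_affine_preimage sum.distrib del: sum_Suc cong: sum.cong)
  also have "\<dots> = degree (wronskian p q) + card affine_preimages"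
    using sum_order_roots_eq_degree[OF wronskian_degree_sum(1) fin sub] by (simp add: sum_Suc)
  finally show ?thesis using wronskian_degree_sum(2) by simp
qed

lemma preimages_eq: "preimages p q = insert Infty (Fin ` affine_preimages)"
proof (intro set_eqI)
  fix k show "k \<in> preimages p q \<longleftrightarrow> k \<in> insert Infty (Fin ` affine_preimages)"
    by (cases k) (use inf_marked Fin_in_preimages_iff in \<open>auto simp: preimages_def\<close>)
qed

lemma finite_card_preimages: "finite (preimages p q)" "card (preimages p q) = rat_degree p q + 2"
proof -
  have "card (Fin ` affine_preimages) = rat_degree p q + 1"
    using card_affine_preimages card_image[of Fin affine_preimages] by (simp add: inj_on_def)
  then show "finite (preimages p q)" "card (preimages p q) = rat_degree p q + 2"
    unfolding preimages_eq using finite_affine_preimages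
    by (simp, subst card_insert_disjoint) auto
qed

end

section \<open>Local expansions of the pulled-back tensor\<close>

lemma analytic_extension_of_expansion:
  assumes H: "H holomorphic_on ball 0 e - {0}" and "e > 0" and c: "(H \<longlongrightarrow> c) (at 0)"
    and d: "((\<lambda>u. (H u - c) / u) \<longlongrightarrow> d) (at 0)"
  shows "\<exists>G. G analytic_on {0} \<and> G 0 = c \<and> deriv G 0 = d \<and> (\<forall>\<^sub>F u in at 0. H u = G u)"
proof -
  obtain G where G: "G holomorphic_on ball 0 e" "\<And>z. z \<in> ball 0 e - {0} \<Longrightarrow> G z = H z"
    using holomorphic_on_extend[OF H _ bigo_1_of_tendsto[OF c]] \<open>e > 0\<close> by auto
  have ev: "\<forall>\<^sub>F u in at 0. H u = G u"
    using \<open>e > 0\<close> G(2) by (auto simp: eventually_at dist_norm intro!: exI[of _ e])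
  have dG: "(G has_field_derivative deriv G 0) (at 0)"
    using G(1) \<open>e > 0\<close> by (intro holomorphic_derivI) auto
  have "(G \<longlongrightarrow> G 0) (at 0)" using DERIV_isCont[OF dG] by (simp add: isCont_def)
  moreover have "(G \<longlongrightarrow> c) (at 0)" using c ev by (rule Lim_transform_eventually)
  ultimately have G0: "G 0 = c" by (rule LIM_unique)
  have "((\<lambda>u. (G u - c) / u) \<longlongrightarrow> deriv G 0) (at 0)"
    using dG by (simp add: has_field_derivative_iff G0)
  moreover have "((\<lambda>u. (G u - c) / u) \<longlongrightarrow> d) (at 0)"
    using d by (rule Lim_transform_eventually) (use ev in \<open>auto elim: eventually_mono\<close>)
  ultimately have "deriv G 0 = d" by (rule LIM_unique)
  moreover have "G analytic_on {0}" using G(1) \<open>e > 0\<close> by (auto simp: analytic_on_def)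
  ultimately show ?thesis using G0 ev by blast
qed

lemma double_pole_germ_cong:
  assumes "double_pole_germ F s h" "\<forall>\<^sub>F u in at 0. F' u = F u" "s = s'" "h = h'"
  shows "double_pole_germ F' s' h'"
proof -
  obtain M where M: "M analytic_on {0}" "M 0 = s" "deriv M 0 = h" and FM: "\<forall>\<^sub>F u in at 0. F u = M u / u\<^sup>2"
    using assms(1) unfolding double_pole_germ_def by blast
  have "\<forall>\<^sub>F u in at 0. F' u = M u / u\<^sup>2"
    using assms(2) FM by eventually_elim simp
  with M show ?thesis using assms(3,4) unfolding double_pole_germ_def by blast
qed

lemma double_pole_germ_bigo:
  assumes "double_pole_germ F s h"
  shows "(\<lambda>u. F u - (s / u\<^sup>2 + h / u)) \<in> O[at 0](\<lambda>_. 1)"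
proof -
  obtain M where M: "M analytic_on {0}" "M 0 = s" "deriv M 0 = h" and FM: "\<forall>\<^sub>F u in at 0. F u = M u / u\<^sup>2"
    using assms unfolding double_pole_germ_def by blast
  obtain e where e: "e > 0" "M holomorphic_on ball 0 e" using M(1) by (rule analytic_at_ball)
  define M1 where "M1 z = (if z = 0 then deriv M 0 else (M z - M 0) / (z - 0))" for z
  have "M1 holomorphic_on ball 0 e"
    unfolding M1_def[abs_def] using e(2) by (rule pole_lemma_open) simp
  then have "(M1 has_field_derivative deriv M1 0) (at 0)" using e(1) by (intro holomorphic_derivI) auto
  then have "((\<lambda>u. (M1 u - M1 0) / u) \<longlongrightarrow> deriv M1 0) (at 0)"
    by (simp add: has_field_derivative_iff)
  moreover have "\<forall>\<^sub>F u in at 0. (M1 u - M1 0) / u = F u - (s / u\<^sup>2 + h / u)"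
    using FM eventually_neq_at_within[of 0 0 UNIV]
    by eventually_elim (simp add: M1_def M power2_eq_square field_simps)
  ultimately have "((\<lambda>u. F u - (s / u\<^sup>2 + h / u)) \<longlongrightarrow> deriv M1 0) (at 0)"
    by (rule Lim_transform_eventually)
  then show ?thesis by (rule bigo_1_of_tendsto)
qed

lemma filterlim_chart: "filterlim (chart k) (pnhd k) (at 0)"
proof (cases k)
  case (Fin a)
  have "filterlim (\<lambda>u. a + u) (at a) (at 0)"
    by (auto simp: filterlim_at eventually_at_filter intro!: tendsto_eq_intros)
  moreover have "chart k = (\<lambda>u. a + u)" by (simp add: Fin fun_eq_iff)
  ultimately show ?thesis by (simp add: Fin)
next
  case Infty
  have "chart k = inverse" by (simp add: Infty fun_eq_iff divide_inverse)
  then show ?thesis using filterlim_inverse_at_infinity by (simp add: Infty)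
qed

lemma lparam_chart: "u \<noteq> 0 \<Longrightarrow> lparam k (chart k u) = u"
  by (cases k) auto

lemma eventually_pnhd_avoids_finite:
  assumes "finite S"
  shows "\<forall>\<^sub>F x in pnhd k. x \<notin> S"
proof (cases k)
  case (Fin a)
  have "open (- (S - {a}))" using assms by (intro open_Compl finite_imp_closed finite_Diff)
  moreover have "a \<in> - (S - {a})" by simp
  ultimately have "\<forall>\<^sub>F x in nhds a. x \<in> - (S - {a})" by (rule eventually_nhds_in_open)
  then show ?thesis by (auto simp: Fin eventually_at_filter elim: eventually_mono)
next
  case Infty
  obtain b where "\<And>a. a \<in> S \<Longrightarrow> cmod a \<le> b"
    using finite_imp_bounded[OF assms] bounded_iff by blast
  then have "x \<notin> S" if "b + 1 \<le> cmod x" for x using that by force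
  then show ?thesis by (auto simp: Infty eventually_at_infinity)
qed

text \<open>A rational function in the charts centred at \<open>k\<close> and at its value. At a pole the coordinate of the target is the
reciprocal, which turns an expansion with \<open>c\<close> and \<open>d/c\<close> into one with \<open>1/c\<close> and \<open>- d/c\<close>.\<close>
definition local_map :: "complex poly \<Rightarrow> complex poly \<Rightarrow> csphere \<Rightarrow> complex \<Rightarrow> complex" where
  "local_map p q k u = lparam (ratmap p q k) (aff p q (chart k u))"

definition local_coeff :: "complex poly \<Rightarrow> complex poly \<Rightarrow> csphere \<Rightarrow> complex \<Rightarrow> complex" where
  "local_coeff p q k c = (if ratmap p q k = Infty then 1 / c else c)"

definition local_slope :: "complex poly \<Rightarrow> complex poly \<Rightarrow> csphere \<Rightarrow> complex \<Rightarrow> complex" where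
  "local_slope p q k \<delta> = (if ratmap p q k = Infty then - \<delta> else \<delta>)"

text \<open>The expansion determines the limit and the difference quotient at 0 of the local map divided by its power of
\<open>u\<close>, hence value and derivative of the analytic extension.\<close>
lemma local_map_expansion:
  assumes L: "leading_expansion p q k c d"
    and hol: "local_map p q k holomorphic_on ball 0 e - {0}" and e: "e > 0"
  shows "\<exists>G. G analytic_on {0} \<and> G 0 = local_coeff p q k c \<and>
     deriv G 0 / G 0 = local_slope p q k (d / c) \<and> G 0 \<noteq> 0 \<and>
     (\<forall>\<^sub>F u in at 0. local_map p q k u = u ^ (ram_ord p q k + 1) * G u)"
proof -
  define m where "m = ram_ord p q k + 1"
  from L obtain R where c: "c \<noteq> 0" and R: "R \<in> O[pnhd k](\<lambda>x. lparam k x ^ 2)"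
    and ex: "case ratmap p q k of
          Fin v \<Rightarrow> (\<forall>\<^sub>F x in pnhd k. aff p q x - v =
                     c * lparam k x ^ m * (1 + d / c * lparam k x + R x))
        | Infty \<Rightarrow> (\<forall>\<^sub>F x in pnhd k. aff p q x =
                     c / lparam k x ^ m * (1 + d / c * lparam k x + R x))"
    unfolding leading_expansion_def m_def by blast
  define E where "E u = 1 + d / c * u + R (chart k u)" for u
  have nz: "\<forall>\<^sub>F u in at 0. u \<noteq> (0::complex)" by (rule eventually_neq_at_within)
  have "(\<lambda>u. R (chart k u)) \<in> O[at 0](\<lambda>u. lparam k (chart k u) ^ 2)"
    using R filterlim_chart by (rule landau_o.big.compose)
  also have "(\<lambda>u. lparam k (chart k u) ^ 2) \<in> \<Theta>[at 0](\<lambda>u. u ^ 2)"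
    by (rule bigthetaI_cong) (use nz in \<open>auto elim!: eventually_mono simp: lparam_chart\<close>)
  finally have RO: "(\<lambda>u. R (chart k u)) \<in> O[at 0](\<lambda>u. u ^ 2)" .
  have small: "(\<lambda>u. u ^ 2) \<in> o[at 0](\<lambda>u::complex. u)"
    by (rule smalloI_tendsto) (use nz in \<open>auto simp: power2_eq_square intro!: tendsto_eq_intros Lim_transform_eventually[OF tendsto_ident_at] elim!: eventually_mono\<close>)
  have Ru: "((\<lambda>u. R (chart k u) / u) \<longlongrightarrow> 0) (at 0)"
    using landau_o.big_small_trans[OF RO small] by (rule smalloD_tendsto)
  have Eu: "((\<lambda>u. (E u - 1) / u) \<longlongrightarrow> d / c) (at 0)"
  proof -
    have "((\<lambda>u. d / c + R (chart k u) / u) \<longlongrightarrow> d / c + 0) (at 0)" by (intro tendsto_intros Ru)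
    moreover have "\<forall>\<^sub>F u in at 0. d / c + R (chart k u) / u = (E u - 1) / u"
      using nz by eventually_elim (simp add: E_def add_divide_distrib)
    ultimately have "((\<lambda>u. (E u - 1) / u) \<longlongrightarrow> d / c + 0) (at 0)" by (rule Lim_transform_eventually)
    then show ?thesis by (simp only: add_0_right)
  qed
  have E1: "(E \<longlongrightarrow> 1) (at 0)"
  proof -
    have "((\<lambda>u. 1 + u * ((E u - 1) / u)) \<longlongrightarrow> 1 + 0 * (d / c)) (at 0)" by (intro tendsto_intros Eu)
    moreover have "\<forall>\<^sub>F u in at 0. 1 + u * ((E u - 1) / u) = E u"
      using nz by eventually_elim simp
    ultimately have "(E \<longlongrightarrow> 1 + 0 * (d / c)) (at 0)" by (rule Lim_transform_eventually)
    then show ?thesis by (simp only: mult_zero_left add_0_right)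
  qed
  define H where "H u = local_map p q k u / u ^ m" for u
  have hH: "H holomorphic_on ball 0 e - {0}"
    unfolding H_def by (intro holomorphic_intros hol) auto
  have "(H \<longlongrightarrow> local_coeff p q k c) (at 0) \<and>
    ((\<lambda>u. (H u - local_coeff p q k c) / u) \<longlongrightarrow> local_coeff p q k c * local_slope p q k (d / c)) (at 0)"
  proof (cases "ratmap p q k")
    case (Fin v)
    then have "\<forall>\<^sub>F x in pnhd k. aff p q x - v = c * lparam k x ^ m * (1 + d / c * lparam k x + R x)"
      using ex by simp
    from eventually_compose_filterlim[OF this filterlim_chart] nz
    have HE: "\<forall>\<^sub>F u in at 0. c * E u = H u"
      by eventually_elim (simp add: H_def local_map_def Fin E_def lparam_chart)
    have "((\<lambda>u. c * E u) \<longlongrightarrow> c * 1) (at 0)" by (intro tendsto_intros E1)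
    then have 1: "(H \<longlongrightarrow> c) (at 0)" using Lim_transform_eventually[OF _ HE] by simp
    have "((\<lambda>u. c * ((E u - 1) / u)) \<longlongrightarrow> c * (d / c)) (at 0)" by (intro tendsto_intros Eu)
    moreover have "\<forall>\<^sub>F u in at 0. c * ((E u - 1) / u) = (H u - c) / u"
      using HE by eventually_elim (simp add: algebra_simps)
    ultimately have "((\<lambda>u. (H u - c) / u) \<longlongrightarrow> c * (d / c)) (at 0)"
      by (rule Lim_transform_eventually)
    with 1 show ?thesis by (simp add: local_coeff_def local_slope_def Fin)
  next
    case Infty
    then have "\<forall>\<^sub>F x in pnhd k. aff p q x = c / lparam k x ^ m * (1 + d / c * lparam k x + R x)"
      using ex by simp
    from eventually_compose_filterlim[OF this filterlim_chart] nz
    have HE: "\<forall>\<^sub>F u in at 0. 1 / (c * E u) = H u"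
      by eventually_elim (simp add: H_def local_map_def Infty E_def lparam_chart)
    have "((\<lambda>u. 1 / (c * E u)) \<longlongrightarrow> 1 / (c * 1)) (at 0)" using c by (intro tendsto_intros E1) auto
    then have 1: "(H \<longlongrightarrow> 1 / c) (at 0)" using Lim_transform_eventually[OF _ HE] by simp
    have "((\<lambda>u. - (1 / (c * E u)) * ((E u - 1) / u)) \<longlongrightarrow> - (1 / (c * 1)) * (d / c)) (at 0)"
      using c by (intro tendsto_intros Eu E1) auto
    moreover have "\<forall>\<^sub>F u in at 0. - (1 / (c * E u)) * ((E u - 1) / u) = (H u - 1 / c) / u"
    proof -
      have "\<forall>\<^sub>F u in at 0. E u \<noteq> 0" using E1 by (rule tendsto_imp_eventually_ne) simp
      then show ?thesis using HE nz
      proof eventually_elim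
        case (elim u)
        then show ?case unfolding elim(2)[symmetric] using c by (simp add: field_simps)
      qed
    qed
    ultimately have "((\<lambda>u. (H u - 1 / c) / u) \<longlongrightarrow> - (1 / (c * 1)) * (d / c)) (at 0)"
      by (rule Lim_transform_eventually)
    with 1 show ?thesis by (simp add: local_coeff_def local_slope_def Infty)
  qed
  from analytic_extension_of_expansion[OF hH e conjunct1[OF this] conjunct2[OF this]]
  obtain G where G: "G analytic_on {0}" "G 0 = local_coeff p q k c"
    "deriv G 0 = local_coeff p q k c * local_slope p q k (d / c)" "\<forall>\<^sub>F u in at 0. H u = G u"
    by blast
  have "G 0 \<noteq> 0" using c G(2) by (simp add: local_coeff_def)
  moreover have "deriv G 0 / G 0 = local_slope p q k (d / c)"
    using \<open>G 0 \<noteq> 0\<close> G(2,3) by simp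
  moreover have "\<forall>\<^sub>F u in at 0. local_map p q k u = u ^ m * G u"
    using G(4) nz by eventually_elim (simp add: H_def field_simps)
  ultimately show ?thesis using G(1,2) unfolding m_def by blast
qed

context belyi_function
begin

abbreviation "f \<equiv> aff p q"

definition pullback_stress :: "(csphere \<Rightarrow> real) \<Rightarrow> complex \<Rightarrow> complex" where
  "pullback_stress \<beta> x = base_stress \<beta> (f x) * (deriv f x)\<^sup>2 + schwarzian f x"

lemma open_regular: "open (- affine_preimages)"
  using finite_affine_preimages by (simp add: finite_imp_closed open_Compl)

lemma regular_point:
  assumes "x \<in> - affine_preimages"
  shows "poly q x \<noteq> 0" "f x \<notin> {0, 1}" "deriv f x \<noteq> 0"
proof -
  show q: "poly q x \<noteq> 0" using assms by (simp add: affine_preimages_def)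
  then show "f x \<notin> {0, 1}" using assms by (auto simp: affine_preimages_def aff_def)
  show "deriv f x \<noteq> 0" using q assms wronskian_nonzero by (simp add: deriv_aff)
qed

lemma f_holomorphic: "f holomorphic_on - affine_preimages"
  by (rule holomorphic_on_subset[OF aff_holomorphic]) (use regular_point(1) in auto)

text \<open>With \<open>g\<close> for the local map, \<open>f \<circ> chart k = chart j \<circ> g\<close>. The cocycle rule for both sides shows that the
Schwarzian terms of \<open>f\<close> and \<open>g\<close> correspond, since those of the charts vanish.\<close>
lemma chart_pullback_stress_eq:
  assumes A: "open A" "0 \<notin> A" and reg: "\<And>u. u \<in> A \<Longrightarrow> chart k u \<in> - affine_preimages" and u: "u \<in> A"
    and j: "ratmap p q k = j" "j \<in> marked"
  shows "local_map p q k holomorphic_on A"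
    and "chart_pullback k (pullback_stress \<beta>) u =
      chart_pullback j (base_stress \<beta>) (local_map p q k u) * (deriv (local_map p q k) u)\<^sup>2
       + schwarzian (local_map p q k) u"
proof -
  let ?g = "local_map p q k"
  have hk: "chart k holomorphic_on A" by (rule holomorphic_on_subset[OF chart_holomorphic]) (use A in auto)
  have hfk: "(\<lambda>u. f (chart k u)) holomorphic_on A"
    using holomorphic_on_compose_gen[OF hk f_holomorphic] reg by (auto simp: o_def)
  have f01: "f (chart k u) \<noteq> 0" "f (chart k u) \<noteq> 1" if "u \<in> A" for u
    using regular_point(2)[OF reg[OF that]] by auto
  show hg: "?g holomorphic_on A"
  proof (cases j)
    case (Fin v)
    then have "?g = (\<lambda>u. f (chart k u) - v)" by (simp add: local_map_def fun_eq_iff j)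
    then show ?thesis using hfk by (auto intro!: holomorphic_intros)
  next
    case Infty
    then have "?g = (\<lambda>u. 1 / f (chart k u))" by (simp add: local_map_def fun_eq_iff j)
    then show ?thesis using hfk f01 by (auto intro!: holomorphic_intros)
  qed
  have g0: "?g u \<in> - {0}" if "u \<in> A" for u
    using f01[OF that] j by (cases j) (auto simp: local_map_def marked_def)
  have eq: "chart j (?g u) = f (chart k u)" for u
    by (cases j) (simp_all add: local_map_def j)
  have k': "deriv (chart k) u \<noteq> 0" if "u \<in> A" for u using that A deriv_chart_nonzero by metis
  have o0: "open (- {0 :: complex})" by (simp add: open_Compl)
  have d1: "deriv (\<lambda>u. f (chart k u)) u = deriv f (chart k u) * deriv (chart k) u" if "u \<in> A" for u
    by (rule deriv_compose(1)[OF A(1) open_regular f_holomorphic hk reg that])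
  have d2: "deriv (\<lambda>u. f (chart k u)) u = deriv (chart j) (?g u) * deriv ?g u" if "u \<in> A" for u
    using deriv_compose(1)[OF A(1) o0 chart_holomorphic hg g0 that, of j] by (simp add: eq)
  have g': "deriv ?g u \<noteq> 0" if "u \<in> A" for u
    using d1[OF that] d2[OF that] k'[OF that] regular_point(3)[OF reg[OF that]] by auto
  have S1: "schwarzian (\<lambda>u. f (chart k u)) u = schwarzian f (chart k u) * (deriv (chart k) u)\<^sup>2 + schwarzian (chart k) u"
    by (rule schwarzian_compose[OF A(1) open_regular f_holomorphic hk reg regular_point(3) k' u])
  have "schwarzian (\<lambda>u. chart j (?g u)) u = schwarzian (chart j) (?g u) * (deriv ?g u)\<^sup>2 + schwarzian ?g u"
    by (rule schwarzian_compose[OF A(1) o0 chart_holomorphic hg g0 _ g' u]) (use deriv_chart_nonzero in auto)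
  then have S2: "schwarzian (\<lambda>u. f (chart k u)) u = schwarzian (chart j) (?g u) * (deriv ?g u)\<^sup>2 + schwarzian ?g u"
    by (simp add: eq)
  have u0: "u \<noteq> 0" using u A by auto
  have S: "schwarzian f (chart k u) * (deriv (chart k) u)\<^sup>2 = schwarzian ?g u"
    using S1 S2 schwarzian_chart[OF u0] schwarzian_chart[of "?g u" j] g0[OF u] by simp
  have "chart_pullback k (pullback_stress \<beta>) u = base_stress \<beta> (f (chart k u)) * (deriv f (chart k u) * deriv (chart k) u)\<^sup>2
      + schwarzian f (chart k u) * (deriv (chart k) u)\<^sup>2"
    by (simp add: chart_pullback_def pullback_stress_def power_mult_distrib algebra_simps)
  also have "deriv f (chart k u) * deriv (chart k) u = deriv (chart j) (?g u) * deriv ?g u"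
    using d1[OF u] d2[OF u] by simp
  also have "base_stress \<beta> (f (chart k u)) * (deriv (chart j) (?g u) * deriv ?g u)\<^sup>2 =
      chart_pullback j (base_stress \<beta>) (?g u) * (deriv ?g u)\<^sup>2"
    by (simp add: chart_pullback_def eq power_mult_distrib)
  finally show "chart_pullback k (pullback_stress \<beta>) u = chart_pullback j (base_stress \<beta>) (?g u) * (deriv ?g u)\<^sup>2
       + schwarzian ?g u"
    by (simp only: S)
qed

text \<open>The four formulas for the accessory parameter in one: the weight of the order \<open>B\<close> is \<open>- B (B + 2)\<close>, and for
multiplicity 1 it is the weight of the target.\<close>
definition accessory :: "(csphere \<Rightarrow> real) \<Rightarrow> csphere \<Rightarrow> complex \<Rightarrow> complex \<Rightarrow> complex" where
  "accessory \<beta> k c d =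
     local_slope p q k (d / c) * of_real (weight (pullback_order p q \<beta> k)) / of_nat (ram_ord p q k + 1)
      + (if ram_ord p q k = 0 then local_coeff p q k c * of_real (base_accessory \<beta> (ratmap p q k)) else 0)"

text \<open>In terms of cone angles the weight is \<open>1 - (b + 1)\<^sup>2\<close>, and \<open>b + 1\<close> is multiplied by the multiplicity.\<close>
lemma weight_pullback:
  "weight (pullback_order p q \<beta> k) =
     weight (\<beta> (ratmap p q k)) * (real (ram_ord p q k + 1))\<^sup>2 + 1 - (real (ram_ord p q k + 1))\<^sup>2"
proof -
  have "- (m * (b + 1) - 1) * (m * (b + 1) - 1 + 2) = - b * (b + 2) * m\<^sup>2 + 1 - m\<^sup>2" for m b :: real
    by (simp add: power2_eq_square algebra_simps)
  then show ?thesis unfolding weight_def pullback_order_def by blast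
qed

lemma pullback_stress_germ:
  assumes L: "leading_expansion p q k c d" and k: "k \<in> preimages p q"
  shows "double_pole_germ (chart_pullback k (pullback_stress \<beta>))
    (of_real (weight (pullback_order p q \<beta> k)) / 2) (accessory \<beta> k c d)"
proof -
  define j where "j = ratmap p q k"
  have j: "j \<in> marked" using k by (simp add: preimages_def j_def)
  define m where "m = ram_ord p q k + 1"
  have "\<forall>\<^sub>F u in at 0. chart k u \<in> - affine_preimages"
    using eventually_compose_filterlim[OF eventually_pnhd_avoids_finite[OF finite_affine_preimages] filterlim_chart]
    by simp
  then obtain e where e: "e > 0" "\<And>u. u \<in> ball 0 e - {0} \<Longrightarrow> chart k u \<in> - affine_preimages"
    by (auto simp: eventually_at dist_norm)
  let ?A = "ball 0 e - {0 :: complex}" and ?g = "local_map p q k"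
  have A: "open ?A" "0 \<notin> ?A" by (auto intro: open_delete)
  have "of_real (e / 2) \<in> ?A" using e(1) by auto
  then have hol: "?g holomorphic_on ?A"
    using chart_pullback_stress_eq(1)[OF A e(2) _ j_def[symmetric] j] by blast
  obtain G where G: "G analytic_on {0}" "G 0 = local_coeff p q k c"
    "deriv G 0 / G 0 = local_slope p q k (d / c)" "G 0 \<noteq> 0" "\<forall>\<^sub>F u in at 0. ?g u = u ^ m * G u"
    using local_map_expansion[OF L hol e(1)] unfolding m_def by blast
  have m1: "m \<ge> 1" by (simp add: m_def)
  have germ: "double_pole_germ (\<lambda>u. chart_pullback j (base_stress \<beta>) (?g u) * (deriv ?g u)\<^sup>2 + schwarzian ?g u)
    (of_real (weight (\<beta> j)) / 2 * of_nat m ^ 2 + (1 - of_nat m ^ 2) / 2)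
     (2 * (of_real (weight (\<beta> j)) / 2) * of_nat m * (deriv G 0 / G 0) + (if m = 1 then G 0 * of_real (base_accessory \<beta> j) else 0)
        - (of_nat m ^ 2 - 1) / of_nat m * (deriv G 0 / G 0))"
    by (rule double_pole_germ_compose[OF base_stress_germ[OF j] m1 G(1,4,5)])
  have w: "complex_of_real (weight (pullback_order p q \<beta> k)) = of_real (weight (\<beta> j)) * of_nat m ^ 2 + 1 - of_nat m ^ 2"
    unfolding weight_pullback j_def m_def by simp
  have eq_s: "of_real (weight (\<beta> j)) / 2 * of_nat m ^ 2 + (1 - of_nat m ^ 2) / 2 = complex_of_real (weight (pullback_order p q \<beta> k)) / 2"
    unfolding w by (simp add: field_simps)
  have eq_h: "2 * (of_real (weight (\<beta> j)) / 2) * of_nat m * (deriv G 0 / G 0) + (if m = 1 then G 0 * of_real (base_accessory \<beta> j) else 0)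
        - (of_nat m ^ 2 - 1) / of_nat m * (deriv G 0 / G 0) = accessory \<beta> k c d"
  proof -
    have "2 * (W / 2) * n * \<delta> + X - (n ^ 2 - 1) / n * \<delta> = \<delta> * (W * n ^ 2 + 1 - n ^ 2) / n + X"
      if "n \<noteq> 0" for W n \<delta> X :: complex
      using that by (simp add: field_simps power2_eq_square)
    note eq = this
    have acc: "accessory \<beta> k c d = local_slope p q k (d / c) * of_real (weight (pullback_order p q \<beta> k)) / of_nat m
       + (if m = 1 then G 0 * of_real (base_accessory \<beta> j) else 0)"
      by (simp add: accessory_def m_def G(2) j_def)
    show ?thesis unfolding acc w G(3) by (rule eq) (use m1 in simp)
  qed
  have eq_F: "\<forall>\<^sub>F u in at 0. chart_pullback k (pullback_stress \<beta>) u =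
      chart_pullback j (base_stress \<beta>) (?g u) * (deriv ?g u)\<^sup>2 + schwarzian ?g u"
  proof -
    have "\<forall>\<^sub>F u in at 0. u \<in> ?A"
      using e(1) by (auto simp: eventually_at dist_norm intro!: exI[of _ e])
    then show ?thesis
      by eventually_elim (rule chart_pullback_stress_eq(2)[OF A e(2) _ j_def[symmetric] j])
  qed
  show ?thesis by (rule double_pole_germ_cong[OF germ eq_F eq_s eq_h])
qed

lemma pullback_stress_holomorphic: "pullback_stress \<beta> holomorphic_on - affine_preimages"
proof -
  have "(base_stress \<beta> \<circ> f) holomorphic_on - affine_preimages"
    by (rule holomorphic_on_compose_gen[OF f_holomorphic base_stress_holomorphic]) (use regular_point(2) in auto)
  then have "(\<lambda>x. base_stress \<beta> (f x)) holomorphic_on - affine_preimages" by (simp add: o_def)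
  moreover have "schwarzian f holomorphic_on - affine_preimages"
    unfolding schwarzian_def[abs_def]
    by (intro holomorphic_intros holomorphic_deriv pre_schwarzian_holomorphic f_holomorphic open_regular regular_point(3)) auto
  ultimately show ?thesis
    unfolding pullback_stress_def[abs_def]
    by (intro holomorphic_on_add holomorphic_on_mult holomorphic_on_power holomorphic_deriv f_holomorphic open_regular)
qed

text \<open>The difference of the two sides is holomorphic at the preimages because the germs there have these principal
parts, and both sides tend to 0 at infinity; it vanishes by Liouville's theorem.\<close>
lemma pullback_stress_partial_fractions:
  assumes L: "\<And>k. k \<in> preimages p q \<Longrightarrow> leading_expansion p q k (c k) (d k)" and x: "x \<notin> affine_preimages"
  shows "pullback_stress \<beta> x = (\<Sum>a\<in>affine_preimages.
      of_real (weight (pullback_order p q \<beta> (Fin a))) / (2 * (x - a)\<^sup>2) + accessory \<beta> (Fin a) (c (Fin a)) (d (Fin a)) / (x - a))"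
    and "(\<lambda>x. pullback_stress \<beta> x - (of_real (weight (pullback_order p q \<beta> Infty)) / (2 * x\<^sup>2)
       + accessory \<beta> Infty (c Infty) (d Infty) / x ^ 3)) \<in> O[at_infinity](\<lambda>x. 1 / x ^ 4)"
proof -
  let ?V = "pullback_stress \<beta>"
  define s where "s k = complex_of_real (weight (pullback_order p q \<beta> k))" for k
  define h where "h k = accessory \<beta> k (c k) (d k)" for k
  define t where "t a x = s (Fin a) / (2 * (x - a)\<^sup>2) + h (Fin a) / (x - a)" for a x
  have germ: "(\<lambda>u. chart_pullback k ?V u - (s k / 2 / u\<^sup>2 + h k / u)) \<in> O[at 0](\<lambda>_. 1)" if "k \<in> preimages p q" for k
    using double_pole_germ_bigo[OF pullback_stress_germ[OF L[OF that] that]] by (simp add: s_def h_def)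
  have inv: "filterlim inverse (at 0) (at_infinity :: complex filter)"
    by (simp add: filterlim_inverse_at_iff filterlim_ident)
  show inf: "(\<lambda>x. ?V x - (of_real (weight (pullback_order p q \<beta> Infty)) / (2 * x\<^sup>2)
       + accessory \<beta> Infty (c Infty) (d Infty) / x ^ 3)) \<in> O[at_infinity](\<lambda>x. 1 / x ^ 4)"
  proof -
    have nz: "\<forall>\<^sub>F x in at_infinity. x \<noteq> (0::complex)"
      by (auto simp: eventually_at_infinity intro!: exI[of _ 1])
    have "Infty \<in> preimages p q" using inf_marked by (simp add: preimages_def)
    from landau_o.big.compose[OF germ[OF this] inv]
    have "(\<lambda>x. chart_pullback Infty ?V (inverse x) - (s Infty / 2 / (inverse x)\<^sup>2 + h Infty / inverse x)) \<in> O[at_infinity](\<lambda>_. 1)" .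
    then have "(\<lambda>x. 1 / x ^ 4 * (chart_pullback Infty ?V (inverse x) - (s Infty / 2 / (inverse x)\<^sup>2 + h Infty / inverse x)))
       \<in> O[at_infinity](\<lambda>x. 1 / x ^ 4 * 1)" by (intro landau_o.big.mult) auto
    moreover have "\<forall>\<^sub>F x in at_infinity. 1 / x ^ 4 * (chart_pullback Infty ?V (inverse x) - (s Infty / 2 / (inverse x)\<^sup>2 + h Infty / inverse x))
      = ?V x - (s Infty / (2 * x\<^sup>2) + h Infty / x ^ 3)"
      using nz by eventually_elim (simp add: chart_pullback_simps field_simps eval_nat_numeral)
    ultimately show ?thesis
      unfolding s_def h_def by (simp only: mult_1_right) (rule landau_o.big.in_cong[THEN iffD1], assumption+)
  qed
  have "?V x - (\<Sum>a\<in>affine_preimages. t a x) = 0"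
  proof (rule eq_zero_of_removable_singularities[where f = "\<lambda>x. ?V x - (\<Sum>a\<in>affine_preimages. t a x)", OF _ finite_affine_preimages _ _ x])
    show "(\<lambda>x. ?V x - (\<Sum>a\<in>affine_preimages. t a x)) holomorphic_on - affine_preimages"
      unfolding t_def by (intro holomorphic_intros pullback_stress_holomorphic) auto
    fix a assume a: "a \<in> affine_preimages"
    have "filterlim (\<lambda>x. x - a) (at 0) (at a)"
      by (auto simp: filterlim_at eventually_at_filter intro!: tendsto_eq_intros)
    moreover have "Fin a \<in> preimages p q" using a by (simp add: Fin_in_preimages_iff)
    ultimately have "(\<lambda>x. chart_pullback (Fin a) ?V (x - a) - (s (Fin a) / 2 / (x - a)\<^sup>2 + h (Fin a) / (x - a))) \<in> O[at a](\<lambda>_. 1)"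
      using landau_o.big.compose[OF germ] by blast
    then have 1: "(\<lambda>x. ?V x - t a x) \<in> O[at a](\<lambda>_. 1)"
      by (simp add: chart_pullback_simps t_def)
    have 2: "(\<lambda>x. \<Sum>b\<in>affine_preimages - {a}. t b x) \<in> O[at a](\<lambda>_. 1)"
    proof (rule bigo_1_of_tendsto)
      show "((\<lambda>x. \<Sum>b\<in>affine_preimages - {a}. t b x) \<longlongrightarrow> (\<Sum>b\<in>affine_preimages - {a}. t b a)) (at a)"
        unfolding t_def by (intro tendsto_intros) auto
    qed
    have "(\<lambda>x. (?V x - t a x) - (\<Sum>b\<in>affine_preimages - {a}. t b x)) \<in> O[at a](\<lambda>_. 1)"
      using 1 2 by (rule sum_in_bigo)
    moreover have "(\<Sum>b\<in>affine_preimages. t b x) = t a x + (\<Sum>b\<in>affine_preimages - {a}. t b x)" for x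
      using a finite_affine_preimages by (rule sum.remove[rotated])
    ultimately show "(\<lambda>x. ?V x - (\<Sum>a\<in>affine_preimages. t a x)) \<in> O[at a](\<lambda>_. 1)"
      by (simp add: diff_diff_eq)
  next
    have inv_pow: "((\<lambda>x::complex. c / x ^ n) \<longlongrightarrow> 0) at_infinity" if "n > 0" for c n
    proof -
      have "((\<lambda>x::complex. c * inverse x ^ n) \<longlongrightarrow> c * 0 ^ n) at_infinity"
        by (intro tendsto_intros tendsto_inverse_0)
      then show ?thesis using that by (simp add: divide_inverse power_inverse zero_power)
    qed
    have "((\<lambda>x. ?V x - (s Infty / (2 * x\<^sup>2) + h Infty / x ^ 3)) \<longlongrightarrow> 0) at_infinity"
    proof -
      have "(\<lambda>x::complex. 1 / x ^ 4) \<in> o[at_infinity](\<lambda>_. 1)"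
        by (rule smalloI_tendsto) (use inv_pow[of 4 1] in auto)
      from landau_o.big_small_trans[OF inf this] show ?thesis
        unfolding s_def h_def by (auto dest: smalloD_tendsto)
    qed
    moreover have "((\<lambda>x. s Infty / 2 / x ^ 2 + h Infty / x ^ 3) \<longlongrightarrow> 0 + 0) at_infinity"
      by (intro tendsto_add inv_pow) auto
    ultimately have "((\<lambda>x. ?V x - (s Infty / (2 * x\<^sup>2) + h Infty / x ^ 3) + (s Infty / 2 / x ^ 2 + h Infty / x ^ 3)) \<longlongrightarrow> 0 + (0 + 0)) at_infinity"
      by (rule tendsto_add)
    then have V0: "(?V \<longlongrightarrow> 0) at_infinity" by simp
    have t0: "(t a \<longlongrightarrow> 0) at_infinity" for a
    proof -
      have "filterlim (\<lambda>x. - a + x) at_infinity at_infinity"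
        by (rule tendsto_add_filterlim_at_infinity[OF tendsto_const filterlim_ident])
      then have sh: "filterlim (\<lambda>x. x - a) at_infinity at_infinity" by simp
      have "((\<lambda>x. s (Fin a) / 2 / (x - a) ^ 2 + h (Fin a) / (x - a) ^ 1) \<longlongrightarrow> 0 + 0) at_infinity"
        by (intro tendsto_add filterlim_compose[OF inv_pow sh]) auto
      then show ?thesis unfolding t_def[abs_def] by simp
    qed
    have "((\<lambda>x. ?V x - (\<Sum>a\<in>affine_preimages. t a x)) \<longlongrightarrow> 0 - (\<Sum>a\<in>affine_preimages. 0)) at_infinity"
      by (intro tendsto_diff tendsto_sum V0 t0)
    then show "((\<lambda>x. ?V x - (\<Sum>a\<in>affine_preimages. t a x)) \<longlongrightarrow> 0) at_infinity" by simp
  qed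
  then show "?V x = (\<Sum>a\<in>affine_preimages.
      of_real (weight (pullback_order p q \<beta> (Fin a))) / (2 * (x - a)\<^sup>2) + accessory \<beta> (Fin a) (c (Fin a)) (d (Fin a)) / (x - a))"
    by (simp add: t_def s_def h_def)
qed

end

lemma metric_potential_liouville:
  assumes "metric_potential \<beta> \<phi>"
  shows "\<exists>P Q. liouville (2 * pi * (total_order \<beta> + 2)) (UNIV - {0, 1}) \<phi> P Q"
proof (rule liouville_of_smooth)
  show "open (UNIV - {0, 1 :: complex})" by (intro open_Diff open_UNIV finite_imp_closed) auto
  show "smooth_on (UNIV - {0, 1}) \<phi>" using assms unfolding metric_potential_def by blast
  show "complex_of_real (exp (- 2 * \<phi> z)) * (- 4 * wirtinger (wirtinger_bar (\<lambda>w. complex_of_real (\<phi> w))) z) =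
      complex_of_real (2 * pi * (total_order \<beta> + 2))" if "z \<in> UNIV - {0, 1}" for z
    using assms that unfolding metric_potential_def by blast
qed

lemma (in belyi_function) stress_energy_pullback:
  assumes \<beta>: "\<forall>j\<in>marked. \<beta> j > -1" and \<phi>: "metric_potential \<beta> \<phi>" and x: "x \<notin> affine_preimages"
  shows "stress_energy (pullback_potential p q \<phi>) x = pullback_stress \<beta> x"
proof -
  obtain P Q where L: "liouville (2 * pi * (total_order \<beta> + 2)) (UNIV - {0, 1}) \<phi> P Q"
    using metric_potential_liouville[OF \<phi>] by blast
  have sub: "f z \<in> UNIV - {0, 1}" if "z \<in> - affine_preimages" for z using regular_point(2)[OF that] by simp
  have eq: "pullback_potential p q \<phi> = (\<lambda>z. \<phi> (f z) + ln (cmod (deriv f z)))"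
    by (simp add: fun_eq_iff pullback_potential_def)
  have x': "x \<in> - affine_preimages" using x by simp
  note pb = liouville_pullback[OF L open_regular f_holomorphic sub regular_point(3)]
  have "stress_energy (pullback_potential p q \<phi>) x = 2 * (Q (f x) - (P (f x))\<^sup>2) * (deriv f x)\<^sup>2 + schwarzian f x"
    unfolding eq using liouville_stress_energy[OF pb(1) x'] pb(2)[OF _ _ x'] by simp
  also have "2 * (Q (f x) - (P (f x))\<^sup>2) = base_stress \<beta> (f x)"
    by (rule three_point_stress[OF \<beta> \<phi> L]) (use regular_point(2)[OF x'] in simp)
  finally show ?thesis by (simp add: pullback_stress_def)
qed

theorem lemma4p1:
  fixes p q :: "complex poly"
    and \<beta> :: "csphere \<Rightarrow> real"
    and \<phi> :: "complex \<Rightarrow> real"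
    and c d :: "csphere \<Rightarrow> complex"
  assumes "admissible_orders \<beta>"
    and "metric_potential \<beta> \<phi>"
    and "belyi p q"
    and "ratmap p q Infty \<in> marked"
    and "\<forall>k\<in>preimages p q. leading_expansion p q k (c k) (d k)"
  shows "finite (preimages p q) \<and> card (preimages p q) = rat_degree p q + 2 \<and>
    (\<exists>h :: csphere \<Rightarrow> complex.
      (\<forall>x. Fin x \<notin> preimages p q \<longrightarrow>
         stress_energy (pullback_potential p q \<phi>) x =
           (\<Sum>a | Fin a \<in> preimages p q.
              of_real (weight (pullback_order p q \<beta> (Fin a))) / (2 * (x - a)\<^sup>2)
              + h (Fin a) / (x - a))) \<and>
      (\<lambda>x. stress_energy (pullback_potential p q \<phi>) x
           - (of_real (weight (pullback_order p q \<beta> Infty)) / (2 * x\<^sup>2) + h Infty / x ^ 3))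
        \<in> O[at_infinity](\<lambda>x. 1 / x ^ 4) \<and>
      (\<forall>k\<in>preimages p q. ratmap p q k \<noteq> Infty \<longrightarrow>
         h k = (if ram_ord p q k = 0
                then d k / c k * of_real (weight (\<beta> (ratmap p q k)))
                     + c k * of_real (base_accessory \<beta> (ratmap p q k))
                else - (d k / c k)
                     * of_real (pullback_order p q \<beta> k * (pullback_order p q \<beta> k + 2)
                                / real (ram_ord p q k + 1)))) \<and>
      (\<forall>k\<in>preimages p q. ratmap p q k = Infty \<longrightarrow>
         h k = (if ram_ord p q k = 0
                then - (d k / c k) * of_real (weight (\<beta> Infty))
                     + 1 / c k * of_real (base_accessory \<beta> Infty)
                else d k / c k
                     * of_real (pullback_order p q \<beta> k * (pullback_order p q \<beta> k + 2)
                                / real (ram_ord p q k + 1)))))"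
proof -
  interpret belyi_function p q
    using assms(3,4) by unfold_locales (auto simp: belyi_def)
  have \<beta>: "\<forall>j\<in>marked. \<beta> j > -1" using assms(1) by (simp add: admissible_orders_def)
  note T = stress_energy_pullback[OF \<beta> assms(2)]
  have L: "leading_expansion p q k (c k) (d k)" if "k \<in> preimages p q" for k
    using assms(5) that by blast
  define h where "h k = accessory \<beta> k (c k) (d k)" for k
  have set_eq: "{a. Fin a \<in> preimages p q} = affine_preimages"
    by (simp add: Fin_in_preimages_iff)
  have 2: "(\<lambda>x. stress_energy (pullback_potential p q \<phi>) x
           - (of_real (weight (pullback_order p q \<beta> Infty)) / (2 * x\<^sup>2) + h Infty / x ^ 3))
        \<in> O[at_infinity](\<lambda>x. 1 / x ^ 4)"
  proof -
    have "\<forall>\<^sub>F x in at_infinity. x \<notin> affine_preimages"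
      using eventually_pnhd_avoids_finite[OF finite_affine_preimages, of Infty] by simp
    then have ev: "\<forall>\<^sub>F x in at_infinity. pullback_stress \<beta> x
           - (of_real (weight (pullback_order p q \<beta> Infty)) / (2 * x\<^sup>2) + h Infty / x ^ 3)
         = stress_energy (pullback_potential p q \<phi>) x
           - (of_real (weight (pullback_order p q \<beta> Infty)) / (2 * x\<^sup>2) + h Infty / x ^ 3)"
      by eventually_elim (simp add: T)
    obtain x0 where x0: "x0 \<notin> affine_preimages"
      using ex_new_if_finite[OF infinite_UNIV_char_0 finite_affine_preimages] by blast
    have big: "(\<lambda>x. pullback_stress \<beta> x - (of_real (weight (pullback_order p q \<beta> Infty)) / (2 * x\<^sup>2) + h Infty / x ^ 3))
        \<in> O[at_infinity](\<lambda>x. 1 / x ^ 4)"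
      using pullback_stress_partial_fractions(2)[OF L x0] unfolding h_def by blast
    show ?thesis by (rule landau_o.big.in_cong[THEN iffD1, OF ev big])
  qed
  have unram: "pullback_order p q \<beta> k = \<beta> (ratmap p q k)" if "ram_ord p q k = 0" for k
    using that by (simp add: pullback_order_def)
  have weight_minus: "weight b = - (b * (b + 2))" for b by (simp add: weight_def)
  show ?thesis
  proof (intro conjI exI[of _ h] allI ballI impI)
    fix x assume "Fin x \<notin> preimages p q"
    then show "stress_energy (pullback_potential p q \<phi>) x =
        (\<Sum>a | Fin a \<in> preimages p q.
           of_real (weight (pullback_order p q \<beta> (Fin a))) / (2 * (x - a)\<^sup>2) + h (Fin a) / (x - a))"
      using T pullback_stress_partial_fractions(1)[OF L]
      by (simp add: set_eq h_def Fin_in_preimages_iff)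
  qed (use finite_card_preimages 2 in
      \<open>simp_all add: h_def accessory_def local_slope_def local_coeff_def weight_minus unram\<close>)
qed

end
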